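(* Let $\zeta\in\{0,\infty\}$, assume that $V$ satisfies Condition (C1) near $\zeta$, and let $\tilde W(r)$ be the corresponding (radial) Wolff potential around $\zeta$ (see context). (I) Suppose that $u$ is a positive subsolution of $Q'(v):=-\Delta_p(v)+V|v|^{p-2}v=0$ in a punctured neighborhood of $\zeta$ satisfying one of the following conditions: 1.1: $\zeta=0$, $p>d$ and $\lim_{x\to0}u(x)=0$; 1.2: $\zeta=0$, $p\le d$ and $\lim_{x\to0}u(x)=\infty$; 1.3: $\zeta=\infty$, $p\ge d$ and $\lim_{x\to\infty}u(x)=\infty$; 1.4: $\zeta=\infty$, $p<d$ and $\lim_{x\to\infty}u(x)=0$. Let $M(r):=\sup_{x\in S_r}u(x)$. Then for $\zeta=0$ (respectively, $\zeta=\infty$) there is $R_2>0$ such that for every $0<r_2<R_2$ (respectively, $r_2>R_2$) there exists $R_1(r_2)$ with $0<R_1(r_2)<r_2$ (respectively, $R_1(r_2)>r_2$) such that for every $r_1$ with $0<r_1<R_1(r_2)$ (respectively, $r_1>R_1(r_2)$) the inequality $$M(r_3)\le M(r_1)\frac{\tilde W(r_2)-\tilde W(r_3)}{\tilde W(r_2)-\tilde W(r_1)}+M(r_2)\frac{\tilde W(r_3)-\tilde W(r_1)}{\tilde W(r_2)-\tilde W(r_1)}$$ holds for all $r_3\in(r_1,r_2)$ (respectively, $r_3\in(r_2,r_1)$). Moreover, $M$ is monotone near $\zeta$. (II) Suppose that $u$ is a positive supersolution of $Q'(v)=0$ in a punctured neighborhood of $\zeta$ satisfying one of the following conditions: 2.1: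 $\zeta=0$, $p>d$ and $\lim_{x\to0}u(x)=\infty$; 2.2: $\zeta=0$, $p\le d$ and $\lim_{x\to0}u(x)=0$; 2.3: $\zeta=\infty$, $p\ge d$ and $\lim_{x\to\infty}u(x)=0$; 2.4: $\zeta=\infty$, $p<d$ and $\lim_{x\to\infty}u(x)=\infty$. Let $m(r):=\inf_{x\in S_r}u(x)$. Then for $\zeta=0$ (respectively, $\zeta=\infty$) there is $R_2>0$ such that for every $0<r_2<R_2$ (respectively, $r_2>R_2$) there exists $R_1(r_2)$ with $0<R_1(r_2)<r_2$ (respectively, $R_1(r_2)>r_2$) such that for every $r_1$ with $0<r_1<R_1(r_2)$ (respectively, $r_1>R_1(r_2)$) the inequality $$m(r_1)\frac{\tilde W(r_2)-\tilde W(r_3)}{\tilde W(r_2)-\tilde W(r_1)}+m(r_2)\frac{\tilde W(r_3)-\tilde W(r_1)}{\tilde W(r_2)-\tilde W(r_1)}\le m(r_3)$$ holds for all $r_3\in(r_1,r_2)$ (respectively, $r_3\in(r_2,r_1)$). Moreover, $m$ is monotone near $\zeta$.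
   Context: Setting: $1<p<\infty$, $d\ge 2$ an integer, $\Delta_p(u)=\operatorname{div}(|\nabla u|^{p-2}\nabla u)$, $B_R\subset\mathbb{R}^d$ the open ball of radius $R$ centered at $0$, $S_r$ the sphere of radius $r$ centered at $0$, $B_R^*:=\mathbb{R}^d\setminus\overline{B_R}$. Either $\zeta=0$ and $\Omega=B_R$, or $\zeta=\infty$ and $\Omega=B_R^*$; $V\in L^\infty_{\mathrm{loc}}(\Omega\setminus\{\zeta\})$ is real valued. A punctured neighborhood of $0$ (resp. $\infty$) is an open set containing $B_r\setminus\{0\}$ (resp. $B_r^*$) for some $r>0$ and not containing $\zeta$. A supersolution (resp. subsolution) of $Q'(v)=0$ in an open set $D$ is a function $v\in C^1(D)$ with $\int_D(|\nabla v|^{p-2}\nabla v\cdot\nabla\varphi+V|v|^{p-2}v\varphi)\,dx\ge0$ (resp. $\le0$) for all nonnegative $\varphi\in C_0^\infty(D)$. Condition (C1) near $\zeta$: near $\zeta$, $|V(x)|\le G(|x|)=g(|x|)/|x|^p$, where $g:\mathbb{R}_+\to\mathbb{R}_+$ is positive, bounded and continuous, and $$\left|\int_\zeta^1\left|t^{1-d}\int_a^t\frac{g(s)}{s^p}s^{d-1}\,ds\right|^{\frac1{p-1}}dt\right|<\infty,$$ where $a=\zeta$ in the classical cases ($\zeta=0$ with $p\le d$, or $\zeta=\infty$ with $p\ge d$) and $a=1$ in the nonclassical cases ($\zeta=0$ with $p>d$, or $\zeta=\infty$ with $p<d$). The Wolff potential of $G$ around $\zeta$ is (with the same $a$) $$\tilde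 W(r):=\left|\int_\zeta^{r}\left|t^{1-d}\int_a^t\frac{g(s)}{s^p}s^{d-1}\,ds\right|^{\frac1{p-1}}dt\right|,$$ considered for $r$ near $\zeta$. *)

theory Defs
  imports "HOL-Analysis.Analysis"
begin

text \<open>\<open>\<zeta>\<close> is only ever \<open>0\<close> or \<open>\<infinity>\<close>, so the else-branches below concern \<open>\<zeta> = \<infinity>\<close>, where removing
  \<open>\<zeta>\<close> from a set of finite points removes nothing.\<close>

definition Omega_minus_zeta :: "ereal \<Rightarrow> real \<Rightarrow> 'a::euclidean_space set"
  where "Omega_minus_zeta \<zeta> R = (if \<zeta> = 0 then ball 0 R - {0} else - cball 0 R)"

definition punctured_nbhd :: "ereal \<Rightarrow> 'a::euclidean_space set \<Rightarrow> bool"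
  where "punctured_nbhd \<zeta> D \<longleftrightarrow> open D \<and>
    (if \<zeta> = 0 then 0 \<notin> D \<and> (\<exists>r>0. ball 0 r - {0} \<subseteq> D) else (\<exists>r>0. - cball 0 r \<subseteq> D))"

definition Linf_loc :: "'a::euclidean_space set \<Rightarrow> ('a \<Rightarrow> real) \<Rightarrow> bool"
  where "Linf_loc S V \<longleftrightarrow> V \<in> borel_measurable (lebesgue_on S) \<and>
    (\<forall>K. compact K \<and> K \<subseteq> S \<longrightarrow> (\<exists>C. AE x in lebesgue. x \<in> K \<longrightarrow> \<bar>V x\<bar> \<le> C))"

text \<open>\<open>C\<^sup>k(S)\<close> for an open set \<open>S\<close>: the partial derivatives of order at most \<open>k\<close> exist, the functions
  being totally differentiable at each stage, and are continuous.\<close>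

primrec Ck_on :: "nat \<Rightarrow> 'a::euclidean_space set \<Rightarrow> ('a \<Rightarrow> real) \<Rightarrow> bool" where
  "Ck_on 0 S f \<longleftrightarrow> continuous_on S f"
| "Ck_on (Suc k) S f \<longleftrightarrow> (\<forall>x\<in>S. f differentiable at x) \<and>
     (\<forall>b\<in>Basis. Ck_on k S (\<lambda>x. frechet_derivative f (at x) b))"

text \<open>Elements of \<open>C\<^sub>0\<^sup>\<infinity>(D)\<close> are taken to be extended by zero to the whole space.\<close>

definition test_function :: "'a::euclidean_space set \<Rightarrow> ('a \<Rightarrow> real) \<Rightarrow> bool"
  where "test_function D \<phi> \<longleftrightarrow> (\<forall>k. Ck_on k UNIV \<phi>) \<and>
    compact (closure {x. \<phi> x \<noteq> 0}) \<and> closure {x. \<phi> x \<noteq> 0} \<subseteq> D"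

definition grad :: "('a::euclidean_space \<Rightarrow> real) \<Rightarrow> 'a \<Rightarrow> 'a"
  where "grad f x = (THE w. GDERIV f x :> w)"

lemma GDERIV_grad:
  assumes "f differentiable at x"
  shows "GDERIV f x :> grad f x"
proof -
  let ?D = "frechet_derivative f (at x)"
  have D: "(f has_derivative ?D) (at x)"
    using assms frechet_derivative_works by blast
  have eq: "?D h = inner h (adjoint ?D 1)" for h
    using adjoint_works[OF has_derivative_linear[OF D], of h 1] by (simp add: inner_commute)
  have "GDERIV f x :> adjoint ?D 1"
    unfolding gderiv_def using D eq by (metis (no_types, lifting) has_derivative_eq_rhs ext)
  moreover have "w = w'" if "GDERIV f x :> w" "GDERIV f x :> w'" for w w'
  proof -
    have "(\<lambda>h. inner h w) = (\<lambda>h. inner h w')"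
      using that has_derivative_unique unfolding gderiv_def by blast
    then show ?thesis by (metis inner_commute vector_eq_rdot)
  qed
  ultimately show ?thesis unfolding grad_def by (metis theI)
qed

text \<open>The weak form of \<open>Q'(v) = - \<Delta>\<^sub>p(v) + V |v|\<^sup>p\<^sup>-\<^sup>2 v\<close> tested against \<open>\<phi>\<close>. At points where the
  gradient (or \<open>v\<close>) vanishes, the convention \<open>0 powr a = 0\<close> gives the customary value \<open>0\<close> of
  \<open>|\<nabla>v|\<^sup>p\<^sup>-\<^sup>2 \<nabla>v\<close> for all \<open>p > 1\<close>. The integrand is integrable whenever \<open>v\<close> is \<open>C\<^sup>1\<close> on \<open>D\<close>, \<open>\<phi>\<close> is
  a test function on \<open>D\<close> and \<open>V\<close> is locally bounded on \<open>D\<close>.\<close>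

definition weak_form :: "real \<Rightarrow> ('a::euclidean_space \<Rightarrow> real) \<Rightarrow> 'a set \<Rightarrow> ('a \<Rightarrow> real) \<Rightarrow> ('a \<Rightarrow> real) \<Rightarrow> real"
  where "weak_form p V D v \<phi> =
    (LINT x:D|lebesgue. norm (grad v x) powr (p - 2) * inner (grad v x) (grad \<phi> x)
       + V x * \<bar>v x\<bar> powr (p - 2) * v x * \<phi> x)"

definition supersolution :: "real \<Rightarrow> ('a::euclidean_space \<Rightarrow> real) \<Rightarrow> 'a set \<Rightarrow> ('a \<Rightarrow> real) \<Rightarrow> bool"
  where "supersolution p V D v \<longleftrightarrow> Ck_on 1 D v \<and>
    (\<forall>\<phi>. test_function D \<phi> \<and> (\<forall>x. 0 \<le> \<phi> x) \<longrightarrow> 0 \<le> weak_form p V D v \<phi>)"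

definition subsolution :: "real \<Rightarrow> ('a::euclidean_space \<Rightarrow> real) \<Rightarrow> 'a set \<Rightarrow> ('a \<Rightarrow> real) \<Rightarrow> bool"
  where "subsolution p V D v \<longleftrightarrow> Ck_on 1 D v \<and>
    (\<forall>\<phi>. test_function D \<phi> \<and> (\<forall>x. 0 \<le> \<phi> x) \<longrightarrow> weak_form p V D v \<phi> \<le> 0)"

text \<open>The base point \<open>a\<close> of the inner integral: \<open>\<zeta>\<close> in the classical cases, \<open>1\<close> in the others.\<close>

definition wolff_base :: "real \<Rightarrow> nat \<Rightarrow> ereal \<Rightarrow> ereal"
  where "wolff_base p d \<zeta> =
    (if (\<zeta> = 0 \<and> p \<le> real d) \<or> (\<zeta> = \<infinity> \<and> p \<ge> real d) then \<zeta> else 1)"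

definition wolff_inner :: "real \<Rightarrow> nat \<Rightarrow> (real \<Rightarrow> real) \<Rightarrow> real \<Rightarrow> real"
  where "wolff_inner p d g s = g s / s powr p * s ^ (d - 1)"

definition wolff_integrand :: "real \<Rightarrow> nat \<Rightarrow> ereal \<Rightarrow> (real \<Rightarrow> real) \<Rightarrow> real \<Rightarrow> real"
  where "wolff_integrand p d \<zeta> g t =
    \<bar>t powr (1 - real d) * (LBINT s=wolff_base p d \<zeta>..ereal t. wolff_inner p d g s)\<bar> powr (1 / (p - 1))"

definition wolff_potential :: "real \<Rightarrow> nat \<Rightarrow> ereal \<Rightarrow> (real \<Rightarrow> real) \<Rightarrow> real \<Rightarrow> real"
  where "wolff_potential p d \<zeta> g r = \<bar>LBINT t=\<zeta>..ereal r. wolff_integrand p d \<zeta> g t\<bar>"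

text \<open>All integrands are nonnegative, so finiteness of the double integral means that the inner
  integrals and the outer integral converge; this has to be said explicitly, since a divergent
  integral has value \<open>0\<close> in the library. The bound on \<open>V\<close> holds almost everywhere, as \<open>V\<close> is an element
  of \<open>L\<^sup>\<infinity>\<close>.\<close>

definition condition_C1 :: "real \<Rightarrow> ereal \<Rightarrow> (real \<Rightarrow> real) \<Rightarrow> ('a::euclidean_space \<Rightarrow> real) \<Rightarrow> bool"
  where "condition_C1 p \<zeta> g V \<longleftrightarrow>
    (\<forall>s>0. 0 < g s) \<and> bounded (g ` {0<..}) \<and> continuous_on {0<..} g \<and>
    (\<exists>U::'a set. punctured_nbhd \<zeta> U \<and>
       (AE x in lebesgue. x \<in> U \<longrightarrow> \<bar>V x\<bar> \<le> g (norm x) / norm x powr p)) \<and>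
    (\<forall>t. ereal t \<in> {min \<zeta> 1<..<max \<zeta> 1} \<longrightarrow>
       interval_lebesgue_integrable lborel (wolff_base p DIM('a) \<zeta>) (ereal t) (wolff_inner p DIM('a) g)) \<and>
    interval_lebesgue_integrable lborel \<zeta> 1 (wolff_integrand p DIM('a) \<zeta> g)"

end

theory Submission
  imports Defs
begin

text \<open>Near \<open>\<zeta>\<close> the Wolff potential \<open>W\<close>, as a radial function, solves \<open>\<Delta>\<^sub>p W = \<sigma> G\<close> with \<open>\<sigma> = 1\<close> in the
  classical and \<open>\<sigma> = - 1\<close> in the nonclassical cases. Hence \<open>v = A + B W\<close> satisfies
  \<open>\<Delta>\<^sub>p v = - |B|\<^sup>p\<^sup>-\<^sup>1 G\<close> whenever \<open>\<sigma> B < 0\<close>, and a subsolution \<open>u\<close> with \<open>u \<le> |B|\<close> on an annulus satisfies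
  \<open>\<Delta>\<^sub>p u \<ge> - G u\<^sup>p\<^sup>-\<^sup>1 \<ge> \<Delta>\<^sub>p v\<close> there; so \<open>u \<le> v\<close> on the two boundary spheres extends to the annulus.
  If \<open>v\<close> interpolates \<open>M\<close> at \<open>r\<^sub>1\<close> and \<open>r\<^sub>2\<close>, this is the three-spheres inequality. The bound
  \<open>u \<le> |B|\<close> holds for \<open>r\<^sub>1\<close> close to \<open>\<zeta>\<close>, because \<open>W\<close> tends to \<open>0\<close> at \<open>\<zeta>\<close> and therefore
  \<open>|B| \<ge> 4 |M(r\<^sub>2) - M(r\<^sub>1)|\<close>. Supersolutions are treated by the same comparison with the
  inequalities reversed.\<close>

section \<open>Smooth bump functions\<close>

text \<open>As V may change sign, a comparison principle for Q' itself is not at hand. Only the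
  p-Laplacians of u and v are compared, and the term V u^(p-1) is absorbed by the right-hand side of
  the equation of v. This needs the bound by |B| only at points violating the desired inequality.
  For supersolutions such points satisfy u < v, and v is at most the larger boundary value, so
  boundary data suffice. For subsolutions they satisfy u > v, and the spherical maximum has to be
  controlled inside the annulus beforehand; hence the continuity of M and the intermediate value
  argument. The sign condition on B prescribes whether M rises or falls towards \<zeta>; the limit
  conditions in the four cases supply exactly this. The factor 4 is the reciprocal of the bound 1/4
  imposed on W near \<zeta>. It is large enough because the intermediate value argument yields an
  increment of at least a quarter of the maximum. The weak inequalities are stated for smooth test
  functions, whereas the comparison needs one built from u, which is only C^1. Bumps and
  mollification serve to close this gap.\<close>

text \<open>\<open>flat_deriv n\<close> is the \<open>n\<close>-th derivative of \<open>t \<mapsto> exp (- 1 / t)\<close>, extended by \<open>0\<close> to \<open>t \<le> 0\<close>.\<close>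

primrec flat_poly :: "nat \<Rightarrow> real poly" where
  "flat_poly 0 = 1"
| "flat_poly (Suc n) = monom 1 2 * (flat_poly n - pderiv (flat_poly n))"

definition flat_deriv :: "nat \<Rightarrow> real \<Rightarrow> real" where
  "flat_deriv n t = (if 0 < t then poly (flat_poly n) (1 / t) * exp (- (1 / t)) else 0)"

lemma poly_times_exp_minus_tendsto_0:
  fixes P :: "real poly"
  shows "((\<lambda>y. poly P y * exp (- y)) \<longlongrightarrow> 0) at_top"
proof -
  have "((\<lambda>y. \<Sum>i\<le>degree P. coeff P i * (y ^ i / exp y)) \<longlongrightarrow> (\<Sum>i\<le>degree P. coeff P i * 0)) at_top"
    by (intro tendsto_sum tendsto_mult tendsto_const tendsto_power_div_exp_0)
  moreover have "(\<lambda>y. poly P y * exp (- y)) = (\<lambda>y. \<Sum>i\<le>degree P. coeff P i * (y ^ i / exp y))"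
    by (simp add: poly_altdef fun_eq_iff sum_distrib_right exp_minus divide_inverse mult.assoc)
  ultimately show ?thesis by simp
qed

lemma flat_deriv_has_derivative: "(flat_deriv n has_real_derivative flat_deriv (Suc n) t) (at t)"
proof (cases t "0 :: real" rule: linorder_cases)
  case less
  have "((\<lambda>_. 0 :: real) has_real_derivative flat_deriv (Suc n) t) (at t)"
    using less by (simp add: flat_deriv_def)
  then show ?thesis
    by (rule has_field_derivative_transform_within_open[where S = "{..<0}"])
       (use less in \<open>auto simp: flat_deriv_def\<close>)
next
  case greater
  have "((\<lambda>t. poly (flat_poly n) (1 / t) * exp (- (1 / t))) has_real_derivative
      flat_deriv (Suc n) t) (at t)"
    using greater
    by (auto intro!: derivative_eq_intros poly_DERIV[THEN DERIV_chain2]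
        simp: flat_deriv_def poly_monom field_simps power2_eq_square)
  then show ?thesis
    by (rule has_field_derivative_transform_within_open[where S = "{0<..}"])
       (use greater in \<open>auto simp: flat_deriv_def\<close>)
next
  case equal
  \<comment> \<open>The right difference quotient at 0 is \<open>poly ?P y * exp (- y)\<close> at y
    = 1/h; the extra factor y stands for the division by h.\<close>
  let ?P = "monom 1 1 * flat_poly n"
  have inv: "filterlim (\<lambda>t::real. 1 / t) at_top (at_right 0)"
    using filterlim_inverse_at_top_right by (simp add: inverse_eq_divide)
  have "((\<lambda>t. poly ?P (1 / t) * exp (- (1 / t))) \<longlongrightarrow> 0) (at_right 0)"
    by (rule filterlim_compose[OF poly_times_exp_minus_tendsto_0 inv])
  then have R: "((\<lambda>h. (flat_deriv n h - flat_deriv n 0) / (h - 0)) \<longlongrightarrow> 0) (at_right 0)"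
    by (rule Lim_transform_eventually)
       (auto simp: eventually_at_filter flat_deriv_def poly_monom)
  have L: "((\<lambda>h. (flat_deriv n h - flat_deriv n 0) / (h - 0)) \<longlongrightarrow> 0) (at_left 0)"
    by (rule Lim_transform_eventually[OF tendsto_const])
       (auto simp: eventually_at_filter flat_deriv_def)
  have "(flat_deriv n has_real_derivative 0) (at 0)"
    unfolding has_field_derivative_iff using L R by (simp add: filterlim_at_split)
  then show ?thesis using equal by (simp add: flat_deriv_def)
qed

section \<open>Closure properties of C^k functions on the whole space\<close>

lemma Ck_on_add:
  "Ck_on k UNIV f \<Longrightarrow> Ck_on k UNIV g \<Longrightarrow> Ck_on k UNIV (\<lambda>x. f x + g x)"
proof (induction k arbitrary: f g)
  case 0
  then show ?case by (auto intro: continuous_intros)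
next
  case (Suc k)
  have "frechet_derivative (\<lambda>x. f x + g x) (at x) b =
      frechet_derivative f (at x) b + frechet_derivative g (at x) b" for x b
  proof -
    have "((\<lambda>x. f x + g x) has_derivative
        (\<lambda>h. frechet_derivative f (at x) h + frechet_derivative g (at x) h)) (at x)"
      using Suc.prems(1,2)[unfolded Ck_on.simps, THEN conjunct1, THEN bspec, OF UNIV_I, of x]
      by (intro has_derivative_add) (simp_all only: frechet_derivative_works)
    from fun_cong[OF frechet_derivative_at[OF this], of b] show ?thesis by (rule sym)
  qed
  then show ?case using Suc by simp
qed

text \<open>The product rule leaves one factor undifferentiated, so the induction for products has
  to lower the order of that factor. The base case is continuity of differentiable
  functions.\<close>

lemma Ck_on_SucD: "Ck_on (Suc k) S f \<Longrightarrow> Ck_on k S f"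
proof (induction k arbitrary: f)
  case 0
  then show ?case
    using continuous_at_imp_continuous_on differentiable_imp_continuous_within by fastforce
next
  case (Suc k)
  then show ?case unfolding Ck_on.simps(2)[of "Suc k"] Ck_on.simps(2)[of k S f] by blast
qed

lemma Ck_on_mult:
  "Ck_on k UNIV f \<Longrightarrow> Ck_on k UNIV g \<Longrightarrow> Ck_on k UNIV (\<lambda>x. f x * g x)"
proof (induction k arbitrary: f g)
  case 0
  then show ?case by (auto intro: continuous_intros)
next
  case (Suc k)
  have "frechet_derivative (\<lambda>x. f x * g x) (at x) b =
      f x * frechet_derivative g (at x) b + frechet_derivative f (at x) b * g x" for x b
  proof -
    have "((\<lambda>x. f x * g x) has_derivative
        (\<lambda>h. f x * frechet_derivative g (at x) h + frechet_derivative f (at x) h * g x)) (at x)"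
      using Suc.prems(1,2)[unfolded Ck_on.simps, THEN conjunct1, THEN bspec, OF UNIV_I, of x]
      by (intro has_derivative_mult) (simp_all only: frechet_derivative_works)
    from fun_cong[OF frechet_derivative_at[OF this], of b] show ?thesis by (rule sym)
  qed
  moreover have "Ck_on k UNIV f" "Ck_on k UNIV g"
    using Suc.prems by (blast intro: Ck_on_SucD)+
  ultimately show ?case
    using Suc by (auto intro!: Ck_on_add)
qed

lemma Ck_on_const: "Ck_on k UNIV (\<lambda>_. c)"
  by (induction k arbitrary: c) (auto simp: frechet_derivative_const)

lemma Ck_on_inner_const: "Ck_on k UNIV (\<lambda>x. inner x b)"
proof (cases k)
  case (Suc j)
  have "((\<lambda>x. inner x b) has_derivative (\<lambda>h. inner h b)) (at x)" for x
    by (auto intro!: derivative_eq_intros)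
  then have "frechet_derivative (\<lambda>x. inner x b) (at x) = (\<lambda>h. inner h b)"
    "(\<lambda>x. inner x b) differentiable at x" for x
    by (metis frechet_derivative_at, metis differentiableI)
  then show ?thesis using Suc by (simp add: Ck_on_const)
qed (auto intro: continuous_intros)

lemma flat_deriv_radial_has_derivative:
  "((\<lambda>x::'a::euclidean_space. flat_deriv n (c - inner x x)) has_derivative
    (\<lambda>h. flat_deriv (Suc n) (c - inner x x) * (- 2 * inner x h))) (at x)"
proof -
  have "((\<lambda>x::'a. c - inner x x) has_derivative (\<lambda>h. 0 - (inner x h + inner h x))) (at x)"
    by (intro has_derivative_diff has_derivative_const has_derivative_inner has_derivative_ident)
  then have "((\<lambda>x::'a. c - inner x x) has_derivative (\<lambda>h. - 2 * inner x h)) (at x)"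
    by (simp add: inner_commute)
  from has_derivative_compose[OF this
      flat_deriv_has_derivative[THEN has_field_derivative_imp_has_derivative]]
  show ?thesis .
qed

text \<open>The index n stays arbitrary in the induction on k: a partial derivative of the function
  of index n is the one of index n + 1 times a linear function.\<close>

lemma Ck_on_flat: "Ck_on k UNIV (\<lambda>x::'a::euclidean_space. flat_deriv n (c - inner x x))"
proof (induction k arbitrary: n)
  case 0
  have "isCont (\<lambda>x::'a. flat_deriv n (c - inner x x)) x" for x
    using flat_deriv_radial_has_derivative by (rule has_derivative_continuous)
  then show ?case by (simp add: continuous_on_eq_continuous_within)
next
  case (Suc k)
  have "frechet_derivative (\<lambda>x::'a. flat_deriv n (c - inner x x)) (at x) =
      (\<lambda>h. flat_deriv (Suc n) (c - inner x x) * (- 2 * inner x h))" for x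
    using frechet_derivative_at[OF flat_deriv_radial_has_derivative[of n c x]] by (rule sym)
  moreover have "Ck_on k UNIV (\<lambda>x::'a. flat_deriv (Suc n) (c - inner x x) * (- 2 * inner x b))" for b
    by (intro Ck_on_mult Suc.IH Ck_on_const Ck_on_inner_const)
  moreover have "(\<lambda>x::'a. flat_deriv n (c - inner x x)) differentiable at x" for x
    using flat_deriv_radial_has_derivative by (rule differentiableI)
  ultimately show ?case by simp
qed

section \<open>Smooth functions, gradients and normalised bumps\<close>

definition smooth :: "('a::euclidean_space \<Rightarrow> real) \<Rightarrow> bool" where
  "smooth f \<longleftrightarrow> (\<forall>k. Ck_on k UNIV f)"

lemma smooth_continuous: "smooth f \<Longrightarrow> continuous_on UNIV f"
  unfolding smooth_def by (metis Ck_on.simps(1))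

lemma smooth_differentiable: "smooth f \<Longrightarrow> f differentiable at x"
  unfolding smooth_def by (metis Ck_on.simps(2) UNIV_I)

lemma smooth_partial: "smooth f \<Longrightarrow> b \<in> Basis \<Longrightarrow> smooth (\<lambda>x. frechet_derivative f (at x) b)"
  unfolding smooth_def by (metis Ck_on.simps(2))

lemma smooth_GDERIV: "smooth f \<Longrightarrow> GDERIV f x :> grad f x"
  by (simp add: GDERIV_grad smooth_differentiable)

lemma frechet_derivative_grad:
  assumes "f differentiable at x"
  shows "frechet_derivative f (at x) h = inner h (grad f x)"
  using GDERIV_grad[OF assms] frechet_derivative_at unfolding gderiv_def by metis

lemma grad_eqI: "GDERIV f x :> w \<Longrightarrow> grad f x = w"
proof -
  assume w: "GDERIV f x :> w"
  then have "f differentiable at x" unfolding gderiv_def by (rule differentiableI)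
  from GDERIV_grad[OF this] w have "(\<lambda>h. inner h w) = (\<lambda>h. inner h (grad f x))"
    unfolding gderiv_def by (metis has_derivative_unique)
  then show ?thesis by (metis inner_commute vector_eq_rdot)
qed

lemma Ck_on_1_grad_continuous:
  assumes "Ck_on 1 D u"
  shows "continuous_on D (grad u)"
proof -
  have "continuous_on D (\<lambda>x. \<Sum>b\<in>Basis. frechet_derivative u (at x) b *\<^sub>R b)"
    using assms by (auto intro!: continuous_intros)
  moreover have "(\<Sum>b\<in>Basis. frechet_derivative u (at x) b *\<^sub>R b) = grad u x" if "x \<in> D" for x
  proof -
    have "u differentiable at x" using assms that by simp
    then show ?thesis
      using euclidean_representation[of "grad u x"]
      by (simp add: frechet_derivative_grad inner_commute)
  qed
  ultimately show ?thesis by (metis (no_types, lifting) continuous_on_cong)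
qed

lemma smooth_grad_continuous: "smooth f \<Longrightarrow> continuous_on UNIV (grad f)"
  using Ck_on_1_grad_continuous unfolding smooth_def by blast

text \<open>The function exp(-1/t) at t = \<delta>^2 - |x|^2 is positive exactly in the open ball of
  radius \<delta>; dividing by its integral normalises it.\<close>

lemma mollifier_exists:
  fixes \<delta> :: real
  assumes "0 < \<delta>"
  obtains \<rho> :: "'a::euclidean_space \<Rightarrow> real" where
    "smooth \<rho>" "\<And>x. 0 \<le> \<rho> x" "\<And>x. \<delta> \<le> norm x \<Longrightarrow> \<rho> x = 0"
    "(\<integral>x. \<rho> x \<partial>lborel) = 1" "integrable lborel \<rho>"
proof -
  define f where "f x = flat_deriv 0 (\<delta>\<^sup>2 - inner x x)" for x :: 'a
  have sm: "smooth f"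
    unfolding smooth_def f_def by (simp add: Ck_on_flat)
  have nn: "0 \<le> f x" for x by (simp add: f_def flat_deriv_def)
  have z: "f x = 0" if "\<delta> \<le> norm x" for x
    using power_mono[OF that, of 2] assms by (auto simp: f_def flat_deriv_def power2_norm_eq_inner)
  have f0: "0 < f 0" using assms by (simp add: f_def flat_deriv_def)
  have int: "integrable lborel f"
  proof -
    have "set_integrable lborel (cball 0 \<delta>) f"
      unfolding set_integrable_def
      by (rule borel_integrable_compact) (auto intro: continuous_on_subset[OF smooth_continuous[OF sm]])
    moreover have "(\<lambda>x. indicator (cball 0 \<delta>) x *\<^sub>R f x) = f"
      using z by (auto simp: indicator_def fun_eq_iff)
    ultimately show ?thesis by (simp add: set_integrable_def)
  qed
  \<comment> \<open>A nonnegative function with integral 0 vanishes almost everywhere. By continuity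
    the set where it does not vanish is open, and a negligible open set is empty; but this one
    contains 0.\<close>
  have pos: "0 < (\<integral>x. f x \<partial>lborel)"
  proof (rule ccontr)
    assume "\<not> ?thesis"
    then have "(\<integral>x. f x \<partial>lborel) = 0"
      using integral_nonneg_AE[of f lborel] nn by (simp add: order.antisym)
    then have "AE x in lborel. f x = 0"
      using integral_nonneg_eq_0_iff_AE[OF int] nn by simp
    then have "AE x in lebesgue. x \<notin> {x. f x \<noteq> 0}"
      using AE_completion by simp
    moreover have op: "open {x. f x \<noteq> 0}"
      by (intro open_Collect_neq smooth_continuous sm continuous_intros)
    ultimately have "negligible {x. f x \<noteq> 0}"
      using AE_iff_null_sets[of "{x. f x \<noteq> 0}" lebesgue] negligible_iff_null_sets by fastforce
    then show False using open_not_negligible[OF op] f0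
      by (metis (mono_tags, lifting) empty_iff less_irrefl mem_Collect_eq)
  qed
  define \<rho> where "\<rho> x = f x * (1 / (\<integral>x. f x \<partial>lborel))" for x
  show thesis
  proof
    show "smooth \<rho>"
      using sm unfolding smooth_def \<rho>_def by (intro allI Ck_on_mult Ck_on_const) blast
  qed (use nn z int pos in \<open>auto simp: \<rho>_def[abs_def]\<close>)
qed

section \<open>Mollification\<close>

text \<open>Polymorphic because it is applied to gradients as well as to the real numbers B and
  \<open>W' r\<close>; \<open>flux_scaleR\<close> links the two uses.\<close>

definition flux :: "real \<Rightarrow> 'a::real_normed_vector \<Rightarrow> 'a" where
  "flux p v = norm v powr (p - 2) *\<^sub>R v"

text \<open>The class of test functions of the comparison argument. K is any compact set outside
  which f vanishes, not necessarily the closed support, so it can be chosen as a set that is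
  convenient to describe.\<close>

definition C1_supported :: "'a::euclidean_space set \<Rightarrow> ('a \<Rightarrow> real) \<Rightarrow> ('a \<Rightarrow> 'a) \<Rightarrow> bool" where
  "C1_supported K f df \<longleftrightarrow> compact K \<and> (\<forall>x. GDERIV f x :> df x) \<and> continuous_on UNIV df \<and>
     (\<forall>x. x \<notin> K \<longrightarrow> f x = 0)"

lemma GDERIV_isCont: "GDERIV f x :> w \<Longrightarrow> isCont f x"
  unfolding gderiv_def by (rule has_derivative_continuous)

lemma C1_supported_continuous: "C1_supported K f df \<Longrightarrow> continuous_on UNIV f"
  unfolding C1_supported_def by (auto simp: continuous_on_eq_continuous_within intro: GDERIV_isCont)

lemma C1_supported_grad_zero:
  assumes "C1_supported K f df" "x \<notin> K"
  shows "df x = 0"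
proof -
  have op: "open (- K)" using assms(1) by (simp add: C1_supported_def compact_imp_closed open_Compl)
  have "((\<lambda>_. 0 :: real) has_derivative (\<lambda>_. 0)) (at x)" by simp
  then have "(f has_derivative (\<lambda>_. 0)) (at x)"
    by (rule has_derivative_transform_within_open[OF _ op])
       (use assms in \<open>auto simp: C1_supported_def\<close>)
  then have "GDERIV f x :> 0" by (simp add: gderiv_def)
  moreover have "GDERIV f x :> df x" using assms(1) by (simp add: C1_supported_def)
  ultimately show ?thesis by (metis grad_eqI)
qed

section \<open>Integration of compactly supported functions\<close>

lemma continuous_compact_support_bounded:
  fixes f :: "'a::euclidean_space \<Rightarrow> 'b::real_normed_vector"
  assumes "continuous_on UNIV f" "compact K" "\<And>x. x \<notin> K \<Longrightarrow> f x = 0"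
  shows "\<exists>C\<ge>0. \<forall>x. norm (f x) \<le> C"
proof -
  have "bounded (f ` K)"
    using assms by (meson compact_continuous_image compact_imp_bounded continuous_on_subset subset_UNIV)
  then obtain C where "\<And>x. x \<in> K \<Longrightarrow> norm (f x) \<le> C" by (auto simp: bounded_iff)
  then have "norm (f x) \<le> max C 0" for x
    using assms(3)[of x] by (cases "x \<in> K") (auto simp: le_max_iff_disj)
  then show ?thesis by (intro exI[of _ "max C 0"]) simp
qed

lemma continuous_compact_support_integrable:
  fixes f :: "'a::euclidean_space \<Rightarrow> real"
  assumes "continuous_on UNIV f" "compact K" "\<And>x. x \<notin> K \<Longrightarrow> f x = 0"
  shows "integrable lborel f"
proof -
  have "integrable lborel (\<lambda>x. indicator K x *\<^sub>R f x)"
    by (rule borel_integrable_compact) (use assms in \<open>auto intro: continuous_on_subset\<close>)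
  moreover have "(\<lambda>x. indicator K x *\<^sub>R f x) = f"
    using assms(3) by (auto simp: indicator_def fun_eq_iff)
  ultimately show ?thesis by simp
qed

lemma integral_lborel_translate:
  fixes f :: "'a::euclidean_space \<Rightarrow> real"
  assumes "f \<in> borel_measurable borel"
  shows "(\<integral>x. f (x + c) \<partial>lborel) = (\<integral>x. f x \<partial>lborel)"
proof -
  have "(\<integral>x. f x \<partial>lborel) = (\<integral>x. f x \<partial>distr lborel borel ((+) c))"
    by (simp add: lborel_distr_plus)
  also have "\<dots> = (\<integral>x. f (c + x) \<partial>lborel)"
    by (rule integral_distr) (use assms in auto)
  finally show ?thesis by (simp add: add.commute)
qed

lemma lborel_distr_reflect: "distr lborel borel (\<lambda>y. c - y) = (lborel :: 'a::euclidean_space measure)"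
  by (subst lborel_affine[of "-1" c]) (auto simp: density_1)

lemma integral_lborel_reflect:
  fixes f :: "'a::euclidean_space \<Rightarrow> real"
  assumes "f \<in> borel_measurable borel"
  shows "(\<integral>y. f (c - y) \<partial>lborel) = (\<integral>y. f y \<partial>lborel)"
proof -
  have "(\<integral>x. f x \<partial>lborel) = (\<integral>x. f x \<partial>distr lborel borel (\<lambda>y. c - y))"
    by (simp add: lborel_distr_reflect)
  also have "\<dots> = (\<integral>x. f (c - x) \<partial>lborel)"
    by (rule integral_distr) (use assms in auto)
  finally show ?thesis by simp
qed

text \<open>Integration by parts without Fubini: by translation invariance every difference quotient
  in direction b has integral 0, and dominated convergence passes this on to the derivative.\<close>

lemma integral_derivative_compact_support:
  fixes f :: "'a::euclidean_space \<Rightarrow> real"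
  assumes D: "\<And>x. (f has_derivative f' x) (at x)"
    and cont: "continuous_on UNIV (\<lambda>x. f' x b)"
    and K: "compact K" "\<And>x. x \<notin> K \<Longrightarrow> f x = 0"
  shows "(\<integral>x. f' x b \<partial>lborel) = 0"
proof -
  have f_cont: "continuous_on UNIV f"
    using D by (auto simp: continuous_on_eq_continuous_within intro: has_derivative_continuous)
  then have f_meas[measurable]: "f \<in> borel_measurable borel"
    by (rule borel_measurable_continuous_onI)
  have g_meas[measurable]: "(\<lambda>x. f' x b) \<in> borel_measurable borel"
    using cont by (rule borel_measurable_continuous_onI)
  have f_int: "integrable lborel f"
    using f_cont K by (rule continuous_compact_support_integrable)
  have z: "f' x b = 0" if "x \<notin> K" for x
  proof -
    have "((\<lambda>_. 0 :: real) has_derivative (\<lambda>_. 0)) (at x)" by simp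
    then have "(f has_derivative (\<lambda>_. 0)) (at x)"
      by (rule has_derivative_transform_within_open[OF _ open_Compl[OF compact_imp_closed[OF K(1)]]])
         (use that K in auto)
    with D show ?thesis by (metis has_derivative_unique)
  qed
  have "\<exists>C\<ge>0. \<forall>x. norm (f' x b) \<le> C"
    by (rule continuous_compact_support_bounded[OF cont K(1)]) (rule z)
  then obtain C where C: "0 \<le> C" "\<And>x. norm (f' x b) \<le> C" by blast
  obtain r where r: "K \<subseteq> cball 0 r"
    using compact_imp_bounded[OF K(1)] by (metis bounded_subset_ballD ball_subset_cball order.trans)
  \<comment> \<open>Step lengths of at most 1 keep all shifted supports inside the ball of radius
    \<open>r + norm b\<close>, which carries the dominating function.\<close>
  define h where "h k = 1 / real (Suc k)" for k
  have h: "0 < h k" "h k \<le> 1" for k by (auto simp: h_def)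
  define s where "s k x = (f (x + h k *\<^sub>R b) - f x) / h k" for k x
  have s_meas[measurable]: "s k \<in> borel_measurable borel" for k
    unfolding s_def by measurable
  have s_zero: "(\<integral>x. s k x \<partial>lborel) = 0" for k
  proof -
    have int: "integrable lborel (\<lambda>x. f (x + h k *\<^sub>R b))"
    proof (rule continuous_compact_support_integrable)
      show "continuous_on UNIV (\<lambda>x. f (x + h k *\<^sub>R b))"
        by (intro continuous_on_compose2[OF f_cont] continuous_intros) auto
      show "compact ((\<lambda>x. x - h k *\<^sub>R b) ` K)"
        using K(1) by (intro compact_continuous_image continuous_intros)
      show "f (x + h k *\<^sub>R b) = 0" if "x \<notin> (\<lambda>x. x - h k *\<^sub>R b) ` K" for x
        using that by (intro K(2)) (auto simp: image_iff)
    qed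
    have "(\<integral>x. s k x \<partial>lborel) = ((\<integral>x. f (x + h k *\<^sub>R b) \<partial>lborel) - (\<integral>x. f x \<partial>lborel)) / h k"
      unfolding s_def using int f_int by simp
    also have "\<dots> = 0"
      by (simp add: integral_lborel_translate)
    finally show ?thesis .
  qed
  have line: "((\<lambda>t. f (x + t *\<^sub>R b)) has_real_derivative f' (x + t *\<^sub>R b) b) (at t)" for x t
  proof -
    have "((\<lambda>t. x + t *\<^sub>R b) has_derivative (\<lambda>t. t *\<^sub>R b)) (at t)"
      by (auto intro!: derivative_eq_intros)
    from has_derivative_compose[OF this D]
    have "((\<lambda>t. f (x + t *\<^sub>R b)) has_derivative (\<lambda>s. f' (x + t *\<^sub>R b) (s *\<^sub>R b))) (at t)" .
    moreover have "f' (x + t *\<^sub>R b) (s *\<^sub>R b) = s * f' (x + t *\<^sub>R b) b" for s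
      using linear_scale[OF has_derivative_linear[OF D], of "x + t *\<^sub>R b" s b] by simp
    ultimately show ?thesis
      by (simp add: has_field_derivative_def mult_commute_abs)
  qed
  have bound: "norm (s k x) \<le> C * indicator (cball 0 (r + norm b)) x" for k x
  proof (cases "norm x \<le> r + norm b")
    case True
    obtain \<xi> where "f (x + h k *\<^sub>R b) - f (x + 0 *\<^sub>R b) = (h k - 0) * f' (x + \<xi> *\<^sub>R b) b"
      using MVT2[OF h(1)[of k] line[of x]] by blast
    then have "s k x = f' (x + \<xi> *\<^sub>R b) b" using h(1)[of k] by (simp add: s_def)
    then show ?thesis using True C(2) by simp
  next
    case False
    have "norm (h k *\<^sub>R b) \<le> norm b" using h[of k] by (simp add: mult_left_le_one_le)
    moreover have "norm x - norm (h k *\<^sub>R b) \<le> norm (x + h k *\<^sub>R b)"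
      using norm_triangle_ineq2[of x "- (h k *\<^sub>R b)"]
      by (simp only: norm_minus_cancel diff_minus_eq_add)
    ultimately have "r < norm (x + h k *\<^sub>R b)" "r < norm x"
      using False norm_ge_zero[of b] by linarith+
    then have "x + h k *\<^sub>R b \<notin> K" "x \<notin> K" using r by auto
    then show ?thesis using C(1) K(2) by (simp add: s_def)
  qed
  have lim: "(\<lambda>k. s k x) \<longlonglongrightarrow> f' x b" for x
  proof -
    have "filterlim h (at 0) sequentially"
      unfolding filterlim_at using h(1) LIMSEQ_inverse_real_of_nat
      by (auto simp: h_def[abs_def] inverse_eq_divide intro!: always_eventually)
    moreover have "((\<lambda>t. (f (x + t *\<^sub>R b) - f x) / t) \<longlongrightarrow> f' x b) (at 0)"
      using line[of x 0] by (simp add: DERIV_def)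
    ultimately show ?thesis unfolding s_def by (rule filterlim_compose[rotated])
  qed
  have "(\<lambda>k. \<integral>x. s k x \<partial>lborel) \<longlonglongrightarrow> (\<integral>x. f' x b \<partial>lborel)"
  proof (rule integral_dominated_convergence)
    show "integrable lborel (\<lambda>x. C * indicator (cball 0 (r + norm b)) x)"
      by (intro integrable_mult_right integrable_real_indicator) (use emeasure_bounded_finite[of "cball 0 (r + norm b)"] in auto)
  qed (use lim bound in auto)
  then show ?thesis unfolding s_zero by (simp add: LIMSEQ_const_iff)
qed


section \<open>Convolution with a smooth kernel\<close>

definition conv :: "('a::euclidean_space \<Rightarrow> real) \<Rightarrow> ('a \<Rightarrow> real) \<Rightarrow> 'a \<Rightarrow> real" where
  "conv f \<rho> x = (\<integral>y. f y * \<rho> (x - y) \<partial>lborel)"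

lemma conv_integrable:
  fixes f \<rho> :: "'a::euclidean_space \<Rightarrow> real"
  assumes "continuous_on UNIV f" "compact K" "\<And>x. x \<notin> K \<Longrightarrow> f x = 0" "continuous_on UNIV \<rho>"
  shows "integrable lborel (\<lambda>y. f y * \<rho> (x - y))"
  using assms
  by (intro continuous_compact_support_integrable[OF _ assms(2)] continuous_on_mult
      continuous_on_compose2[OF assms(4)] continuous_intros) auto

lemma smooth_conv_has_derivative:
  fixes f \<rho> :: "'a::euclidean_space \<Rightarrow> real"
  assumes f: "continuous_on UNIV f" "compact K" "\<And>x. x \<notin> K \<Longrightarrow> f x = 0" and \<rho>: "smooth \<rho>"
  shows "conv f \<rho> differentiable at x"
    and "frechet_derivative (conv f \<rho>) (at x) b = conv f (\<lambda>z. frechet_derivative \<rho> (at z) b) x"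
proof -
  obtain c d where cd: "K \<subseteq> cbox c d"
    using compact_imp_bounded[OF f(2)] bounded_subset_cbox_symmetric by metis
  \<comment> \<open>Differentiation under the integral sign takes place over a compact box; since f
    vanishes outside K, a box containing K captures the whole integral.\<close>
  have on_cbox: "(\<integral>y. F y \<partial>lborel) = integral (cbox c d) F"
    if "continuous_on UNIV F" "\<And>y. y \<notin> K \<Longrightarrow> F y = 0" for F :: "'a \<Rightarrow> real"
  proof -
    have "(\<integral>y. F y \<partial>lborel) = integral UNIV F"
      using continuous_compact_support_integrable[OF that(1) f(2) that(2)] by (simp add: integral_lborel)
    also have "F = (\<lambda>y. if y \<in> cbox c d then F y else 0)"
      using that(2) cd by (fastforce simp: fun_eq_iff)
    then have "integral UNIV F = integral (cbox c d) F"
      by (metis integral_restrict_UNIV)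
    finally show ?thesis .
  qed
  have \<rho>_cont: "continuous_on UNIV (\<lambda>y. \<rho> (x - y))" for x
    by (intro continuous_on_compose2[OF smooth_continuous[OF \<rho>]] continuous_intros) auto
  have grad_cont: "continuous_on S (\<lambda>z. grad \<rho> (l z))" if "continuous_on S l"
    for l :: "'b::topological_space \<Rightarrow> 'a" and S
    using that by (intro continuous_on_compose2[OF smooth_grad_continuous[OF \<rho>]]) auto
  \<comment> \<open>The Leibniz rule integrates the derivative as a bounded linear map. Evaluating
    the integral at b afterwards gives the partial derivative as a convolution.\<close>
  define Df where "Df x y = f y *\<^sub>R blinfun_inner_left (grad \<rho> (x - y))" for x y
  have Df_apply: "blinfun_apply (Df x y) h = f y * inner h (grad \<rho> (x - y))" for x y h
    by (simp add: Df_def blinfun.scaleR_left)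
  then have Df_apply': "blinfun_apply (Df x y) = (\<lambda>h. f y * inner h (grad \<rho> (x - y)))" for x y
    by (rule ext)
  have conv_eq: "conv f \<rho> = (\<lambda>x. integral (cbox c d) (\<lambda>y. f y * \<rho> (x - y)))"
    unfolding conv_def using f(1,3) \<rho>_cont
    by (intro ext on_cbox continuous_on_mult) auto
  have D: "((\<lambda>x. integral (cbox c d) (\<lambda>y. f y * \<rho> (x - y))) has_derivative
      blinfun_apply (integral (cbox c d) (Df x))) (at x within UNIV)"
  proof (rule leibniz_rule)
    show "((\<lambda>x. f t * \<rho> (x - t)) has_derivative blinfun_apply (Df x t)) (at x within UNIV)" for x t
    proof -
      have "((\<lambda>x. x - t) has_derivative (\<lambda>h. h)) (at x)"
        by (auto intro!: derivative_eq_intros)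
      from has_derivative_compose[OF this smooth_GDERIV[OF \<rho>, unfolded gderiv_def]]
      have "((\<lambda>x. \<rho> (x - t)) has_derivative (\<lambda>h. inner h (grad \<rho> (x - t)))) (at x)" .
      from has_derivative_mult_right[OF this, of "f t"]
      show ?thesis by (simp add: Df_apply')
    qed
    show "(\<lambda>y. f y * \<rho> (x - y)) integrable_on cbox c d" for x
      by (intro integrable_continuous continuous_on_mult continuous_on_subset[OF f(1)]
          continuous_on_subset[OF \<rho>_cont]) auto
    have "continuous_on (UNIV \<times> cbox c d) (\<lambda>z. Df (fst z) (snd z))"
      unfolding Df_def
      by (intro continuous_intros bounded_linear.continuous_on[OF bounded_linear_blinfun_inner_left]
          grad_cont continuous_on_compose2[OF f(1)]) auto
    then show "continuous_on (UNIV \<times> cbox c d) (\<lambda>(x, t). Df x t)"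
      by (simp add: case_prod_unfold)
  qed auto
  then show "conv f \<rho> differentiable at x"
    unfolding conv_eq by (rule differentiableI)
  have Df_int: "Df x integrable_on cbox c d"
    unfolding Df_def
    by (intro integrable_continuous continuous_intros grad_cont
        bounded_linear.continuous_on[OF bounded_linear_blinfun_inner_left] continuous_on_subset[OF f(1)]) auto
  have "frechet_derivative (conv f \<rho>) (at x) b = blinfun_apply (integral (cbox c d) (Df x)) b"
    unfolding conv_eq using fun_cong[OF frechet_derivative_at[OF D], of b] by (rule sym)
  also have "\<dots> = integral (cbox c d) (\<lambda>y. f y * inner b (grad \<rho> (x - y)))"
    using blinfun_apply_integral[OF Df_int, of b] by (simp add: Df_apply)
  also have "\<dots> = conv f (\<lambda>z. frechet_derivative \<rho> (at z) b) x"
    unfolding conv_def frechet_derivative_grad[OF smooth_differentiable[OF \<rho>]]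
    by (intro on_cbox[symmetric] continuous_intros f(1) grad_cont) (use f(3) in auto)
  finally show "frechet_derivative (conv f \<rho>) (at x) b = conv f (\<lambda>z. frechet_derivative \<rho> (at z) b) x" .
qed

text \<open>Differentiation only replaces the kernel by one of its partial derivatives, so the
  induction on the order has to range over all smooth kernels.\<close>

lemma smooth_conv:
  fixes f \<rho> :: "'a::euclidean_space \<Rightarrow> real"
  assumes f: "continuous_on UNIV f" "compact K" "\<And>x. x \<notin> K \<Longrightarrow> f x = 0" and "smooth \<rho>"
  shows "smooth (conv f \<rho>)"
proof -
  have "Ck_on k UNIV (conv f \<eta>)" if "smooth \<eta>" for k \<eta>
    using that
  proof (induction k arbitrary: \<eta>)
    case 0
    show ?case
      using smooth_conv_has_derivative(1)[OF f \<open>smooth \<eta>\<close>]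
      by (simp add: continuous_on_eq_continuous_within differentiable_imp_continuous_within)
  next
    case (Suc k)
    have "Ck_on k UNIV (\<lambda>x. frechet_derivative (conv f \<eta>) (at x) b)" if "b \<in> Basis" for b
    proof -
      have "(\<lambda>x. frechet_derivative (conv f \<eta>) (at x) b) = conv f (\<lambda>z. frechet_derivative \<eta> (at z) b)"
        by (rule ext) (rule smooth_conv_has_derivative(2)[OF f Suc.prems])
      then show ?thesis using Suc.IH smooth_partial[OF Suc.prems that] by metis
    qed
    then show ?case
      using smooth_conv_has_derivative(1)[OF f \<open>smooth \<eta>\<close>] by simp
  qed
  then show ?thesis using \<open>smooth \<rho>\<close> by (simp add: smooth_def)
qed

text \<open>The y-derivative of f(y) \<rho>(x - y) has integral 0, which moves the derivative from
  the kernel to f. In this form the gradients of mollifications are averages of \<open>df\<close>,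
  hence bounded and convergent.\<close>

lemma conv_partial_swap:
  fixes f \<rho> :: "'a::euclidean_space \<Rightarrow> real"
  assumes f: "C1_supported K f df" and \<rho>: "smooth \<rho>"
  shows "inner b (grad (conv f \<rho>) x) = conv (\<lambda>y. inner b (df y)) \<rho> x"
proof -
  note f_cont = C1_supported_continuous[OF f]
  have K: "compact K" "\<And>x. x \<notin> K \<Longrightarrow> f x = 0" and df: "\<And>x. GDERIV f x :> df x"
    and df_cont: "continuous_on UNIV df"
    using f by (auto simp: C1_supported_def)
  have \<rho>_cont: "continuous_on UNIV (\<lambda>y. \<rho> (x - y))"
    by (intro continuous_on_compose2[OF smooth_continuous[OF \<rho>]] continuous_intros) auto
  have grad_cont: "continuous_on UNIV (\<lambda>y. grad \<rho> (x - y))"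
    by (intro continuous_on_compose2[OF smooth_grad_continuous[OF \<rho>]] continuous_intros) auto
  have D: "((\<lambda>y. f y * \<rho> (x - y)) has_derivative
      (\<lambda>h. f y * (- inner h (grad \<rho> (x - y))) + inner h (df y) * \<rho> (x - y))) (at y)" for y
  proof -
    have "((\<lambda>y. x - y) has_derivative (\<lambda>h. - h)) (at y)"
      by (auto intro!: derivative_eq_intros)
    from has_derivative_compose[OF this smooth_GDERIV[OF \<rho>, unfolded gderiv_def]]
    have "((\<lambda>y. \<rho> (x - y)) has_derivative (\<lambda>h. - inner h (grad \<rho> (x - y)))) (at y)"
      by simp
    from has_derivative_mult[OF df[unfolded gderiv_def] this] show ?thesis .
  qed
  have "(\<integral>y. f y * (- inner b (grad \<rho> (x - y))) + inner b (df y) * \<rho> (x - y) \<partial>lborel) = 0"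
    by (rule integral_derivative_compact_support[OF D _ K(1)])
       (auto intro!: continuous_intros f_cont df_cont grad_cont \<rho>_cont simp: K(2))
  moreover have "integrable lborel (\<lambda>y. f y * inner b (grad \<rho> (x - y)))"
    by (rule continuous_compact_support_integrable[OF _ K(1)])
       (auto intro!: continuous_intros f_cont grad_cont simp: K(2))
  moreover have "integrable lborel (\<lambda>y. inner b (df y) * \<rho> (x - y))"
    by (rule continuous_compact_support_integrable[OF _ K(1)])
       (auto intro!: continuous_intros df_cont \<rho>_cont simp: C1_supported_grad_zero[OF f])
  ultimately have "conv f (\<lambda>z. inner b (grad \<rho> z)) x = conv (\<lambda>y. inner b (df y)) \<rho> x"
    by (simp add: conv_def)
  moreover have "inner b (grad (conv f \<rho>) x) = conv f (\<lambda>z. inner b (grad \<rho> z)) x"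
    using smooth_conv_has_derivative(2)[OF f_cont K \<rho>, of x b]
    by (simp add: frechet_derivative_grad[OF smooth_differentiable[OF \<rho>]]
        frechet_derivative_grad[OF smooth_conv_has_derivative(1)[OF f_cont K \<rho>]])
  ultimately show ?thesis by simp
qed

definition mollifier :: "real \<Rightarrow> ('a::euclidean_space \<Rightarrow> real) \<Rightarrow> bool" where
  "mollifier \<delta> \<rho> \<longleftrightarrow> smooth \<rho> \<and> (\<forall>x. 0 \<le> \<rho> x) \<and> (\<forall>x. \<delta> \<le> norm x \<longrightarrow> \<rho> x = 0) \<and>
     (\<integral>x. \<rho> x \<partial>lborel) = 1 \<and> integrable lborel \<rho>"

lemma mollifier_reflect:
  assumes "mollifier \<delta> \<rho>"
  shows "integrable lborel (\<lambda>y. \<rho> (x - y))" "(\<integral>y. \<rho> (x - y) \<partial>lborel) = 1"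
proof -
  have cont: "continuous_on UNIV \<rho>" using assms by (simp add: mollifier_def smooth_continuous)
  show "integrable lborel (\<lambda>y. \<rho> (x - y))"
  proof (rule continuous_compact_support_integrable)
    show "continuous_on UNIV (\<lambda>y. \<rho> (x - y))"
      by (intro continuous_on_compose2[OF cont] continuous_intros) auto
    show "compact (cball x \<delta>)" by simp
    show "\<rho> (x - y) = 0" if "y \<notin> cball x \<delta>" for y
      using that assms by (simp add: mollifier_def dist_norm)
  qed
  show "(\<integral>y. \<rho> (x - y) \<partial>lborel) = 1"
    using integral_lborel_reflect[OF borel_measurable_continuous_onI[OF cont], of x] assms
    by (simp add: mollifier_def)
qed

text \<open>The convolution at x is a weighted mean of f over the ball of radius \<delta> about x.
  Taking c = f x gives convergence of mollifications, and c = 0 gives bounds uniform in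
  \<delta>.\<close>

lemma conv_mollifier_close:
  fixes f :: "'a::euclidean_space \<Rightarrow> real"
  assumes f: "continuous_on UNIV f" "compact K" "\<And>x. x \<notin> K \<Longrightarrow> f x = 0"
    and \<rho>: "mollifier \<delta> \<rho>" and close: "\<And>y. dist x y < \<delta> \<Longrightarrow> \<bar>f y - c\<bar> \<le> e"
  shows "\<bar>conv f \<rho> x - c\<bar> \<le> e"
proof -
  have cont: "continuous_on UNIV \<rho>" using \<rho> by (simp add: mollifier_def smooth_continuous)
  note int = conv_integrable[OF f cont, of x] mollifier_reflect[OF \<rho>, of x]
  have "conv f \<rho> x - c = (\<integral>y. f y * \<rho> (x - y) - c * \<rho> (x - y) \<partial>lborel)"
    using int by (simp add: conv_def)
  also have "\<bar>\<dots>\<bar> \<le> (\<integral>y. e * \<rho> (x - y) \<partial>lborel)"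
  proof (rule integral_abs_bound[THEN order_trans], rule integral_mono)
    show "integrable lborel (\<lambda>y. \<bar>f y * \<rho> (x - y) - c * \<rho> (x - y)\<bar>)"
      using int by (intro integrable_abs) simp
    show "integrable lborel (\<lambda>y. e * \<rho> (x - y))" using int by simp
    show "\<bar>f y * \<rho> (x - y) - c * \<rho> (x - y)\<bar> \<le> e * \<rho> (x - y)" for y
    proof (cases "dist x y < \<delta>")
      case True
      have "\<bar>f y * \<rho> (x - y) - c * \<rho> (x - y)\<bar> = \<bar>f y - c\<bar> * \<rho> (x - y)"
        using \<rho> by (simp add: mollifier_def flip: left_diff_distrib) (simp add: abs_mult)
      then show ?thesis using close[OF True] \<rho> by (simp add: mollifier_def mult_right_mono)
    next
      case False
      then have "\<rho> (x - y) = 0" using \<rho> by (simp add: mollifier_def dist_norm)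
      then show ?thesis by simp
    qed
  qed
  also have "\<dots> = e" using int by simp
  finally show ?thesis .
qed

section \<open>Comparison of weak solutions with radial profiles\<close>

lemma powr_minus_2_mult: "0 \<le> t \<Longrightarrow> t powr (p - 2) * t = t powr (p - 1)" for t :: real
  using powr_add[of t "p - 2" 1] by (cases "t = 0") auto

lemma norm_flux: "norm (flux p v) = norm v powr (p - 1)"
  by (simp add: flux_def powr_minus_2_mult)

lemma flux_scaleR: "flux p (c *\<^sub>R v) = flux p c *\<^sub>R flux p v"
  by (simp add: flux_def powr_mult)

text \<open>Separates the change of length from the change of direction: the first summand is
  nonnegative because t^(p-1) is increasing, the second by the Cauchy-Schwarz inequality.\<close>

lemma flux_inner_diff:
  fixes v w :: "'a::euclidean_space"
  shows "inner (flux p v - flux p w) (v - w) =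
    (norm v powr (p - 1) - norm w powr (p - 1)) * (norm v - norm w) +
    (norm v powr (p - 2) + norm w powr (p - 2)) * (norm v * norm w - inner v w)"
proof -
  have "inner (flux p v - flux p w) (v - w) =
    norm v powr (p - 2) * (norm v)\<^sup>2 + norm w powr (p - 2) * (norm w)\<^sup>2
      - (norm v powr (p - 2) + norm w powr (p - 2)) * inner v w"
    by (simp add: flux_def inner_diff_left inner_diff_right power2_norm_eq_inner inner_commute
        algebra_simps)
  also have "\<dots> = (norm v powr (p - 2) * norm v - norm w powr (p - 2) * norm w) * (norm v - norm w)
      + (norm v powr (p - 2) + norm w powr (p - 2)) * (norm v * norm w - inner v w)"
    by (simp add: power2_eq_square algebra_simps)
  finally show ?thesis by (simp add: powr_minus_2_mult)
qed

lemma powr_diff_mult_nonneg: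
  fixes s t q :: real
  assumes "0 < q" "0 \<le> s" "0 \<le> t"
  shows "0 \<le> (s powr q - t powr q) * (s - t)"
    and "(s powr q - t powr q) * (s - t) = 0 \<Longrightarrow> s = t"
proof -
  show "0 \<le> (s powr q - t powr q) * (s - t)"
    using assms powr_mono2[of q s t] powr_mono2[of q t s]
    by (cases "s \<le> t") (auto simp: zero_le_mult_iff)
  assume "(s powr q - t powr q) * (s - t) = 0"
  then show "s = t"
    using assms powr_less_mono2[of q s t] powr_less_mono2[of q t s]
    by (cases s t rule: linorder_cases) auto
qed

text \<open>In the equality case both summands of \<open>flux_inner_diff\<close> vanish: the first
  yields equal lengths, the second equality in the Cauchy-Schwarz inequality. No quantitative lower
  bound enters, so 1 < p < 2 and p \<ge> 2 are treated alike.\<close>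

lemma flux_monotone:
  fixes v w :: "'a::euclidean_space"
  assumes "1 < p"
  shows "0 \<le> inner (flux p v - flux p w) (v - w)"
    and "inner (flux p v - flux p w) (v - w) = 0 \<Longrightarrow> v = w"
proof -
  let ?A = "(norm v powr (p - 1) - norm w powr (p - 1)) * (norm v - norm w)"
  let ?B = "(norm v powr (p - 2) + norm w powr (p - 2)) * (norm v * norm w - inner v w)"
  have A: "0 \<le> ?A" using assms by (intro powr_diff_mult_nonneg) auto
  have B: "0 \<le> ?B" by (intro mult_nonneg_nonneg add_nonneg_nonneg) (auto simp: norm_cauchy_schwarz)
  show "0 \<le> inner (flux p v - flux p w) (v - w)"
    unfolding flux_inner_diff using A B by simp
  assume "inner (flux p v - flux p w) (v - w) = 0"
  then have "?A + ?B = 0" by (simp only: flux_inner_diff)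
  then have A0: "?A = 0" and B0: "?B = 0" using A B by linarith+
  have eq: "norm v = norm w"
    by (rule powr_diff_mult_nonneg(2)[OF _ _ _ A0]) (use assms in auto)
  show "v = w"
  proof (cases "w = 0")
    case False
    then have "norm v powr (p - 2) + norm w powr (p - 2) > 0" by (simp add: add_nonneg_pos)
    then have "inner v w = norm v * norm w" using B0 by simp
    then show ?thesis using norm_cauchy_schwarz_eq[of v w] eq False by simp
  qed (use eq in simp)
qed

section \<open>Radial vector fields\<close>

lemma continuous_on_zero_extension:
  fixes g :: "'a::topological_space \<Rightarrow> 'b::real_normed_vector"
  assumes "open U" "closed K" "K \<subseteq> U" "continuous_on U g" "\<And>x. x \<notin> K \<Longrightarrow> g x = 0"
  shows "continuous_on UNIV g"
proof -
  have "continuous_on (- K) g"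
    using assms(5) continuous_on_cong[of "- K" "- K" g "\<lambda>_. 0"] by auto
  then have "continuous_on (U \<union> - K) g"
    using assms by (intro continuous_on_open_Un) auto
  moreover have "U \<union> - K = UNIV" using assms(3) by auto
  ultimately show ?thesis by simp
qed

lemma GDERIV_zero_outside:
  assumes "closed K" "x \<notin> K" "\<And>x. x \<notin> K \<Longrightarrow> f x = 0"
  shows "GDERIV f x :> 0"
proof -
  have "((\<lambda>_. 0 :: real) has_derivative (\<lambda>_. 0)) (at x)" by simp
  then have "(f has_derivative (\<lambda>_. 0)) (at x)"
    by (rule has_derivative_transform_within_open[OF _ open_Compl[OF assms(1)]]) (use assms in auto)
  then show ?thesis by (simp add: gderiv_def)
qed

text \<open>The divergence theorem for the field X(x) = \<Phi>(|x|) x / |x|^n, n being the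
  dimension, whose divergence is H(|x|). It is obtained componentwise from integrals of derivatives,
  without polar coordinates. With \<Phi> taken from W it becomes the weak equation of the radial
  profile.\<close>

lemma radial_flux_divergence:
  fixes \<phi> :: "'a::euclidean_space \<Rightarrow> real"
  assumes \<phi>: "C1_supported K \<phi> d\<phi>" and K: "K \<subseteq> {x. a < norm x \<and> norm x < b}" and a: "0 < a"
    and \<Phi>: "\<And>r. a < r \<Longrightarrow> r < b \<Longrightarrow> (\<Phi> has_real_derivative H r * r ^ (DIM('a) - 1)) (at r)"
    and H: "continuous_on {a<..<b} H"
  shows "integrable lborel (\<lambda>x. \<Phi> (norm x) / norm x ^ DIM('a) * inner x (d\<phi> x) + H (norm x) * \<phi> x)"
    and "(\<integral>x. \<Phi> (norm x) / norm x ^ DIM('a) * inner x (d\<phi> x) + H (norm x) * \<phi> x \<partial>lborel) = 0"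
proof -
  define U where "U = {x::'a. a < norm x \<and> norm x < b}"
  have U: "open U" unfolding U_def by (intro open_Collect_conj open_Collect_less continuous_intros)
  have KU: "K \<subseteq> U" using K by (simp add: U_def)
  have cK: "compact K" "closed K" and \<phi>0: "\<And>x. x \<notin> K \<Longrightarrow> \<phi> x = 0"
    and D\<phi>: "\<And>x. GDERIV \<phi> x :> d\<phi> x" and d\<phi>_cont: "continuous_on UNIV d\<phi>"
    using \<phi> by (auto simp: C1_supported_def compact_imp_closed)
  note d\<phi>0 = C1_supported_grad_zero[OF \<phi>]
  \<comment> \<open>X = \<Psi>(|x|) x has divergence n \<Psi> + r \<Psi>'; the formula for \<Psi>'
    is this expression set equal to H and solved for \<Psi>'.\<close>
  define \<Psi> where "\<Psi> r = \<Phi> r / r ^ DIM('a)" for r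
  define \<Psi>' where "\<Psi>' r = (H r - real DIM('a) * \<Psi> r) / r" for r
  have D\<Psi>: "(\<Psi> has_real_derivative \<Psi>' r) (at r)" if "a < r" "r < b" for r
  proof -
    have "r > 0" using that a by simp
    moreover have "r ^ DIM('a) = r * r ^ (DIM('a) - 1)"
      using DIM_positive[where 'a = 'a] by (metis Suc_pred' power_Suc)
    ultimately show ?thesis
      unfolding \<Psi>_def \<Psi>'_def
      by (auto intro!: derivative_eq_intros \<Phi>[OF that] simp: field_simps power2_eq_square)
  qed
  have cont_\<Psi>: "continuous_on {a<..<b} \<Psi>"
    by (rule DERIV_continuous_on) (use D\<Psi> in \<open>auto intro: DERIV_subset\<close>)
  have cont_\<Psi>': "continuous_on {a<..<b} \<Psi>'"
    unfolding \<Psi>'_def using a by (intro continuous_intros H cont_\<Psi>) auto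
  have comp: "continuous_on U (\<lambda>x. h (norm x))" if "continuous_on {a<..<b} h" for h :: "real \<Rightarrow> real"
    by (intro continuous_on_compose2[OF that] continuous_intros) (auto simp: U_def)
  have cont_sgn: "continuous_on U (sgn :: 'a \<Rightarrow> 'a)"
    unfolding sgn_div_norm using a by (intro continuous_intros) (auto simp: U_def)
  \<comment> \<open>The gradient of \<phi> times the b-component of X. Summing its b-components over
    the basis gives the divergence of \<phi> X, which is the integrand of the claim.\<close>
  define df where "df b x = (if x \<in> U then \<phi> x *\<^sub>R (\<Psi> (norm x) *\<^sub>R b + (inner x b * \<Psi>' (norm x)) *\<^sub>R sgn x)
      + (\<Psi> (norm x) * inner x b) *\<^sub>R d\<phi> x else 0)" for b x :: 'a
  have df0: "df b x = 0" if "x \<notin> K" for b x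
    using that by (simp add: df_def \<phi>0 d\<phi>0)
  have cont_df: "continuous_on UNIV (df b)" for b
  proof (rule continuous_on_zero_extension[OF U cK(2) KU])
    have "continuous_on U (\<lambda>x. \<phi> x *\<^sub>R (\<Psi> (norm x) *\<^sub>R b + (inner x b * \<Psi>' (norm x)) *\<^sub>R sgn x)
      + (\<Psi> (norm x) * inner x b) *\<^sub>R d\<phi> x)"
      by (intro continuous_intros comp cont_\<Psi> cont_\<Psi>' cont_sgn
          continuous_on_subset[OF d\<phi>_cont] continuous_on_subset[OF C1_supported_continuous[OF \<phi>]]) auto
    then show "continuous_on U (df b)"
      by (rule continuous_on_eq) (simp add: df_def)
  qed (rule df0)
  have D: "GDERIV (\<lambda>x. \<phi> x * (\<Psi> (norm x) * inner x b)) x :> df b x" for b x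
  proof (cases "x \<in> U")
    case True
    have 1: "GDERIV (\<lambda>x. \<Psi> (norm x)) x :> \<Psi>' (norm x) *\<^sub>R sgn x"
      using True a by (intro GDERIV_DERIV_compose GDERIV_norm D\<Psi>) (auto simp: U_def)
    have 2: "GDERIV (\<lambda>x. inner x b) x :> b"
      unfolding gderiv_def by (auto intro!: derivative_eq_intros)
    have "GDERIV (\<lambda>x. \<phi> x * (\<Psi> (norm x) * inner x b)) x :>
        \<phi> x *\<^sub>R (\<Psi> (norm x) *\<^sub>R b + inner x b *\<^sub>R (\<Psi>' (norm x) *\<^sub>R sgn x)) + (\<Psi> (norm x) * inner x b) *\<^sub>R d\<phi> x"
      by (intro GDERIV_mult D\<phi> 1 2)
    then show ?thesis using True by (simp add: df_def)
  next
    case False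
    then have "x \<notin> K" using KU by auto
    then show ?thesis
      using GDERIV_zero_outside[OF cK(2), of x "\<lambda>x. \<phi> x * (\<Psi> (norm x) * inner x b)"] df0[of x b] \<phi>0
      by simp
  qed
  have int: "integrable lborel (\<lambda>x. inner b (df b x))" for b
    by (rule continuous_compact_support_integrable[OF _ cK(1)])
       (auto intro!: continuous_intros cont_df simp: df0)
  have zero: "(\<integral>x. inner b (df b x) \<partial>lborel) = 0" for b
    by (rule integral_derivative_compact_support[OF D[unfolded gderiv_def] _ cK(1)])
       (auto intro!: continuous_intros cont_df simp: \<phi>0)
  have eq: "(\<Sum>b\<in>Basis. inner b (df b x)) =
      \<Phi> (norm x) / norm x ^ DIM('a) * inner x (d\<phi> x) + H (norm x) * \<phi> x" for x
  proof (cases "x \<in> U")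
    case True
    then have x: "norm x > 0" using a by (auto simp: U_def)
    have "(\<Sum>b\<in>Basis. inner b (df b x)) =
      (\<Sum>b\<in>Basis. \<phi> x * \<Psi> (norm x) + \<phi> x * \<Psi>' (norm x) * (inner x b * inner (sgn x) b)
        + \<Psi> (norm x) * (inner x b * inner (d\<phi> x) b))"
      using True by (intro sum.cong) (auto simp: df_def inner_add_right inner_commute algebra_simps)
    also have "\<dots> = real DIM('a) * (\<phi> x * \<Psi> (norm x)) + \<phi> x * \<Psi>' (norm x) * inner x (sgn x)
        + \<Psi> (norm x) * inner x (d\<phi> x)"
      by (simp add: sum.distrib euclidean_inner[of x "sgn x"] euclidean_inner[of x "d\<phi> x"]
          sum_distrib_left)
    also have "inner x (sgn x) = norm x"
      using x by (simp add: sgn_div_norm power2_norm_eq_inner[symmetric] power2_eq_square)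
    also have "real DIM('a) * (\<phi> x * \<Psi> (norm x)) + \<phi> x * \<Psi>' (norm x) * norm x = H (norm x) * \<phi> x"
      using x unfolding \<Psi>'_def by (simp add: field_simps)
    finally show ?thesis by (simp add: \<Psi>_def)
  next
    case False
    then have "x \<notin> K" using KU by auto
    then show ?thesis by (simp add: df0 \<phi>0 d\<phi>0)
  qed
  show "integrable lborel (\<lambda>x. \<Phi> (norm x) / norm x ^ DIM('a) * inner x (d\<phi> x) + H (norm x) * \<phi> x)"
    unfolding eq[symmetric] by (intro Bochner_Integration.integrable_sum int)
  show "(\<integral>x. \<Phi> (norm x) / norm x ^ DIM('a) * inner x (d\<phi> x) + H (norm x) * \<phi> x \<partial>lborel) = 0"
    unfolding eq[symmetric] by (simp add: Bochner_Integration.integral_sum int zero)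
qed

text \<open>Subsolutions correspond to \<open>\<epsilon> = 1\<close>, supersolutions to \<open>\<epsilon> = - 1\<close>.\<close>

locale weak_inequality =
  fixes p \<epsilon> :: real and V u :: "'a::euclidean_space \<Rightarrow> real" and D :: "'a set"
  assumes p: "1 < p" and D: "open D" and u: "Ck_on 1 D u" and u_pos: "\<And>x. x \<in> D \<Longrightarrow> 0 < u x"
    and V_meas: "V \<in> borel_measurable (lebesgue_on D)"
    and V_bdd: "\<And>K. compact K \<Longrightarrow> K \<subseteq> D \<Longrightarrow> \<exists>C. AE x in lebesgue. x \<in> K \<longrightarrow> \<bar>V x\<bar> \<le> C"
    and weak: "\<And>\<phi>. test_function D \<phi> \<Longrightarrow> \<forall>x. 0 \<le> \<phi> x \<Longrightarrow> \<epsilon> * weak_form p V D u \<phi> \<le> 0"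
begin

text \<open>The integrand of the weak form, simplified by positivity of u. Gradient and value of the
  test function are separate arguments, so that bounds and measurability can be stated for
  continuous data alone.\<close>

definition tested :: "('a \<Rightarrow> 'a) \<Rightarrow> ('a \<Rightarrow> real) \<Rightarrow> 'a \<Rightarrow> real" where
  "tested w \<psi> x = inner (flux p (grad u x)) (w x) + V x * u x powr (p - 1) * \<psi> x"

lemma u_cont: "continuous_on D u"
  using Ck_on_SucD[of 0 D u] u by simp

lemma grad_u_cont: "continuous_on D (grad u)"
  using u by (rule Ck_on_1_grad_continuous)

lemma weak_form_eq: "weak_form p V D u \<phi> = (LINT x:D|lebesgue. tested (grad \<phi>) \<phi> x)"
  unfolding weak_form_def
proof (rule set_lebesgue_integral_cong)
  show "\<forall>x. x \<in> D \<longrightarrow> norm (grad u x) powr (p - 2) * inner (grad u x) (grad \<phi> x)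
      + V x * \<bar>u x\<bar> powr (p - 2) * u x * \<phi> x = tested (grad \<phi>) \<phi> x"
    using u_pos powr_minus_2_mult[of "u _" p]
    by (auto simp: tested_def flux_def mult.assoc less_imp_le)
qed (use D in auto)

lemma tested_measurable:
  assumes "continuous_on UNIV w" "continuous_on UNIV \<psi>"
  shows "(\<lambda>x. indicator D x *\<^sub>R tested w \<psi> x) \<in> borel_measurable lebesgue"
proof -
  have S: "D \<in> sets lebesgue" using D by auto
  have [measurable]: "u \<in> borel_measurable (lebesgue_on D)" "grad u \<in> borel_measurable (lebesgue_on D)"
    "w \<in> borel_measurable (lebesgue_on D)" "\<psi> \<in> borel_measurable (lebesgue_on D)"
    using S assms u_cont grad_u_cont
    by (auto intro!: continuous_imp_measurable_on_sets_lebesgue intro: continuous_on_subset)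
  note V_meas[measurable]
  have "tested w \<psi> \<in> borel_measurable (lebesgue_on D)"
    unfolding tested_def flux_def by measurable
  then show ?thesis
    using S by (simp add: borel_measurable_restrict_space_iff)
qed

text \<open>The constant depends on u, V and K but not on the test function, so a single dominating
  function serves a whole sequence of test functions.\<close>

lemma tested_bound:
  assumes K: "compact K" "K \<subseteq> D"
  shows "\<exists>B\<ge>0. AE x in lebesgue. x \<in> K \<longrightarrow>
    (\<forall>w \<psi>. \<bar>tested w \<psi> x\<bar> \<le> B * (norm (w x) + \<bar>\<psi> x\<bar>))"
proof -
  obtain C where C: "AE x in lebesgue. x \<in> K \<longrightarrow> \<bar>V x\<bar> \<le> C" using V_bdd[OF K] by blast
  have "compact (u ` K)" "compact (grad u ` K)"
    using K u_cont grad_u_cont by (auto intro: compact_continuous_image continuous_on_subset)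
  then have "bounded (u ` K)" "bounded (grad u ` K)" by (auto intro: compact_imp_bounded)
  then obtain C1 C2 where C12: "\<And>x. x \<in> K \<Longrightarrow> \<bar>u x\<bar> \<le> C1" "\<And>x. x \<in> K \<Longrightarrow> norm (grad u x) \<le> C2"
    by (auto simp: bounded_iff)
  define B where "B = max 0 (max (C2 powr (p - 1)) (C * C1 powr (p - 1)))"
  have "\<bar>tested w \<psi> x\<bar> \<le> B * (norm (w x) + \<bar>\<psi> x\<bar>)" if x: "x \<in> K" and V: "\<bar>V x\<bar> \<le> C" for w \<psi> x
  proof -
    have "u x > 0" using x K u_pos by auto
    then have "\<bar>V x * u x powr (p - 1)\<bar> \<le> C * C1 powr (p - 1)"
      unfolding abs_mult using V C12(1)[OF x] p
      by (intro mult_mono) (auto intro!: powr_mono2)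
    also have "\<dots> \<le> B" by (simp add: B_def)
    finally have V': "\<bar>V x * u x powr (p - 1)\<bar> \<le> B" .
    have "norm (flux p (grad u x)) \<le> C2 powr (p - 1)"
      unfolding norm_flux using C12(2)[OF x] p by (intro powr_mono2) auto
    also have "\<dots> \<le> B" by (simp add: B_def)
    finally have F: "norm (flux p (grad u x)) \<le> B" .
    have "\<bar>tested w \<psi> x\<bar> \<le> norm (flux p (grad u x)) * norm (w x) + \<bar>V x * u x powr (p - 1)\<bar> * \<bar>\<psi> x\<bar>"
      unfolding tested_def
      by (intro abs_triangle_ineq[THEN order_trans] add_mono Cauchy_Schwarz_ineq2) (simp add: abs_mult)
    also have "\<dots> \<le> B * norm (w x) + B * \<bar>\<psi> x\<bar>"
      using V' F by (intro add_mono mult_right_mono) auto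
    finally show ?thesis by (simp add: algebra_simps)
  qed
  then have "AE x in lebesgue. x \<in> K \<longrightarrow> (\<forall>w \<psi>. \<bar>tested w \<psi> x\<bar> \<le> B * (norm (w x) + \<bar>\<psi> x\<bar>))"
    using C by (auto elim: eventually_mono)
  then show ?thesis by (intro exI[of _ B]) (auto simp: B_def)
qed

lemma integrable_indicator_compact:
  assumes "compact (K :: 'a set)"
  shows "integrable lebesgue (\<lambda>x. c * indicator K x :: real)"
proof -
  have "emeasure lborel K < \<infinity>" 
    by (rule emeasure_bounded_finite[OF compact_imp_bounded[OF assms]])
  then show ?thesis
    using assms by (intro integrable_mult_right integrable_real_indicator) (auto simp: borel_compact)
qed

lemma tested_integrable:
  assumes K: "compact K" "K \<subseteq> D" and w: "continuous_on UNIV w" "\<And>x. x \<notin> K \<Longrightarrow> w x = 0"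
    and \<psi>: "continuous_on UNIV \<psi>" "\<And>x. x \<notin> K \<Longrightarrow> \<psi> x = 0"
  shows "set_integrable lebesgue D (tested w \<psi>)"
proof -
  obtain B where B: "0 \<le> B" "AE x in lebesgue. x \<in> K \<longrightarrow>
      (\<forall>w \<psi>. \<bar>tested w \<psi> x\<bar> \<le> B * (norm (w x) + \<bar>\<psi> x\<bar>))"
    using tested_bound[OF K] by blast
  obtain C1 where C1: "0 \<le> C1" "\<forall>x. norm (w x) \<le> C1"
    using continuous_compact_support_bounded[OF w(1) K(1) w(2)] by auto
  obtain C2 where C2: "0 \<le> C2" "\<forall>x. norm (\<psi> x) \<le> C2"
    using continuous_compact_support_bounded[OF \<psi>(1) K(1) \<psi>(2)] by auto
  show ?thesis
    unfolding set_integrable_def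
  proof (rule Bochner_Integration.integrable_bound[OF integrable_indicator_compact[OF K(1)]])
    show "AE x in lebesgue. norm (indicator D x *\<^sub>R tested w \<psi> x) \<le> norm (B * (C1 + C2) * indicator K x)"
      using B(2)
    proof eventually_elim
      case (elim x)
      show ?case
      proof (cases "x \<in> K")
        case True
        have "\<bar>tested w \<psi> x\<bar> \<le> B * (norm (w x) + \<bar>\<psi> x\<bar>)" using elim True by blast
        also have "\<dots> \<le> B * (C1 + C2)"
          using B(1) C1(2) C2(2) by (intro mult_left_mono add_mono) auto
        finally show ?thesis using True K by (auto simp: indicator_def)
      qed (simp add: tested_def w \<psi>)
    qed
  qed (rule tested_measurable[OF w(1) \<psi>(1)])
qed

text \<open>Mollifications of \<phi> are admissible test functions; they and their gradients
  converge pointwise with uniform bounds and supports in one compact subset of D. Dominated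
  convergence carries the weak inequality to the limit.\<close>

lemma weak_inequality_C1:
  assumes \<phi>: "C1_supported K \<phi> d\<phi>" and K: "K \<subseteq> D" and nn: "\<And>x. 0 \<le> \<phi> x"
  shows "\<epsilon> * (LINT x:D|lebesgue. tested d\<phi> \<phi> x) \<le> 0"
proof -
  have cK: "compact K" and \<phi>0: "\<And>x. x \<notin> K \<Longrightarrow> \<phi> x = 0" and d\<phi>_cont: "continuous_on UNIV d\<phi>"
    using \<phi> by (auto simp: C1_supported_def)
  note \<phi>_cont = C1_supported_continuous[OF \<phi>]
  note d\<phi>0 = C1_supported_grad_zero[OF \<phi>]
  obtain \<delta> where \<delta>: "\<delta> > 0" "(\<Union>x\<in>K. cball x \<delta>) \<subseteq> D"
    using compact_subset_open_imp_cball_epsilon_subset[OF cK D K] by blast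
  \<comment> \<open>The closed \<delta>-neighbourhood of K, written as a sum of compact sets. It
    contains the supports of all mollifications, whose radii are at most \<delta>.\<close>
  define K' where "K' = {x + y | x y. x \<in> K \<and> y \<in> cball 0 \<delta>}"
  have cK': "compact K'" unfolding K'_def using cK by (intro compact_sums) auto
  have K': "K' \<subseteq> D" using \<delta>(2) by (force simp: K'_def dist_norm)
  define h where "h k = \<delta> / real (Suc k)" for k
  have h: "0 < h k" "h k \<le> \<delta>" for k
    using \<delta>(1) by (auto simp: h_def field_simps)
  have "h \<longlonglongrightarrow> \<delta> * 0"
    using tendsto_mult[OF tendsto_const LIMSEQ_inverse_real_of_nat, of \<delta>]
    by (simp add: h_def[abs_def] divide_inverse)
  then have h_lim: "h \<longlonglongrightarrow> 0" by simp
  have "\<forall>k. \<exists>\<rho>. mollifier (h k) (\<rho> :: 'a \<Rightarrow> real)"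
    using mollifier_exists[OF h(1)] unfolding mollifier_def by metis
  then obtain \<rho> where \<rho>: "\<And>k. mollifier (h k) (\<rho> k :: 'a \<Rightarrow> real)" by metis
  then have sm: "smooth (\<rho> k)" for k by (simp add: mollifier_def)
  define \<phi>k where "\<phi>k k = conv \<phi> (\<rho> k)" for k
  have sm\<phi>: "smooth (\<phi>k k)" for k
    unfolding \<phi>k_def by (rule smooth_conv[OF \<phi>_cont cK \<phi>0 sm])
  have out: "\<phi>k k x = 0" if "x \<notin> K'" for k x
  proof -
    have "\<phi> y * \<rho> k (x - y) = 0" for y
    proof (cases "y \<in> K")
      case True
      have "x - y \<notin> cball 0 \<delta>"
      proof
        assume "x - y \<in> cball 0 \<delta>"
        with True have "y + (x - y) \<in> K'" unfolding K'_def by blast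
        then show False using that by simp
      qed
      then have "h k \<le> norm (x - y)" using h(2)[of k] by simp
      then show ?thesis using \<rho>[of k] by (simp add: mollifier_def)
    qed (simp add: \<phi>0)
    then have eq0: "(\<lambda>y. \<phi> y * \<rho> k (x - y)) = (\<lambda>_. 0)" by (rule ext)
    show ?thesis unfolding \<phi>k_def conv_def eq0 by simp
  qed
  have sub: "closure {x. \<phi>k k x \<noteq> 0} \<subseteq> K'" for k
    using out by (intro closure_minimal compact_imp_closed[OF cK']) auto
  have test: "test_function D (\<phi>k k)" for k
    unfolding test_function_def
  proof (intro conjI)
    show "compact (closure {x. \<phi>k k x \<noteq> 0})"
      using compact_Int_closed[OF cK' closed_closure] sub[of k] by (metis inf.absorb2)
    show "closure {x. \<phi>k k x \<noteq> 0} \<subseteq> D" using sub[of k] K' by (rule order_trans)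
  qed (use sm\<phi> in \<open>auto simp: smooth_def\<close>)
  have nonneg: "0 \<le> \<phi>k k x" for k x
    unfolding \<phi>k_def conv_def using nn \<rho>[of k]
    by (intro Bochner_Integration.integral_nonneg) (auto simp: mollifier_def)
  have C1k: "C1_supported K' (\<phi>k k) (grad (\<phi>k k))" for k
    unfolding C1_supported_def using cK' out smooth_GDERIV[OF sm\<phi>] smooth_grad_continuous[OF sm\<phi>]
    by auto
  have approx: "\<bar>conv f (\<rho> k) x\<bar> \<le> C"
    if "continuous_on UNIV f" "\<And>x. x \<notin> K \<Longrightarrow> f x = 0" "\<And>x. \<bar>f x\<bar> \<le> C" for f k x C
    using conv_mollifier_close[OF that(1) cK that(2) \<rho>[of k], where x = x and c = 0 and e = C] that(3)
    by simp
  have conv_lim: "(\<lambda>k. conv f (\<rho> k) x) \<longlonglongrightarrow> f x"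
    if f: "continuous_on UNIV f" "\<And>x. x \<notin> K \<Longrightarrow> f x = 0" for f x
  proof (rule LIMSEQ_I)
    fix e :: real assume "0 < e"
    then obtain s where s: "s > 0" "\<And>y. dist y x < s \<Longrightarrow> dist (f y) (f x) < e / 2"
      using f(1) unfolding continuous_on_iff by (metis UNIV_I half_gt_zero)
    obtain k0 where k0: "\<And>k. k \<ge> k0 \<Longrightarrow> h k < s"
      using order_tendstoD(2)[OF h_lim s(1)] unfolding eventually_sequentially by blast
    have "\<bar>conv f (\<rho> k) x - f x\<bar> \<le> e / 2" if "k \<ge> k0" for k
      using s(2) k0[OF that]
      by (intro conv_mollifier_close[OF f(1) cK f(2) \<rho>[of k]])
         (auto simp: dist_commute dist_real_def intro: less_imp_le)
    then show "\<exists>k0. \<forall>k\<ge>k0. norm (conv f (\<rho> k) x - f x) < e"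
      using \<open>0 < e\<close> by (intro exI[of _ k0]) force
  qed
  obtain C1 where C1: "0 \<le> C1" "\<forall>x. norm (\<phi> x) \<le> C1"
    using continuous_compact_support_bounded[OF \<phi>_cont cK \<phi>0] by auto
  obtain C2 where C2: "0 \<le> C2" "\<forall>x. norm (d\<phi> x) \<le> C2"
    using continuous_compact_support_bounded[OF d\<phi>_cont cK d\<phi>0] by auto
  have partial: "inner b (grad (\<phi>k k) x) = conv (\<lambda>y. inner b (d\<phi> y)) (\<rho> k) x" for b k x
    unfolding \<phi>k_def by (rule conv_partial_swap[OF \<phi> sm])
  have b_cont: "continuous_on UNIV (\<lambda>y. inner b (d\<phi> y))" for b
    by (intro continuous_intros d\<phi>_cont)
  have bound1: "\<bar>\<phi>k k x\<bar> \<le> C1" for k x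
    unfolding \<phi>k_def using C1(2) by (intro approx \<phi>_cont \<phi>0) auto
  \<comment> \<open>Convolution bounds are available for scalar functions, so the gradient is
    bounded component by component; this costs the factor \<open>DIM('a)\<close>.\<close>
  have bound2: "norm (grad (\<phi>k k) x) \<le> real DIM('a) * C2" for k x
  proof -
    have "\<bar>inner b (grad (\<phi>k k) x)\<bar> \<le> C2" if "b \<in> Basis" for b
      unfolding partial
    proof (rule approx[OF b_cont])
      show "\<bar>inner b (d\<phi> y)\<bar> \<le> C2" for y
        using Cauchy_Schwarz_ineq2[of b "d\<phi> y"] C2(2) that by (auto intro: order_trans)
    qed (simp add: d\<phi>0)
    then have "(\<Sum>b\<in>Basis. \<bar>inner (grad (\<phi>k k) x) b\<bar>) \<le> (\<Sum>b\<in>(Basis :: 'a set). C2)"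
      by (intro sum_mono) (auto simp: inner_commute)
    then show ?thesis using norm_le_l1[of "grad (\<phi>k k) x"] by simp
  qed
  have lim1: "(\<lambda>k. \<phi>k k x) \<longlonglongrightarrow> \<phi> x" for x
    unfolding \<phi>k_def by (rule conv_lim[OF \<phi>_cont \<phi>0])
  have lim2: "(\<lambda>k. grad (\<phi>k k) x) \<longlonglongrightarrow> d\<phi> x" for x
  proof -
    have "(\<lambda>k. \<Sum>b\<in>Basis. inner b (grad (\<phi>k k) x) *\<^sub>R b) \<longlonglongrightarrow> (\<Sum>b\<in>Basis. inner b (d\<phi> x) *\<^sub>R b)"
      unfolding partial
      by (intro tendsto_sum tendsto_scaleR tendsto_const conv_lim b_cont) (simp add: d\<phi>0)
    moreover have "(\<Sum>b\<in>Basis. inner b v *\<^sub>R b) = v" for v :: 'a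
      using euclidean_representation[of v] by (simp add: inner_commute)
    ultimately show ?thesis by simp
  qed
  obtain B where B: "0 \<le> B" "AE x in lebesgue. x \<in> K' \<longrightarrow>
      (\<forall>w \<psi>. \<bar>tested w \<psi> x\<bar> \<le> B * (norm (w x) + \<bar>\<psi> x\<bar>))"
    using tested_bound[OF cK' K'] by blast
  have "(\<lambda>k. \<integral>x. indicator D x *\<^sub>R tested (grad (\<phi>k k)) (\<phi>k k) x \<partial>lebesgue)
      \<longlonglongrightarrow> (\<integral>x. indicator D x *\<^sub>R tested d\<phi> \<phi> x \<partial>lebesgue)"
  proof (rule integral_dominated_convergence)
    show "(\<lambda>x. indicator D x *\<^sub>R tested d\<phi> \<phi> x) \<in> borel_measurable lebesgue"
      by (rule tested_measurable[OF d\<phi>_cont \<phi>_cont])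
    show "(\<lambda>x. indicator D x *\<^sub>R tested (grad (\<phi>k k)) (\<phi>k k) x) \<in> borel_measurable lebesgue" for k
      by (rule tested_measurable[OF smooth_grad_continuous[OF sm\<phi>] smooth_continuous[OF sm\<phi>]])
    show "integrable lebesgue (\<lambda>x. B * (real DIM('a) * C2 + C1) * indicator K' x)"
      by (rule integrable_indicator_compact[OF cK'])
    show "AE x in lebesgue. (\<lambda>k. indicator D x *\<^sub>R tested (grad (\<phi>k k)) (\<phi>k k) x)
        \<longlonglongrightarrow> indicator D x *\<^sub>R tested d\<phi> \<phi> x"
      unfolding tested_def by (intro AE_I2 tendsto_intros lim1 lim2)
    show "AE x in lebesgue. norm (indicator D x *\<^sub>R tested (grad (\<phi>k k)) (\<phi>k k) x)
        \<le> B * (real DIM('a) * C2 + C1) * indicator K' x" for k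
      using B(2)
    proof eventually_elim
      case (elim x)
      show ?case
      proof (cases "x \<in> K'")
        case True
        have "\<bar>tested (grad (\<phi>k k)) (\<phi>k k) x\<bar> \<le> B * (norm (grad (\<phi>k k) x) + \<bar>\<phi>k k x\<bar>)"
          using elim True by blast
        also have "\<dots> \<le> B * (real DIM('a) * C2 + C1)"
          using B(1) bound1 bound2 by (intro mult_left_mono add_mono) auto
        finally show ?thesis using True K' by (auto simp: indicator_def)
      qed (simp add: tested_def out C1_supported_grad_zero[OF C1k])
    qed
  qed
  then have "(\<lambda>k. \<epsilon> * weak_form p V D u (\<phi>k k)) \<longlonglongrightarrow> \<epsilon> * (LINT x:D|lebesgue. tested d\<phi> \<phi> x)"
    unfolding weak_form_eq set_lebesgue_integral_def by (intro tendsto_mult tendsto_const)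
  then show ?thesis
    using weak[OF test] nonneg by (intro LIMSEQ_le_const2) auto
qed

text \<open>The test function is the square of \<open>(\<epsilon> (u - v) - \<delta>)\<^sup>+\<close> with \<open>v = A + B W\<close>: the shift by \<open>\<delta>\<close> makes its
  support a compact subset of the open annulus, and squaring makes it continuously differentiable.\<close>

lemma comparison:
  assumes ab: "0 < a" and annulus: "\<And>x. a \<le> norm x \<Longrightarrow> norm x \<le> b \<Longrightarrow> x \<in> D"
    and W: "\<And>r. a \<le> r \<Longrightarrow> r \<le> b \<Longrightarrow> (W has_real_derivative W' r) (at r)"
    and W': "continuous_on {a..b} W'"
    and \<Phi>: "\<And>r. a \<le> r \<Longrightarrow> r \<le> b \<Longrightarrow> ((\<lambda>r. flux p (W' r) * r ^ (DIM('a) - 1)) has_real_derivative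
        \<sigma> * G r * r ^ (DIM('a) - 1)) (at r)"
    and G: "continuous_on {a..b} G" "\<And>r. a \<le> r \<Longrightarrow> r \<le> b \<Longrightarrow> 0 \<le> G r"
    and V_le: "AE x in lebesgue. a \<le> norm x \<and> norm x \<le> b \<longrightarrow> \<bar>V x\<bar> \<le> G (norm x)"
    and \<epsilon>: "\<bar>\<epsilon>\<bar> = 1" and B: "\<sigma> * sgn B = - \<epsilon>"
    and bd: "\<And>x. norm x = a \<or> norm x = b \<Longrightarrow> \<epsilon> * (u x - (A + B * W (norm x))) \<le> 0"
    and small: "\<And>x. a \<le> norm x \<Longrightarrow> norm x \<le> b \<Longrightarrow> 0 < \<epsilon> * (u x - (A + B * W (norm x))) \<Longrightarrow> u x \<le> \<bar>B\<bar>"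
    and x0: "a \<le> norm x0" "norm x0 \<le> b"
  shows "\<epsilon> * (u x0 - (A + B * W (norm x0))) \<le> 0"
proof (rule field_le_epsilon)
  fix \<delta> :: real assume \<delta>: "0 < \<delta>"
  let ?n = "DIM('a)"
  have \<epsilon>2: "\<epsilon> * \<epsilon> = 1" using \<epsilon> by (auto simp: abs_if split: if_splits)
  define N where "N = {x::'a. a \<le> norm x \<and> norm x \<le> b}"
  define U where "U = {x::'a. a < norm x \<and> norm x < b}"
  have N_compact: "compact N"
  proof -
    have "N = cball 0 b \<inter> {x. a \<le> norm x}" by (auto simp: N_def)
    moreover have "closed {x::'a. a \<le> norm x}" by (intro closed_Collect_le continuous_intros)
    ultimately show ?thesis by (simp add: compact_Int_closed)
  qed
  have U: "open U" unfolding U_def by (intro open_Collect_conj open_Collect_less continuous_intros)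
  have ND: "N \<subseteq> D" using annulus by (auto simp: N_def)
  have UN: "U \<subseteq> N" by (auto simp: U_def N_def)
  have comp: "continuous_on N (\<lambda>x. h (norm x))" if "continuous_on {a..b} h" for h :: "real \<Rightarrow> real"
    by (intro continuous_on_compose2[OF that] continuous_intros) (auto simp: N_def)
  have W_cont: "continuous_on {a..b} W"
    by (rule DERIV_continuous_on) (use W in \<open>auto intro: DERIV_subset\<close>)
  define w where "w x = \<epsilon> * (u x - (A + B * W (norm x))) - \<delta>" for x
  define dv where "dv x = (B * W' (norm x)) *\<^sub>R sgn x" for x :: 'a
  define dw where "dw x = \<epsilon> *\<^sub>R (grad u x - dv x)" for x
  have w_cont: "continuous_on N w"
    unfolding w_def by (intro continuous_intros comp W_cont continuous_on_subset[OF u_cont ND])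
  have sgn_cont: "continuous_on N (sgn :: 'a \<Rightarrow> 'a)"
    unfolding sgn_div_norm using ab by (intro continuous_intros) (auto simp: N_def)
  have dw_cont: "continuous_on N dw"
    unfolding dw_def dv_def
    by (intro continuous_intros comp W' sgn_cont continuous_on_subset[OF grad_u_cont ND])
  define K where "K = N \<inter> w -` {0..}"
  have K_compact: "compact K"
  proof -
    have "closed K"
      unfolding K_def using w_cont compact_imp_closed[OF N_compact] by (rule continuous_closed_preimage) simp
    then have "compact (N \<inter> K)" using N_compact by (simp add: compact_Int_closed)
    then show ?thesis by (simp add: K_def)
  qed
  have KU: "K \<subseteq> U"
  proof
    fix x assume x: "x \<in> K"
    then have "0 < \<epsilon> * (u x - (A + B * W (norm x)))" using \<delta> by (auto simp: K_def w_def)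
    then have "norm x \<noteq> a" "norm x \<noteq> b" using bd[of x] by auto
    then show "x \<in> U" using x by (auto simp: K_def N_def U_def)
  qed
  define \<phi> where "\<phi> x = (if x \<in> N then (max 0 (w x))\<^sup>2 else 0)" for x
  define d\<phi> where "d\<phi> x = (if x \<in> N then (2 * max 0 (w x)) *\<^sub>R dw x else 0)" for x
  have \<phi>0: "\<phi> x = 0" and d\<phi>0: "d\<phi> x = 0" if "x \<notin> K" for x
    using that by (auto simp: \<phi>_def d\<phi>_def K_def)
  have sq: "((\<lambda>t. (max 0 t)\<^sup>2) has_real_derivative 2 * max 0 t) (at t)" for t :: real
  proof (cases t "0 :: real" rule: linorder_cases)
    case less
    have "((\<lambda>_. 0) has_real_derivative 2 * max 0 t) (at t)" using less by simp
    then show ?thesis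
      by (rule has_field_derivative_transform_within_open[where S = "{..<0}"]) (use less in auto)
  next
    case greater
    have "((\<lambda>t. t\<^sup>2) has_real_derivative 2 * max 0 t) (at t)"
      using greater by (auto intro!: derivative_eq_intros)
    then show ?thesis
      by (rule has_field_derivative_transform_within_open[where S = "{0<..}"]) (use greater in auto)
  next
    case equal
    have lim: "((\<lambda>h::real. \<bar>h\<bar>) \<longlongrightarrow> 0) (at 0)"
      using tendsto_rabs_zero[OF tendsto_ident_at] by blast
    have "((\<lambda>h::real. ((max 0 h)\<^sup>2 - (max 0 0)\<^sup>2) / (h - 0)) \<longlongrightarrow> 0) (at 0)"
      by (rule Lim_null_comparison[OF _ lim])
         (auto intro!: always_eventually simp: max_def power2_eq_square)
    then show ?thesis using equal by (simp add: has_field_derivative_iff)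
  qed
  have Dw: "GDERIV w x :> dw x" if "x \<in> U" for x
  proof -
    have x: "x \<noteq> 0" "a \<le> norm x" "norm x \<le> b" "x \<in> D" using that ab UN ND by (auto simp: U_def)
    have "u differentiable at x" using u x(4) by simp
    then have 1: "(u has_derivative (\<lambda>h. inner h (grad u x))) (at x)"
      using GDERIV_grad by (auto simp: gderiv_def)
    have "GDERIV (\<lambda>x. W (norm x)) x :> W' (norm x) *\<^sub>R sgn x"
      using x by (intro GDERIV_DERIV_compose GDERIV_norm W)
    then have 2: "((\<lambda>x. W (norm x)) has_derivative (\<lambda>h. inner h (W' (norm x) *\<^sub>R sgn x))) (at x)"
      by (simp add: gderiv_def)
    have "(w has_derivative (\<lambda>h. \<epsilon> * (inner h (grad u x) - (0 + B * inner h (W' (norm x) *\<^sub>R sgn x))) - 0)) (at x)"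
      unfolding w_def
      by (intro has_derivative_diff has_derivative_mult_right has_derivative_add has_derivative_const 1 2)
    moreover have "(\<lambda>h. \<epsilon> * (inner h (grad u x) - (0 + B * inner h (W' (norm x) *\<^sub>R sgn x))) - 0) = (\<lambda>h. inner h (dw x))"
      by (simp add: dw_def dv_def inner_diff_right mult.assoc)
    ultimately show ?thesis by (simp add: gderiv_def)
  qed
  have D\<phi>: "GDERIV \<phi> x :> d\<phi> x" for x
  proof (cases "x \<in> U")
    case True
    have "GDERIV (\<lambda>x. (max 0 (w x))\<^sup>2) x :> d\<phi> x"
      using GDERIV_DERIV_compose[OF Dw[OF True] sq] UN True by (auto simp: d\<phi>_def)
    then show ?thesis
      unfolding gderiv_def
      by (rule has_derivative_transform_within_open[OF _ U True]) (use UN in \<open>auto simp: \<phi>_def\<close>)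
  next
    case False
    then have "x \<notin> K" using KU by auto
    then show ?thesis
      using GDERIV_zero_outside[OF compact_imp_closed[OF K_compact], of x \<phi>] \<phi>0 d\<phi>0 by simp
  qed
  have "continuous_on U (\<lambda>x. (2 * max 0 (w x)) *\<^sub>R dw x)"
    by (intro continuous_intros continuous_on_subset[OF w_cont UN] continuous_on_subset[OF dw_cont UN])
  then have "continuous_on U d\<phi>"
    by (rule continuous_on_eq) (use UN in \<open>auto simp: d\<phi>_def\<close>)
  then have d\<phi>_cont: "continuous_on UNIV d\<phi>"
    by (rule continuous_on_zero_extension[OF U compact_imp_closed[OF K_compact] KU _ d\<phi>0])
  have C1: "C1_supported K \<phi> d\<phi>"
    unfolding C1_supported_def using K_compact D\<phi> d\<phi>_cont \<phi>0 by auto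
  have KD: "K \<subseteq> D" using KU UN ND by blast
  have \<phi>_nn: "0 \<le> \<phi> x" for x by (simp add: \<phi>_def)
  note \<phi>_cont = C1_supported_continuous[OF C1]
  define T where "T x = indicator D x *\<^sub>R tested d\<phi> \<phi> x" for x
  \<comment> \<open>Since \<open>flux\<close> is multiplicative, \<open>flux p B * Z\<close> is the
    equation of v = A + B W tested with \<phi>. Its integral is 0 by
    \<open>radial_flux_divergence\<close>.\<close>
  define Z where "Z x = flux p (W' (norm x)) * norm x ^ (?n - 1) / norm x ^ ?n * inner x (d\<phi> x)
      + \<sigma> * G (norm x) * \<phi> x" for x
  have T_int: "integrable lebesgue T"
    using tested_integrable[OF K_compact KD d\<phi>_cont d\<phi>0 \<phi>_cont \<phi>0]
    by (simp add: set_integrable_def T_def[abs_def])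
  have T_le: "\<epsilon> * (\<integral>x. T x \<partial>lebesgue) \<le> 0"
    using weak_inequality_C1[OF C1 KD \<phi>_nn] by (simp add: set_lebesgue_integral_def T_def)
  have Z: "integrable lborel Z" "(\<integral>x. Z x \<partial>lborel) = 0"
  proof -
    have "continuous_on {a<..<b} (\<lambda>r. \<sigma> * G r)"
      using G(1) by (intro continuous_intros) (auto intro: continuous_on_subset)
    note div = radial_flux_divergence[OF C1 KU[unfolded U_def] ab(1) \<Phi> this]
    show "integrable lborel Z" "(\<integral>x. Z x \<partial>lborel) = 0"
      unfolding Z_def by (rule div; simp)+
  qed
  then have Z_meas: "Z \<in> borel_measurable lborel" by simp
  have Z_leb: "integrable lebesgue Z" "(\<integral>x. Z x \<partial>lebesgue) = 0"
    using Z integrable_completion[OF Z_meas] integral_completion[OF Z_meas] by simp_all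
  \<comment> \<open>The difference of the relations for u and v, tested with \<phi>. Its integral is
    at most 0 by the weak inequality, while the decomposition below shows that it is nonnegative
    almost everywhere; hence it vanishes almost everywhere.\<close>
  let ?T = "\<lambda>x. \<epsilon> * T x - \<epsilon> * flux p B * Z x"
  have T_split: "?T x = 2 * max 0 (w x) * inner (flux p (grad u x) - flux p (dv x)) (grad u x - dv x)
      + (\<epsilon> * (V x * u x powr (p - 1)) + \<bar>B\<bar> powr (p - 1) * G (norm x)) * \<phi> x"
    if x: "x \<in> N" for x
  proof -
    have nx: "norm x > 0" using x ab by (auto simp: N_def)
    have "x \<in> D" using x ND by auto
    then have T1: "T x = inner (flux p (grad u x)) (d\<phi> x) + V x * u x powr (p - 1) * \<phi> x"
      by (simp add: T_def tested_def)
    have "norm x ^ ?n = norm x * norm x ^ (?n - 1)"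
      using DIM_positive[where 'a = 'a] by (metis Suc_pred' power_Suc)
    then have "flux p (W' (norm x)) * norm x ^ (?n - 1) / norm x ^ ?n * inner x (d\<phi> x)
        = flux p (W' (norm x)) * inner (sgn x) (d\<phi> x)"
      using nx by (simp add: sgn_div_norm field_simps)
    moreover have "flux p (dv x) = (flux p B * flux p (W' (norm x))) *\<^sub>R sgn x"
      using nx flux_scaleR[of p B "W' (norm x)"] flux_scaleR[of p "B * W' (norm x)" "sgn x"]
      by (simp add: dv_def flux_def[of p "sgn x"] norm_sgn)
    ultimately have Z1: "flux p B * Z x = inner (flux p (dv x)) (d\<phi> x) + flux p B * \<sigma> * G (norm x) * \<phi> x"
      by (simp add: Z_def algebra_simps)
    have "flux p B = \<bar>B\<bar> powr (p - 1) * sgn B"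
      using powr_minus_2_mult[of "\<bar>B\<bar>" p] mult_sgn_abs[of B]
      by (simp add: flux_def) (metis mult.assoc mult.commute)
    then have "flux p B * \<sigma> = \<bar>B\<bar> powr (p - 1) * (\<sigma> * sgn B)" by (simp add: ac_simps)
    then have "\<epsilon> * (flux p B * \<sigma>) = - (\<epsilon> * \<epsilon>) * \<bar>B\<bar> powr (p - 1)"
      unfolding B by (simp add: ac_simps)
    \<comment> \<open>Here the sign condition on B acts: the term from the equation of v enters
      \<open>?T\<close> as +|B|^(p-1) G \<phi>, ready to dominate the term with V.\<close>
    then have Bs: "\<epsilon> * (flux p B * \<sigma>) = - (\<bar>B\<bar> powr (p - 1))" using \<epsilon>2 by simp
    have "d\<phi> x = (2 * max 0 (w x) * \<epsilon>) *\<^sub>R (grad u x - dv x)"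
      using x by (simp add: d\<phi>_def dw_def)
    then have inn: "inner F (d\<phi> x) = (2 * max 0 (w x) * \<epsilon>) * inner F (grad u x - dv x)" for F
      by (simp only: inner_scaleR_right)
    have "\<epsilon> * (inner (flux p (grad u x)) (d\<phi> x) - inner (flux p (dv x)) (d\<phi> x))
        = (\<epsilon> * \<epsilon>) * (2 * max 0 (w x)) * inner (flux p (grad u x) - flux p (dv x)) (grad u x - dv x)"
      unfolding inner_diff_left[of "flux p (grad u x)"] inn by (simp add: algebra_simps)
    then have grd: "\<epsilon> * (inner (flux p (grad u x)) (d\<phi> x) - inner (flux p (dv x)) (d\<phi> x))
        = 2 * max 0 (w x) * inner (flux p (grad u x) - flux p (dv x)) (grad u x - dv x)"
      using \<epsilon>2 by simp
    have "?T x = \<epsilon> * (inner (flux p (grad u x)) (d\<phi> x) - inner (flux p (dv x)) (d\<phi> x))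
        + \<epsilon> * (V x * u x powr (p - 1)) * \<phi> x - \<epsilon> * (flux p B * \<sigma>) * G (norm x) * \<phi> x"
      unfolding mult.assoc[of \<epsilon> "flux p B" "Z x"] T1 Z1 by (simp add: algebra_simps)
    then show ?thesis unfolding grd Bs by (simp add: algebra_simps)
  qed
  \<comment> \<open>Where \<phi> does not vanish, w > 0, and there \<open>small\<close> provides u
    \<le> |B|. Together with |V| \<le> G this makes the bracket nonnegative for either sign of
    \<epsilon>.\<close>
  have lower: "0 \<le> (\<epsilon> * (V x * u x powr (p - 1)) + \<bar>B\<bar> powr (p - 1) * G (norm x)) * \<phi> x"
    if x: "x \<in> N" and Vx: "\<bar>V x\<bar> \<le> G (norm x)" for x
  proof (cases "\<phi> x = 0")
    case False
    then have "w x > 0" using x by (auto simp: \<phi>_def max_def split: if_splits)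
    then have "u x \<le> \<bar>B\<bar>" using small[of x] x \<delta> by (auto simp: w_def N_def)
    moreover have ux: "0 < u x" using u_pos x ND by auto
    ultimately have "u x powr (p - 1) \<le> \<bar>B\<bar> powr (p - 1)" using p by (intro powr_mono2) auto
    then have "\<bar>V x\<bar> * u x powr (p - 1) \<le> G (norm x) * \<bar>B\<bar> powr (p - 1)"
      using Vx by (intro mult_mono) auto
    moreover have "\<bar>\<epsilon> * (V x * u x powr (p - 1))\<bar> = \<bar>V x\<bar> * u x powr (p - 1)"
      using \<epsilon> by (simp add: abs_mult)
    ultimately have "0 \<le> \<epsilon> * (V x * u x powr (p - 1)) + \<bar>B\<bar> powr (p - 1) * G (norm x)"
      by (simp add: abs_le_iff mult.commute)
    then show ?thesis using \<phi>_nn by simp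
  qed simp
  have mono: "0 \<le> 2 * max 0 (w x) * inner (flux p (grad u x) - flux p (dv x)) (grad u x - dv x)" for x
    by (intro mult_nonneg_nonneg flux_monotone(1)[OF p]) auto
  have AE_nn: "AE x in lebesgue. 0 \<le> ?T x"
    using V_le
  proof eventually_elim
    case (elim x)
    show ?case
    proof (cases "x \<in> N")
      case True
      then show ?thesis unfolding T_split[OF True] using elim lower mono
        by (intro add_nonneg_nonneg) (auto simp: N_def)
    next
      case False
      then have "x \<notin> K" by (auto simp: K_def)
      then show ?thesis by (simp add: T_def tested_def Z_def \<phi>0 d\<phi>0)
    qed
  qed
  have int: "integrable lebesgue ?T" using T_int Z_leb by (intro Bochner_Integration.integrable_diff) auto
  have "(\<integral>x. ?T x \<partial>lebesgue) \<le> 0" using T_int Z_leb T_le by simp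
  then have "(\<integral>x. ?T x \<partial>lebesgue) = 0" using integral_nonneg_AE[OF AE_nn] by linarith
  then have AE0: "AE x in lebesgue. ?T x = 0"
    using integral_nonneg_eq_0_iff_AE[OF int AE_nn] by simp
  \<comment> \<open>Both nonnegative summands of \<open>?T\<close> vanish almost everywhere. By
    strict monotonicity of the flux, at such points either w \<le> 0 or the gradients of u and v
    agree, and d\<phi> is zero in both cases.\<close>
  have AEd\<phi>: "AE x in lebesgue. d\<phi> x = 0"
    using V_le AE0
  proof eventually_elim
    case (elim x)
    show ?case
    proof (cases "x \<in> N")
      case True
      have V1: "\<bar>V x\<bar> \<le> G (norm x)" using elim(1) True by (simp add: N_def)
      have "2 * max 0 (w x) * inner (flux p (grad u x) - flux p (dv x)) (grad u x - dv x) = 0"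
        using elim(2) mono[of x] lower[OF True V1] unfolding T_split[OF True] by linarith
      then have "max 0 (w x) = 0 \<or> inner (flux p (grad u x) - flux p (dv x)) (grad u x - dv x) = 0"
        by simp
      then have "max 0 (w x) = 0 \<or> grad u x = dv x"
        using flux_monotone(2)[OF p] by blast
      then show ?thesis by (auto simp: d\<phi>_def dw_def)
    next
      case False
      then show ?thesis by (simp add: d\<phi>_def)
    qed
  qed
  have op: "open {x. d\<phi> x \<noteq> 0}"
    by (intro open_Collect_neq d\<phi>_cont continuous_intros)
  have "negligible {x. d\<phi> x \<noteq> 0}"
    using AEd\<phi> AE_iff_null_sets[of "{x. d\<phi> x \<noteq> 0}" lebesgue] op
    by (simp add: negligible_iff_null_sets)
  then have d\<phi>_zero: "d\<phi> x = 0" for x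
    using open_not_negligible[OF op] by auto
  have "(\<phi> has_derivative (\<lambda>h. 0)) (at x within UNIV)" for x
    using D\<phi>[of x] by (simp add: gderiv_def d\<phi>_zero)
  then obtain c where c: "\<And>x. \<phi> x = c"
    using has_derivative_zero_constant[OF convex_UNIV, of \<phi>] by auto
  \<comment> \<open>The origin lies outside the annulus, so the constant value of \<phi> is
    0.\<close>
  have "(0::'a) \<notin> K" using KU ab by (auto simp: U_def)
  then have "\<phi> x0 = 0" using c[of 0] c[of x0] \<phi>0[of 0] by simp
  moreover have "x0 \<in> N" using x0 by (simp add: N_def)
  ultimately have "w x0 \<le> 0" by (simp add: \<phi>_def max_def split: if_splits)
  then show "\<epsilon> * (u x0 - (A + B * W (norm x0))) \<le> 0 + \<delta>" by (simp add: w_def)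
qed

end

section \<open>Wolff potentials\<close>

lemma einterval_convex:
  assumes "s \<in> einterval lo hi" "t \<in> einterval lo hi" "s \<le> x" "x \<le> t"
  shows "x \<in> einterval lo hi"
  using assms less_le_trans[of lo "ereal s" "ereal x"] le_less_trans[of "ereal x" "ereal t" hi]
  by (simp add: einterval_iff)

lemma einterval_subset:
  assumes "s \<in> einterval lo hi"
  shows "einterval lo (ereal s) \<subseteq> einterval lo hi" "einterval (ereal s) hi \<subseteq> einterval lo hi"
proof -
  show "einterval lo (ereal s) \<subseteq> einterval lo hi"
  proof
    fix x assume "x \<in> einterval lo (ereal s)"
    then show "x \<in> einterval lo hi"
      using assms less_trans[of "ereal x" "ereal s" hi] by (simp add: einterval_iff)
  qed
  show "einterval (ereal s) hi \<subseteq> einterval lo hi"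
  proof
    fix x assume "x \<in> einterval (ereal s) hi"
    then show "x \<in> einterval lo hi"
      using assms less_trans[of lo "ereal s" "ereal x"] by (simp add: einterval_iff)
  qed
qed

text \<open>Instantiated twice: for the inner integral with base \<open>wolff_base\<close> and for
  the outer one with base \<zeta>. If the base is the right end point, the signed integral F is
  negative, but F' = f holds in both orientations.\<close>

locale endpoint_integral =
  fixes lo hi a :: ereal and f :: "real \<Rightarrow> real"
  assumes ends: "a = lo \<or> a = hi"
    and cont: "continuous_on (einterval lo hi) f"
    and pos: "\<And>t. t \<in> einterval lo hi \<Longrightarrow> 0 < f t"
    and int: "\<And>t. t \<in> einterval lo hi \<Longrightarrow> interval_lebesgue_integrable lborel a (ereal t) f"
begin

definition F :: "real \<Rightarrow> real" where
  "F t = (LBINT s=a..ereal t. f s)"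

lemma F_split:
  assumes c: "c \<in> einterval lo hi" "u \<in> einterval lo hi" and "c \<le> u"
  shows "F u = F c + (LBINT s=ereal c..ereal u. f s)"
proof -
  have cu: "ereal c \<le> ereal u" using \<open>c \<le> u\<close> by simp
  have "interval_lebesgue_integrable lborel (min a (min (ereal c) (ereal u))) (max a (max (ereal c) (ereal u))) f"
  proof (cases "a = lo")
    case True
    then have "a \<le> ereal c" "a \<le> ereal u" using c by (auto simp: einterval_iff)
    then have "min a (min (ereal c) (ereal u)) = a" "max a (max (ereal c) (ereal u)) = u"
      using cu by (auto simp: min_def max_def)
    then show ?thesis using int[OF c(2)] by simp
  next
    case False
    then have "ereal c \<le> a" "ereal u \<le> a" using ends c by (auto simp: einterval_iff)
    then have "min a (min (ereal c) (ereal u)) = c" "max a (max (ereal c) (ereal u)) = a"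
      using cu by (auto simp: min_def max_def)
    then show ?thesis using int[OF c(1)] by (simp add: interval_integrable_endpoints_reverse)
  qed
  from interval_integral_sum[OF this] show ?thesis by (simp add: F_def)
qed

text \<open>The base may be infinite or a singularity of f, so the fundamental theorem of calculus
  is applied from an interior point c; by \<open>F_split\<close> this changes F only by a
  constant.\<close>

lemma F_deriv:
  assumes t: "t \<in> einterval lo hi"
  shows "(F has_real_derivative f t) (at t)"
proof -
  obtain e where e: "0 < e" "cball t e \<subseteq> einterval lo hi"
    using t open_einterval open_contains_cball by blast
  define c d where "c = t - e" and "d = t + e"
  have cd: "c < t" "t < d" "{c..d} \<subseteq> einterval lo hi"
    using e by (auto simp: c_def d_def cball_eq_atLeastAtMost)
  have "((\<lambda>u. LBINT y=ereal c..ereal u. f y) has_vector_derivative f t) (at t within {c..d})"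
    using cd by (intro interval_integral_FTC2 continuous_on_subset[OF cont]) auto
  then have "((\<lambda>u. LBINT y=ereal c..ereal u. f y) has_real_derivative f t) (at t)"
    using cd by (simp add: at_within_Icc_at has_real_derivative_iff_has_vector_derivative)
  then have D: "((\<lambda>u. F c + (LBINT y=ereal c..ereal u. f y)) has_real_derivative f t) (at t)"
    using DERIV_add[OF DERIV_const] by fastforce
  have eq: "F c + (LBINT y=ereal c..ereal u. f y) = F u" if "u \<in> {c<..<d}" for u
  proof -
    have "c \<in> {c..d}" "u \<in> {c..d}" using that by auto
    then show ?thesis
      using F_split[OF subsetD[OF cd(3)] subsetD[OF cd(3)], of c u] that by simp
  qed
  show ?thesis
    by (rule has_field_derivative_transform_within_open[OF D, where S = "{c<..<d}"])
       (use cd eq in auto)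
qed

lemma F_strict:
  assumes s: "s \<in> einterval lo hi" and t: "t \<in> einterval lo hi" and "s < t"
  shows "F s < F t"
proof (rule DERIV_pos_imp_increasing[OF \<open>s < t\<close>])
  fix x assume "s \<le> x" "x \<le> t"
  then have "x \<in> einterval lo hi" by (rule einterval_convex[OF s t])
  then show "\<exists>y. (F has_real_derivative y) (at x) \<and> 0 < y"
    using F_deriv pos by blast
qed

lemma integral_nonneg:
  assumes "S \<subseteq> einterval lo hi"
  shows "0 \<le> (LINT x:S|lborel. f x)"
  unfolding set_lebesgue_integral_def
  using assms pos by (intro Bochner_Integration.integral_nonneg) (auto simp: indicator_def intro: less_imp_le)

lemma integral_empty: "(LINT x:{}|lborel. f x) = 0"
  by (simp add: set_lebesgue_integral_def)

text \<open>Positivity of f gives F s \<ge> 0 at a point s between the base and t; strict growth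
  from s to t does the rest.\<close>

lemma F_pos:
  assumes "a = lo" and t: "t \<in> einterval lo hi"
  shows "0 < F t"
proof -
  have "lo < ereal t" "ereal t < hi" using t by (auto simp: einterval_iff)
  then obtain s where s: "lo < ereal s" "ereal s < ereal t" using ereal_dense2 by blast
  then have s': "s \<in> einterval lo hi"
    using less_trans[OF s(2) \<open>ereal t < hi\<close>] by (simp add: einterval_iff)
  have "0 \<le> F s"
    unfolding F_def interval_lebesgue_integral_def using assms(1) s
      integral_nonneg[OF einterval_subset(1)[OF s']]
    by (simp add: less_imp_le)
  also have "F s < F t" using s by (intro F_strict s' t) simp
  finally show ?thesis .
qed

lemma F_neg:
  assumes "a = hi" and t: "t \<in> einterval lo hi"
  shows "F t < 0"
proof -
  have "lo < ereal t" "ereal t < hi" using t by (auto simp: einterval_iff)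
  then obtain s where s: "ereal t < ereal s" "ereal s < hi" using ereal_dense2 by blast
  then have s': "s \<in> einterval lo hi"
    using less_trans[OF \<open>lo < ereal t\<close> s(1)] by (simp add: einterval_iff)
  have "F t < F s" using s by (intro F_strict s' t) simp
  also have "F s \<le> 0"
    unfolding F_def interval_lebesgue_integral_def using assms(1) s
      integral_nonneg[OF einterval_subset(2)[OF s']]
    by (auto simp: not_le)
  finally show ?thesis .
qed

text \<open>Continuity of the integral along a decreasing sequence of intervals with empty
  intersection. Together with its counterpart for half-lines this is the source of W tending to 0 at
  \<zeta>.\<close>

lemma F_small_left:
  assumes "a = lo" "lo = 0" "0 < hi" "0 < e"
  shows "\<exists>c\<in>einterval lo hi. F c < e"
proof -
  obtain h where h: "0 < h" "ereal h < hi" using \<open>0 < hi\<close> ereal_dense2[of 0 hi] by auto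
  define c where "c k = h / real (Suc k)" for k
  have c: "0 < c k" "c k \<le> h" for k using h by (auto simp: c_def field_simps)
  then have c_in: "c k \<in> einterval lo hi" for k
    using assms h by (auto simp: einterval_iff intro: le_less_trans[of "ereal (c k)" "ereal h"])
  have ein: "einterval lo (c k) = {0<..<c k}" for k
    using assms(2) by (auto simp: einterval_def)
  have c_mono: "c i \<le> c j" if "j \<le> i" for i j
    unfolding c_def using h that by (intro divide_left_mono) auto
  have dec: "decseq (\<lambda>k. {0<..<c k})"
  proof (rule decseq_SucI)
    show "{0<..<c (Suc k)} \<subseteq> {0<..<c k}" for k using c_mono[of k "Suc k"] by auto
  qed
  have "(\<Inter>k. {0<..<c k}) = {}"
  proof (rule ccontr)
    assume "\<not> ?thesis"
    then obtain x where "x \<in> (\<Inter>k. {0<..<c k})" by blast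
    then have x: "0 < x" "\<And>k. x < c k" by auto
    obtain k where "inverse (real (Suc k)) < x / h"
      using reals_Archimedean[of "x / h"] x h by auto
    then have "c k < x" using h(1) by (simp add: c_def field_simps)
    then show False using x(2)[of k] by simp
  qed
  moreover have "set_integrable lborel {0<..<c 0} f"
    using int[OF c_in[of 0]] c(1)[of 0] assms ein[of 0]
    by (simp add: interval_lebesgue_integrable_def)
  ultimately have "(\<lambda>k. LINT x:{0<..<c k}|lborel. f x) \<longlonglongrightarrow> 0"
    using set_integral_cont_down[OF _ dec, of lborel f] integral_empty by simp
  moreover have "(LINT x:{0<..<c k}|lborel. f x) = F (c k)" for k
    unfolding F_def interval_lebesgue_integral_def using c(1)[of k] assms ein[of k] by simp
  ultimately have "(\<lambda>k. F (c k)) \<longlonglongrightarrow> 0" by simp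
  then have "eventually (\<lambda>k. F (c k) < e) sequentially" using assms(4) by (rule order_tendstoD)
  then show ?thesis using c_in by (auto simp: eventually_sequentially)
qed

lemma F_small_right:
  assumes "a = hi" "hi = \<infinity>" "lo = ereal l" "0 < e"
  shows "\<exists>c\<in>einterval lo hi. - F c < e"
proof -
  define c where "c k = l + 1 + real k" for k
  have c_in: "c k \<in> einterval lo hi" for k
    using assms by (auto simp: einterval_iff c_def)
  have ein: "einterval (c k) hi = {c k<..}" for k
    using assms(2) by (auto simp: einterval_def)
  have dec: "decseq (\<lambda>k. {c k<..})"
    unfolding decseq_def c_def by auto
  have "(\<Inter>k. {c k<..}) = {}"
  proof (rule ccontr)
    assume "\<not> ?thesis"
    then obtain x where x: "\<And>k. c k < x" by auto
    obtain k where "x - l < real k" using reals_Archimedean2 by blast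
    then show False using x[of k] by (simp add: c_def)
  qed
  moreover have "set_integrable lborel {c 0<..} f"
    using int[OF c_in[of 0]] assms ein[of 0]
    by (simp add: interval_lebesgue_integrable_def)
  ultimately have "(\<lambda>k. LINT x:{c k<..}|lborel. f x) \<longlonglongrightarrow> 0"
    using set_integral_cont_down[OF _ dec, of lborel f] integral_empty by simp
  moreover have "(LINT x:{c k<..}|lborel. f x) = - F (c k)" for k
    unfolding F_def interval_lebesgue_integral_def using assms ein[of k] by simp
  ultimately have "(\<lambda>k. - F (c k)) \<longlonglongrightarrow> 0" by simp
  then have "eventually (\<lambda>k. - F (c k) < e) sequentially" using assms(4) by (rule order_tendstoD)
  then show ?thesis using c_in by (auto simp: eventually_sequentially)
qed

end

section \<open>The Wolff potential as a radial solution\<close>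

locale wolff =
  fixes p :: real and n :: nat and \<zeta> :: ereal and g :: "real \<Rightarrow> real"
  assumes p: "1 < p" and n: "1 \<le> n" and zeta: "\<zeta> = 0 \<or> \<zeta> = \<infinity>"
    and g_pos: "\<And>s. 0 < s \<Longrightarrow> 0 < g s" and g_cont: "continuous_on {0<..} g"
    and inner_int: "\<And>t. ereal t \<in> {min \<zeta> 1<..<max \<zeta> 1} \<Longrightarrow>
       interval_lebesgue_integrable lborel (wolff_base p n \<zeta>) (ereal t) (wolff_inner p n g)"
    and outer_int: "interval_lebesgue_integrable lborel \<zeta> 1 (wolff_integrand p n \<zeta> g)"
begin

abbreviation lo :: ereal where "lo \<equiv> min \<zeta> 1"
abbreviation hi :: ereal where "hi \<equiv> max \<zeta> 1"
abbreviation I :: "real set" where "I \<equiv> einterval lo hi"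

lemma lo_hi: "\<zeta> = 0 \<and> lo = 0 \<and> hi = 1 \<or> \<zeta> = \<infinity> \<and> lo = 1 \<and> hi = \<infinity>"
  using zeta by (auto simp: min_def max_def)

lemma I_pos: "t \<in> I \<Longrightarrow> 0 < t"
proof -
  assume "t \<in> I"
  then have "0 < ereal t" using lo_hi by (auto simp: einterval_iff intro: less_trans[of 0 1])
  then show ?thesis by simp
qed

sublocale inner: endpoint_integral lo hi "wolff_base p n \<zeta>" "wolff_inner p n g"
proof
  show "wolff_base p n \<zeta> = lo \<or> wolff_base p n \<zeta> = hi"
    using lo_hi by (auto simp: wolff_base_def)
  have "continuous_on I g" using I_pos by (intro continuous_on_subset[OF g_cont]) auto
  then show "continuous_on I (wolff_inner p n g)"
    unfolding wolff_inner_def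
    by (intro continuous_intros) (auto dest: I_pos)
  show "0 < wolff_inner p n g t" if "t \<in> I" for t
    using I_pos[OF that] g_pos by (simp add: wolff_inner_def)
qed (use inner_int in \<open>auto simp: einterval_iff\<close>)

text \<open>The sign of the inner integral, which allows its absolute value to be replaced by a
  differentiable expression.\<close>

definition base_sign :: real where
  "base_sign = (if wolff_base p n \<zeta> = lo then 1 else - 1)"

lemma H_abs: "t \<in> I \<Longrightarrow> \<bar>inner.F t\<bar> = base_sign * inner.F t" "t \<in> I \<Longrightarrow> inner.F t \<noteq> 0"
  using inner.ends inner.F_pos[of t] inner.F_neg[of t] by (auto simp: base_sign_def)

lemma integrand_eq:
  "wolff_integrand p n \<zeta> g t = \<bar>t powr (1 - real n) * inner.F t\<bar> powr (1 / (p - 1))"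
  by (simp add: wolff_integrand_def inner.F_def)

lemma integrand_pos: "t \<in> I \<Longrightarrow> 0 < wolff_integrand p n \<zeta> g t"
  using H_abs(2)[of t] I_pos[of t] by (simp add: integrand_eq)

lemma integrand_cont: "continuous_on I (wolff_integrand p n \<zeta> g)"
proof -
  have "continuous_on I inner.F"
    by (rule DERIV_continuous_on) (use inner.F_deriv in \<open>auto intro: DERIV_subset\<close>)
  then show ?thesis
    unfolding integrand_eq using H_abs(2) p
    by (intro continuous_intros) (auto dest: I_pos)
qed

sublocale outer: endpoint_integral lo hi \<zeta> "wolff_integrand p n \<zeta> g"
proof
  show "\<zeta> = lo \<or> \<zeta> = hi" using lo_hi by auto
  show "interval_lebesgue_integrable lborel \<zeta> (ereal t) (wolff_integrand p n \<zeta> g)" if "t \<in> I" for t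
  proof (cases "\<zeta> = 0")
    case True
    then have t: "0 \<le> t" "ereal t \<le> 1" using that lo_hi I_pos[OF that] by (auto simp: einterval_iff)
    have "set_integrable lborel (einterval 0 1) (wolff_integrand p n \<zeta> g)"
      using outer_int True by (simp add: interval_lebesgue_integrable_def)
    then have "set_integrable lborel (einterval 0 t) (wolff_integrand p n \<zeta> g)"
      by (rule set_integrable_subset) (use t in \<open>auto simp: einterval_iff intro: less_le_trans\<close>)
    then show ?thesis using t True by (simp add: interval_lebesgue_integrable_def)
  next
    case False
    then have t: "1 \<le> ereal t" "\<zeta> = \<infinity>" using that lo_hi by (auto simp: einterval_iff)
    have "set_integrable lborel (einterval 1 \<infinity>) (wolff_integrand p n \<zeta> g)"
      using outer_int t by (simp add: interval_lebesgue_integrable_def)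
    then have "set_integrable lborel (einterval t \<infinity>) (wolff_integrand p n \<zeta> g)"
      by (rule set_integrable_subset) (use t in \<open>auto simp: einterval_iff intro: le_less_trans\<close>)
    then show ?thesis using t by (simp add: interval_lebesgue_integrable_def)
  qed
qed (rule integrand_cont, rule integrand_pos)

abbreviation W :: "real \<Rightarrow> real" where "W \<equiv> wolff_potential p n \<zeta> g"

text \<open>The sign of W': the potential grows away from \<zeta>, hence increases in r for \<zeta>
  = 0 and decreases for \<zeta> = \<infinity>.\<close>

definition zeta_sign :: real where
  "zeta_sign = (if \<zeta> = 0 then 1 else - 1)"

lemma zeta_sign_abs: "\<bar>zeta_sign\<bar> = 1"
  by (simp add: zeta_sign_def)

definition W' :: "real \<Rightarrow> real" where
  "W' t = zeta_sign * wolff_integrand p n \<zeta> g t"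

text \<open>The sign \<sigma> of the p-Laplacian of W.\<close>

definition laplace_sign :: real where
  "laplace_sign = (if wolff_base p n \<zeta> = \<zeta> then 1 else - 1)"

lemma laplace_sign_eq: "laplace_sign = zeta_sign * base_sign"
  using lo_hi by (auto simp: laplace_sign_def zeta_sign_def base_sign_def wolff_base_def)

lemma W_eq: "t \<in> I \<Longrightarrow> W t = zeta_sign * outer.F t"
  using lo_hi outer.F_pos[of t] outer.F_neg[of t]
  by (auto simp: wolff_potential_def outer.F_def zeta_sign_def)

lemma W_nonneg: "0 \<le> W t"
  by (simp add: wolff_potential_def)

lemma W_deriv:
  assumes "t \<in> I"
  shows "(W has_real_derivative W' t) (at t)"
proof -
  have "((\<lambda>t. zeta_sign * outer.F t) has_real_derivative W' t) (at t)"
    unfolding W'_def by (intro DERIV_cmult outer.F_deriv assms)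
  then show ?thesis
    by (rule has_field_derivative_transform_within_open[where S = I])
       (use assms W_eq in auto)
qed

lemma W'_cont: "continuous_on I W'"
  unfolding W'_def by (intro continuous_intros integrand_cont)

lemma W_small: "0 < e \<Longrightarrow> \<exists>c\<in>I. W c < e"
  using lo_hi outer.F_small_left[of e] outer.F_small_right[of 1 e]
  by (auto simp: W_eq zeta_sign_def)

text \<open>The radial form of the equation of W. The outer exponent 1/(p-1) is undone by the flux,
  and r^(n-1) cancels the weight r^(1-n); what remains is the inner integral with a sign, whose
  derivative is its integrand.\<close>

lemma W_flux_deriv:
  assumes t: "t \<in> I"
  shows "((\<lambda>r. flux p (W' r) * r ^ (n - 1)) has_real_derivative
    laplace_sign * (g t / t powr p) * t ^ (n - 1)) (at t)"
proof -
  have eq: "flux p (W' r) * r ^ (n - 1) = laplace_sign * inner.F r" if r: "r \<in> I" for r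
  proof -
    have r0: "0 < r" using I_pos[OF r] .
    have "flux p (W' r) = zeta_sign * wolff_integrand p n \<zeta> g r powr (p - 1)"
      using powr_minus_2_mult[of "wolff_integrand p n \<zeta> g r" p] integrand_pos[OF r]
        zeta_sign_abs
      by (simp add: flux_def W'_def abs_mult mult.left_commute)
    also have "wolff_integrand p n \<zeta> g r powr (p - 1) = \<bar>r powr (1 - real n) * inner.F r\<bar>"
      using p by (simp add: integrand_eq powr_powr)
    also have "\<dots> = r powr (1 - real n) * (base_sign * inner.F r)"
      using H_abs(1)[OF r] by (simp add: abs_mult)
    finally have "flux p (W' r) * r ^ (n - 1) =
        laplace_sign * inner.F r * (r powr (1 - real n) * r ^ (n - 1))"
      by (simp add: laplace_sign_eq ac_simps)
    also have "r powr (1 - real n) * r ^ (n - 1) = 1"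
      using r0 n by (simp add: powr_realpow[symmetric] powr_add[symmetric] of_nat_diff)
    finally show ?thesis by simp
  qed
  have "((\<lambda>r. laplace_sign * inner.F r) has_real_derivative laplace_sign * wolff_inner p n g t) (at t)"
    by (intro DERIV_cmult inner.F_deriv t)
  then have "((\<lambda>r. laplace_sign * inner.F r) has_real_derivative
      laplace_sign * (g t / t powr p) * t ^ (n - 1)) (at t)"
    by (simp add: wolff_inner_def mult.assoc)
  then show ?thesis
    by (rule has_field_derivative_transform_within_open[where S = I]) (use t eq in auto)
qed

end

section \<open>Functions on an interval that are convex relative to a profile\<close>

text \<open>The interpolant in the three-spheres inequality: the straight line through (W t1, N t1)
  and (W t2, N t2), evaluated at W t.\<close>

definition chord :: "(real \<Rightarrow> real) \<Rightarrow> (real \<Rightarrow> real) \<Rightarrow> real \<Rightarrow> real \<Rightarrow> real \<Rightarrow> real" where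
  "chord W N t1 t2 t = N t1 * ((W t2 - W t) / (W t2 - W t1)) + N t2 * ((W t - W t1) / (W t2 - W t1))"

text \<open>Puts the interpolant into the form A + B W required by the comparison, B being the slope
  of the chord.\<close>

lemma chord_affine:
  assumes "W t1 \<noteq> W t2"
  shows "chord W N t1 t2 t =
    (N t1 - (N t2 - N t1) / (W t2 - W t1) * W t1) + (N t2 - N t1) / (W t2 - W t1) * W t"
  using assms by (simp add: chord_def divide_simps) (simp add: algebra_simps)

lemma chord_between:
  assumes "W t1 < W t2" "W t1 \<le> W t" "W t \<le> W t2"
  shows "chord W N t1 t2 t \<le> max (N t1) (N t2)" "min (N t1) (N t2) \<le> chord W N t1 t2 t"
proof -
  define l where "l = (W t - W t1) / (W t2 - W t1)"
  have l: "0 \<le> l" "0 \<le> 1 - l" using assms by (auto simp: l_def divide_simps)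
  have "(W t2 - W t) / (W t2 - W t1) = 1 - l" using assms by (simp add: l_def field_simps)
  then have eq: "chord W N t1 t2 t = N t1 * (1 - l) + N t2 * l" by (simp add: chord_def l_def)
  have "N t1 * (1 - l) + N t2 * l \<le> max (N t1) (N t2) * (1 - l) + max (N t1) (N t2) * l"
    using l by (intro add_mono mult_right_mono) auto
  then show "chord W N t1 t2 t \<le> max (N t1) (N t2)" unfolding eq by (simp add: algebra_simps)
  have "min (N t1) (N t2) * (1 - l) + min (N t1) (N t2) * l \<le> N t1 * (1 - l) + N t2 * l"
    using l by (intro add_mono mult_right_mono) auto
  then show "min (N t1) (N t2) \<le> chord W N t1 t2 t" unfolding eq by (simp add: algebra_simps)
qed

text \<open>The differential equation is absent from here on: it enters the following lemmas only
  through their comparison hypotheses. The variable t tends to 0 at \<zeta> for both choices of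
  \<zeta>.\<close>

locale profile =
  fixes W N :: "real \<Rightarrow> real" and T :: real
  assumes T: "0 < T" and W_strict: "\<And>s t. 0 < s \<Longrightarrow> s < t \<Longrightarrow> t < T \<Longrightarrow> W s < W t"
    and N_pos: "\<And>t. 0 < t \<Longrightarrow> t < T \<Longrightarrow> 0 < N t"
begin

lemma W_mono: "0 < s \<Longrightarrow> s \<le> t \<Longrightarrow> t < T \<Longrightarrow> W s \<le> W t"
  using W_strict[of s t] by (cases "s = t") auto

lemma chord_le:
  "0 < t1 \<Longrightarrow> t1 < t2 \<Longrightarrow> t2 < T \<Longrightarrow> t \<in> {t1..t2} \<Longrightarrow> chord W N t1 t2 t \<le> max (N t1) (N t2)"
  by (intro chord_between W_strict W_mono) auto

lemma le_chord:
  "0 < t1 \<Longrightarrow> t1 < t2 \<Longrightarrow> t2 < T \<Longrightarrow> t \<in> {t1..t2} \<Longrightarrow> min (N t1) (N t2) \<le> chord W N t1 t2 t"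
  by (intro chord_between W_strict W_mono) auto

text \<open>The threshold R1 depends on t2, because N t1 has to be small or large relative to N t2
  before the comparison applies.\<close>

definition convex_near_0 :: bool where
  "convex_near_0 \<longleftrightarrow> (\<exists>R2>0. \<forall>t2. 0 < t2 \<and> t2 < R2 \<longrightarrow> (\<exists>R1. 0 < R1 \<and> R1 < t2 \<and>
     (\<forall>t1. 0 < t1 \<and> t1 < R1 \<longrightarrow> (\<forall>t3\<in>{t1<..<t2}. N t3 \<le> chord W N t1 t2 t3))))"

definition concave_near_0 :: bool where
  "concave_near_0 \<longleftrightarrow> (\<exists>R2>0. \<forall>t2. 0 < t2 \<and> t2 < R2 \<longrightarrow> (\<exists>R1. 0 < R1 \<and> R1 < t2 \<and>
     (\<forall>t1. 0 < t1 \<and> t1 < R1 \<longrightarrow> (\<forall>t3\<in>{t1<..<t2}. chord W N t1 t2 t3 \<le> N t3))))"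

definition monotone_near_0 :: bool where
  "monotone_near_0 \<longleftrightarrow> (\<exists>\<rho>>0. mono_on {0<..<\<rho>} N \<or> antimono_on {0<..<\<rho>} N)"

lemma supersolution_vanishing:
  assumes lim: "\<And>e. 0 < e \<Longrightarrow> \<exists>t0>0. \<forall>t. 0 < t \<and> t < t0 \<longrightarrow> N t < e"
    and cmp: "\<And>t1 t2 t. 0 < t1 \<Longrightarrow> t1 < t2 \<Longrightarrow> t2 < T \<Longrightarrow> N t1 < N t2 \<Longrightarrow>
      max (N t1) (N t2) \<le> 4 * \<bar>N t2 - N t1\<bar> \<Longrightarrow> t \<in> {t1..t2} \<Longrightarrow> chord W N t1 t2 t \<le> N t"
  shows "concave_near_0" "monotone_near_0"
proof -
  have key: "\<exists>R1. 0 < R1 \<and> R1 < t2 \<and> (\<forall>t1. 0 < t1 \<and> t1 < R1 \<longrightarrow>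
      N t1 < N t2 \<and> (\<forall>t\<in>{t1..t2}. chord W N t1 t2 t \<le> N t))" if t2: "0 < t2" "t2 < T" for t2
  proof -
    have N2: "0 < N t2" using N_pos t2 by blast
    \<comment> \<open>N t1 < N t2 / 2 gives N t2 < 2 (N t2 - N t1), which is more than the increment
      condition of \<open>cmp\<close> asks for.\<close>
    then obtain t0 where t0: "t0 > 0" "\<And>t. 0 < t \<Longrightarrow> t < t0 \<Longrightarrow> N t < N t2 / 2"
      using lim[of "N t2 / 2"] by auto
    show ?thesis
    proof (intro exI[of _ "min t0 (t2 / 2)"] conjI allI impI ballI)
      fix t1 assume t1: "0 < t1 \<and> t1 < min t0 (t2 / 2)"
      then have N1: "N t1 < N t2 / 2" using t0(2) by simp
      then show "N t1 < N t2" using N2 by linarith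
      fix t assume "t \<in> {t1..t2}"
      then show "chord W N t1 t2 t \<le> N t"
        using t1 N1 N2 t2 by (intro cmp) (auto simp: abs_if)
    qed (use t0 t2 in auto)
  qed
  show "concave_near_0"
    unfolding concave_near_0_def
  proof (rule exI[of _ T], intro conjI allI impI)
    fix t2 assume "0 < t2 \<and> t2 < T"
    then show "\<exists>R1. 0 < R1 \<and> R1 < t2 \<and>
     (\<forall>t1. 0 < t1 \<and> t1 < R1 \<longrightarrow> (\<forall>t3\<in>{t1<..<t2}. chord W N t1 t2 t3 \<le> N t3))"
      using key[of t2] by fastforce
  qed (rule T)
  \<comment> \<open>With the right end point fixed at T / 2, the value N s is the smaller end value
    for every s < R1, so it bounds the chord from below and hence N on the rest of the
    interval.\<close>
  obtain R1 where R1: "0 < R1" "R1 < T / 2" "\<And>t1. 0 < t1 \<Longrightarrow> t1 < R1 \<Longrightarrow>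
      N t1 < N (T / 2) \<and> (\<forall>t\<in>{t1..T / 2}. chord W N t1 (T / 2) t \<le> N t)"
    using key[of "T / 2"] T by auto
  have "N s \<le> N t" if "0 < s" "s \<le> t" "t < R1" for s t
  proof -
    have "N s = min (N s) (N (T / 2))" using R1(3)[of s] that by simp
    also have "\<dots> \<le> chord W N s (T / 2) t" using that R1 T by (intro le_chord) auto
    also have "\<dots> \<le> N t" using R1(2) R1(3)[of s] that by auto
    finally show ?thesis .
  qed
  then have "mono_on {0<..<R1} N" by (intro mono_onI) auto
  then show "monotone_near_0" unfolding monotone_near_0_def using R1(1) by blast
qed

text \<open>Blow-up makes the left end value larger than 4 N t2, so the increment condition holds
  with roles of the end points exchanged.\<close>

lemma supersolution_unbounded:
  assumes lim: "\<And>K. \<exists>t0>0. \<forall>t. 0 < t \<and> t < t0 \<longrightarrow> K < N t"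
    and cmp: "\<And>t1 t2 t. 0 < t1 \<Longrightarrow> t1 < t2 \<Longrightarrow> t2 < T \<Longrightarrow> N t2 < N t1 \<Longrightarrow>
      max (N t1) (N t2) \<le> 4 * \<bar>N t2 - N t1\<bar> \<Longrightarrow> t \<in> {t1..t2} \<Longrightarrow> chord W N t1 t2 t \<le> N t"
  shows "concave_near_0" "monotone_near_0"
proof -
  have key: "\<exists>R1. 0 < R1 \<and> R1 < t2 \<and> (\<forall>t1. 0 < t1 \<and> t1 < R1 \<longrightarrow>
      N t2 < N t1 \<and> (\<forall>t\<in>{t1..t2}. chord W N t1 t2 t \<le> N t))" if t2: "0 < t2" "t2 < T" for t2
  proof -
    have N2: "0 < N t2" using N_pos t2 by blast
    obtain t0 where t0: "t0 > 0" "\<And>t. 0 < t \<Longrightarrow> t < t0 \<Longrightarrow> 4 * N t2 < N t"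
      using lim[of "4 * N t2"] by auto
    show ?thesis
    proof (intro exI[of _ "min t0 (t2 / 2)"] conjI allI impI ballI)
      fix t1 assume t1: "0 < t1 \<and> t1 < min t0 (t2 / 2)"
      then have N1: "4 * N t2 < N t1" using t0(2) by simp
      then show "N t2 < N t1" using N2 by linarith
      fix t assume "t \<in> {t1..t2}"
      then show "chord W N t1 t2 t \<le> N t"
        using t1 N1 N2 t2 by (intro cmp) (auto simp: abs_if)
    qed (use t0 t2 in auto)
  qed
  show "concave_near_0"
    unfolding concave_near_0_def
  proof (rule exI[of _ T], intro conjI allI impI)
    fix t2 assume "0 < t2 \<and> t2 < T"
    then show "\<exists>R1. 0 < R1 \<and> R1 < t2 \<and>
     (\<forall>t1. 0 < t1 \<and> t1 < R1 \<longrightarrow> (\<forall>t3\<in>{t1<..<t2}. chord W N t1 t2 t3 \<le> N t3))"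
      using key[of t2] by fastforce
  qed (rule T)
  have "N t \<le> N s" if "0 < s" "s \<le> t" "t < T" for s t
  proof (cases "s = t")
    case False
    obtain R1 where R1: "0 < R1" "R1 < t" "\<And>t1. 0 < t1 \<Longrightarrow> t1 < R1 \<Longrightarrow>
        N t < N t1 \<and> (\<forall>r\<in>{t1..t}. chord W N t1 t r \<le> N r)"
      using key[of t] \<open>0 < s\<close> \<open>s \<le> t\<close> \<open>t < T\<close> by auto
    \<comment> \<open>An auxiliary left end point with N r > N t: on [r, t] the smaller end value is
      N t, so the chord at s is at least N t. As r may be arbitrarily close to 0, monotonicity is
      obtained on all of (0, T).\<close>
    define r where "r = min R1 s / 2"
    have r: "0 < r" "r < R1" "r < s" using R1 that by (auto simp: r_def)
    have "N t = min (N r) (N t)" using R1(3)[of r] r by simp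
    also have "\<dots> \<le> chord W N r t s" using that r by (intro le_chord) auto
    also have "\<dots> \<le> N s" using R1(3)[of r] r that by auto
    finally show ?thesis .
  qed simp
  then have "antimono_on {0<..<T} N" by (intro monotone_onI) auto
  then show "monotone_near_0" unfolding monotone_near_0_def using T by blast
qed

text \<open>The comparison hypothesis for subsolutions bounds \<open>N\<close> on the whole interval by the increment of
  \<open>N\<close>. If an interior maximum exceeded both end values, the intermediate value theorem would
  provide a new end point with at least half of the maximal value, to which the hypothesis applies.\<close>

lemma subsolution_vanishing:
  assumes cont: "continuous_on {0<..<T} N"
    and lim: "\<And>e. 0 < e \<Longrightarrow> \<exists>t0>0. \<forall>t. 0 < t \<and> t < t0 \<longrightarrow> N t < e"
    and cmp: "\<And>t1 t2 t. 0 < t1 \<Longrightarrow> t1 < t2 \<Longrightarrow> t2 < T \<Longrightarrow> N t1 < N t2 \<Longrightarrow>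
      (\<And>t. t \<in> {t1..t2} \<Longrightarrow> N t \<le> 4 * \<bar>N t2 - N t1\<bar>) \<Longrightarrow> t \<in> {t1..t2} \<Longrightarrow> N t \<le> chord W N t1 t2 t"
  shows "convex_near_0" "monotone_near_0"
proof -
  have mono: "N s \<le> N t2" if s: "0 < s" "s \<le> t2" "t2 < T" for s t2
  proof (rule ccontr)
    assume "\<not> N s \<le> N t2"
    then have less: "N t2 < N s" by simp
    have N2: "0 < N t2" using N_pos s by simp
    obtain t0' where t0': "t0' > 0" "\<And>t. 0 < t \<Longrightarrow> t < t0' \<Longrightarrow> N t < N t2 / 2"
      using lim[of "N t2 / 2"] N2 by auto
    define t0 where "t0 = min t0' s / 2"
    have t0: "0 < t0" "t0 < s" "N t0 < N t2 / 2" using t0' s by (auto simp: t0_def)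
    have "continuous_on {t0..t2} N" using t0 s by (intro continuous_on_subset[OF cont]) auto
    then obtain tm where tm: "tm \<in> {t0..t2}" "\<And>t. t \<in> {t0..t2} \<Longrightarrow> N t \<le> N tm"
      using continuous_attains_sup[of "{t0..t2}" N] t0 s by auto
    have Nm: "N t2 < N tm" using tm(2)[of s] t0 s less by simp
    \<comment> \<open>The level for the new end point: it lies between N t2 and N tm, hence is
      attained. Since N t0 < N t2 / 2 \<le> y / 2, the increment exceeds y / 2 \<ge> N tm / 4, which
      is what the factor 4 in \<open>cmp\<close> is made for.\<close>
    define y where "y = max (N t2) (N tm / 2)"
    have y: "N t2 \<le> y" "N tm / 2 \<le> y" "y < N tm" using Nm N2 by (auto simp: y_def)
    have "continuous_on {tm..t2} N" using tm(1) t0 s by (intro continuous_on_subset[OF cont]) auto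
    then obtain t where t: "tm \<le> t" "t \<le> t2" "N t = y"
      using IVT2'[of N t2 y tm] y tm(1) by auto
    have "t0 < tm" using tm(1) t0(3) Nm N2 by (cases "tm = t0") auto
    moreover have "tm \<noteq> t" using t y by auto
    ultimately have ord: "t0 < tm" "tm < t" using t(1) by auto
    have "N tm \<le> chord W N t0 t tm"
    proof (rule cmp)
      show "N t0 < N t" using t0(3) y t(3) N2 by linarith
      show "N r \<le> 4 * \<bar>N t - N t0\<bar>" if "r \<in> {t0..t}" for r
        using tm(2)[of r] that t(2) t(3) t0(3) y by auto
    qed (use ord t0 t s in auto)
    also have "\<dots> \<le> max (N t0) (N t)" using ord t0 t s by (intro chord_le) auto
    also have "\<dots> = y" using t0(3) y t(3) N2 by auto
    finally show False using y by simp
  qed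
  then have "mono_on {0<..<T} N" by (intro mono_onI) auto
  then show "monotone_near_0" unfolding monotone_near_0_def using T by blast
  show "convex_near_0"
    unfolding convex_near_0_def
  proof (rule exI[of _ T], intro conjI allI impI)
    fix t2 assume t2: "0 < t2 \<and> t2 < T"
    have N2: "0 < N t2" using N_pos t2 by blast
    then obtain t0 where t0: "t0 > 0" "\<And>t. 0 < t \<Longrightarrow> t < t0 \<Longrightarrow> N t < N t2 / 2"
      using lim[of "N t2 / 2"] by auto
    show "\<exists>R1. 0 < R1 \<and> R1 < t2 \<and>
     (\<forall>t1. 0 < t1 \<and> t1 < R1 \<longrightarrow> (\<forall>t3\<in>{t1<..<t2}. N t3 \<le> chord W N t1 t2 t3))"
    proof (intro exI[of _ "min t0 (t2 / 2)"] conjI allI impI ballI)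
      fix t1 t3 assume t1: "0 < t1 \<and> t1 < min t0 (t2 / 2)" and t3: "t3 \<in> {t1<..<t2}"
      then have N1: "N t1 < N t2 / 2" using t0(2) by simp
      show "N t3 \<le> chord W N t1 t2 t3"
      proof (rule cmp)
        show "N t1 < N t2" using N1 N2 by linarith
        \<comment> \<open>By the monotonicity just shown the maximum over the interval is N t2, and
          N t2 < 2 (N t2 - N t1).\<close>
        show "N t \<le> 4 * \<bar>N t2 - N t1\<bar>" if "t \<in> {t1..t2}" for t
          using mono[of t t2] that t1 t2 N1 N2 by auto
      qed (use t1 t2 t3 in auto)
    qed (use t0 t2 in auto)
  qed (rule T)
qed

text \<open>The mirror image of the vanishing case: large values now sit at the left end, so the new
  end point is sought to the left of an interior maximum. The outcome, that N is largest at t1 on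
  [t1, t2], serves both convexity and monotonicity.\<close>

lemma subsolution_unbounded:
  assumes cont: "continuous_on {0<..<T} N"
    and lim: "\<And>K. \<exists>t0>0. \<forall>t. 0 < t \<and> t < t0 \<longrightarrow> K < N t"
    and cmp: "\<And>t1 t2 t. 0 < t1 \<Longrightarrow> t1 < t2 \<Longrightarrow> t2 < T \<Longrightarrow> N t2 < N t1 \<Longrightarrow>
      (\<And>t. t \<in> {t1..t2} \<Longrightarrow> N t \<le> 4 * \<bar>N t2 - N t1\<bar>) \<Longrightarrow> t \<in> {t1..t2} \<Longrightarrow> N t \<le> chord W N t1 t2 t"
  shows "convex_near_0" "monotone_near_0"
proof -
  have key: "\<exists>R1. 0 < R1 \<and> R1 < t2 \<and> (\<forall>t1. 0 < t1 \<and> t1 < R1 \<longrightarrow>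
      4 * N t2 < N t1 \<and> (\<forall>t\<in>{t1..t2}. N t \<le> N t1))" if t2: "0 < t2" "t2 < T" for t2
  proof -
    have N2: "0 < N t2" using N_pos t2 by blast
    obtain t0 where t0: "t0 > 0" "\<And>t. 0 < t \<Longrightarrow> t < t0 \<Longrightarrow> 4 * N t2 < N t"
      using lim[of "4 * N t2"] by auto
    show ?thesis
    proof (intro exI[of _ "min t0 (t2 / 2)"] conjI allI impI ballI)
      fix t1 assume t1: "0 < t1 \<and> t1 < min t0 (t2 / 2)"
      then show N1: "4 * N t2 < N t1" using t0(2) by simp
      fix s assume s: "s \<in> {t1..t2}"
      show "N s \<le> N t1"
      proof (rule ccontr)
        assume "\<not> N s \<le> N t1"
        then have less: "N t1 < N s" by simp
        have "continuous_on {t1..t2} N" using t1 t2 by (intro continuous_on_subset[OF cont]) auto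
        then obtain tm where tm: "tm \<in> {t1..t2}" "\<And>t. t \<in> {t1..t2} \<Longrightarrow> N t \<le> N tm"
          using continuous_attains_sup[of "{t1..t2}" N] t1 by auto
        have Nm: "N t1 < N tm" using tm(2)[OF s] less by simp
        \<comment> \<open>Here N t2 < N t1 / 4 \<le> y / 4, so the increment exceeds 3 y / 4 and
          four times it exceeds N tm.\<close>
        define y where "y = max (N t1) (N tm / 2)"
        have y: "N t1 \<le> y" "N tm / 2 \<le> y" "y < N tm" using Nm N1 N2 by (auto simp: y_def)
        have "continuous_on {t1..tm} N" using tm(1) t1 t2 by (intro continuous_on_subset[OF cont]) auto
        then obtain t where t: "t1 \<le> t" "t \<le> tm" "N t = y"
          using IVT'[of N t1 y tm] y tm(1) by auto
        have "tm < t2" using tm(1) Nm N1 N2 by (cases "tm = t2") auto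
        moreover have "tm \<noteq> t" using t y by auto
        ultimately have ord: "t < tm" "tm < t2" using t(2) by auto
        have "N tm \<le> chord W N t t2 tm"
        proof (rule cmp)
          show "N t2 < N t" using N1 N2 y t(3) by linarith
          show "N r \<le> 4 * \<bar>N t2 - N t\<bar>" if "r \<in> {t..t2}" for r
            using tm(2)[of r] that t(1) t(3) N1 y by auto
        qed (use ord t t1 t2 in auto)
        also have "\<dots> \<le> max (N t) (N t2)" using ord t t1 t2 by (intro chord_le) auto
        also have "\<dots> = y" using N1 N2 y t(3) by auto
        finally show False using y by simp
      qed
    qed (use t0 t2 in auto)
  qed
  show "convex_near_0"
    unfolding convex_near_0_def
  proof (rule exI[of _ T], intro conjI allI impI)
    fix t2 assume t2: "0 < t2 \<and> t2 < T"
    then obtain R1 where R1: "0 < R1" "R1 < t2" "\<And>t1. 0 < t1 \<Longrightarrow> t1 < R1 \<Longrightarrow>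
        4 * N t2 < N t1 \<and> (\<forall>t\<in>{t1..t2}. N t \<le> N t1)"
      using key[of t2] by blast
    have N2: "0 < N t2" using N_pos t2 by blast
    show "\<exists>R1. 0 < R1 \<and> R1 < t2 \<and>
     (\<forall>t1. 0 < t1 \<and> t1 < R1 \<longrightarrow> (\<forall>t3\<in>{t1<..<t2}. N t3 \<le> chord W N t1 t2 t3))"
    proof (intro exI[of _ R1] conjI allI impI ballI)
      fix t1 t3 assume t1: "0 < t1 \<and> t1 < R1" and t3: "t3 \<in> {t1<..<t2}"
      then have N1: "4 * N t2 < N t1" "\<And>t. t \<in> {t1..t2} \<Longrightarrow> N t \<le> N t1" using R1(3) by blast+
      show "N t3 \<le> chord W N t1 t2 t3"
      proof (rule cmp)
        show "N t2 < N t1" using N1 N2 by linarith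
        show "N t \<le> 4 * \<bar>N t2 - N t1\<bar>" if "t \<in> {t1..t2}" for t
          using N1(2)[OF that] N1(1) N2 by auto
      qed (use t1 t2 t3 R1 in auto)
    qed (use R1 in auto)
  qed (rule T)
  \<comment> \<open>For s < R1 the value N s is the maximum of N over [s, T / 2], which immediately
    gives monotonicity on (0, R1).\<close>
  obtain R1 where R1: "0 < R1" "R1 < T / 2" "\<And>t1. 0 < t1 \<Longrightarrow> t1 < R1 \<Longrightarrow>
      4 * N (T / 2) < N t1 \<and> (\<forall>t\<in>{t1..T / 2}. N t \<le> N t1)"
    using key[of "T / 2"] T by auto
  have "N t \<le> N s" if "0 < s" "s \<le> t" "t < R1" for s t
    using R1(2) R1(3)[of s] that by auto
  then have "antimono_on {0<..<R1} N" by (intro monotone_onI) auto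
  then show "monotone_near_0" unfolding monotone_near_0_def using R1(1) by blast
qed

end

section \<open>The three-spheres inequality\<close>

text \<open>The parameter \<open>t\<close> tends to \<open>0\<close> as the radius tends to \<open>\<zeta>\<close>.\<close>

definition radius :: "ereal \<Rightarrow> real \<Rightarrow> real" where
  "radius \<zeta> t = (if \<zeta> = 0 then t else 1 / t)"

lemma radius_radius: "radius \<zeta> (radius \<zeta> t) = t"
  by (simp add: radius_def)

lemma radius_pos: "0 < t \<Longrightarrow> 0 < radius \<zeta> t"
  by (simp add: radius_def)

lemma radius_between:
  assumes "0 < t1" "t1 \<le> t2" "min (radius \<zeta> t1) (radius \<zeta> t2) \<le> r" "r \<le> max (radius \<zeta> t1) (radius \<zeta> t2)"
  shows "radius \<zeta> r \<in> {t1..t2}"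
proof (cases "\<zeta> = 0")
  case False
  have "1 / t2 \<le> 1 / t1" using assms by (intro divide_left_mono) auto
  then have r: "1 / t2 \<le> r" "r \<le> 1 / t1" using assms False by (auto simp: radius_def)
  moreover have "0 < 1 / t2" using assms by simp
  ultimately have "0 < r" by linarith
  then show ?thesis using r assms False by (auto simp: radius_def field_simps)
qed (use assms in \<open>auto simp: radius_def\<close>)

section \<open>Transport from t near 0 to radii near \<infinity>\<close>

lemma near_infinity:
  assumes "\<exists>R2>0. \<forall>t2. 0 < t2 \<and> t2 < R2 \<longrightarrow> (\<exists>R1. 0 < R1 \<and> R1 < t2 \<and>
     (\<forall>t1. 0 < t1 \<and> t1 < R1 \<longrightarrow> (\<forall>t3\<in>{t1<..<t2}. P t1 t2 (t3::real))))"
  shows "\<exists>R2>0. \<forall>r2. r2 > R2 \<longrightarrow> (\<exists>R1. R1 > r2 \<and>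
     (\<forall>r1. r1 > R1 \<longrightarrow> (\<forall>r3\<in>{r2<..<r1}. P (1 / r1) (1 / r2) (1 / r3))))"
proof -
  obtain R2 where R2: "R2 > 0" and H: "\<And>t2. 0 < t2 \<Longrightarrow> t2 < R2 \<Longrightarrow> \<exists>R1. 0 < R1 \<and> R1 < t2 \<and>
     (\<forall>t1. 0 < t1 \<and> t1 < R1 \<longrightarrow> (\<forall>t3\<in>{t1<..<t2}. P t1 t2 t3))"
    using assms by blast
  show ?thesis
  proof (rule exI[of _ "1 / R2"], intro conjI allI impI)
    show "0 < 1 / R2" using R2 by simp
    fix r2 assume r2: "1 / R2 < r2"
    then have r2_pos: "0 < r2" using R2 by (meson less_trans zero_less_divide_1_iff)
    have "1 / r2 < R2" using r2 r2_pos R2 by (simp add: field_simps)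
    then obtain R1 where R1: "0 < R1" "R1 < 1 / r2"
        "\<And>t1 t3. 0 < t1 \<Longrightarrow> t1 < R1 \<Longrightarrow> t3 \<in> {t1<..<1 / r2} \<Longrightarrow> P t1 (1 / r2) t3"
      using H[of "1 / r2"] r2_pos by auto
    show "\<exists>R1. R1 > r2 \<and> (\<forall>r1. r1 > R1 \<longrightarrow> (\<forall>r3\<in>{r2<..<r1}. P (1 / r1) (1 / r2) (1 / r3)))"
    proof (rule exI[of _ "1 / R1"], intro conjI allI impI ballI)
      show "r2 < 1 / R1" using R1 r2_pos by (simp add: field_simps)
      fix r1 r3 assume r1: "1 / R1 < r1" and r3: "r3 \<in> {r2<..<r1}"
      have r1_pos: "0 < r1" using r1 R1(1) by (meson less_trans zero_less_divide_1_iff)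
      have "1 / r1 < R1" using r1 r1_pos R1(1) by (simp add: field_simps)
      moreover have "1 / r1 < 1 / r3" "1 / r3 < 1 / r2"
        using r3 r2_pos by (auto intro!: divide_strict_left_mono)
      ultimately show "P (1 / r1) (1 / r2) (1 / r3)" using r1_pos by (intro R1(3)) auto
    qed
  qed
qed

text \<open>Inversion reverses the order, so the two alternatives change places.\<close>

lemma monotone_near_infinity:
  fixes M :: "real \<Rightarrow> real"
  assumes "\<exists>\<rho>>0. mono_on {0<..<\<rho>} (\<lambda>t. M (1 / t)) \<or> antimono_on {0<..<\<rho>} (\<lambda>t. M (1 / t))"
  shows "\<exists>\<rho>>0. mono_on {\<rho><..} M \<or> antimono_on {\<rho><..} M"
proof -
  obtain \<rho> where \<rho>: "\<rho> > 0" "mono_on {0<..<\<rho>} (\<lambda>t. M (1 / t)) \<or> antimono_on {0<..<\<rho>} (\<lambda>t. M (1 / t))"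
    using assms by blast
  have inv: "1 / s \<in> {0<..<\<rho>}" "1 / t \<in> {0<..<\<rho>}" "1 / t \<le> 1 / s"
    if "1 / \<rho> < s" "s \<le> t" for s t
  proof -
    have "0 < s" using that \<rho>(1) by (meson less_trans zero_less_divide_1_iff)
    moreover have "1 / s < \<rho>" using that \<open>0 < s\<close> \<rho>(1) by (simp add: field_simps)
    moreover have "1 / t \<le> 1 / s" using \<open>0 < s\<close> that by (intro divide_left_mono) auto
    ultimately show "1 / s \<in> {0<..<\<rho>}" "1 / t \<in> {0<..<\<rho>}" "1 / t \<le> 1 / s" using that by auto
  qed
  show ?thesis
    using \<rho>(2)
  proof
    assume m: "mono_on {0<..<\<rho>} (\<lambda>t. M (1 / t))"
    have "antimono_on {1 / \<rho><..} M"
    proof (rule monotone_onI)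
      fix s t assume "s \<in> {1 / \<rho><..}" "t \<in> {1 / \<rho><..}" "s \<le> t"
      then show "M t \<le> M s" using mono_onD[OF m inv(2) inv(1) inv(3), of s t] by simp
    qed
    then show ?thesis using \<rho>(1) by (intro exI[of _ "1 / \<rho>"]) auto
  next
    assume m: "antimono_on {0<..<\<rho>} (\<lambda>t. M (1 / t))"
    have "mono_on {1 / \<rho><..} M"
    proof (rule mono_onI)
      fix s t assume "s \<in> {1 / \<rho><..}" "t \<in> {1 / \<rho><..}" "s \<le> t"
      then show "M s \<le> M t" using monotone_onD[OF m inv(2) inv(1) inv(3), of s t] by simp
    qed
    then show ?thesis using \<rho>(1) by (intro exI[of _ "1 / \<rho>"]) auto
  qed
qed

lemma eventually_near_0:
  assumes "eventually P (at (0 :: 'a::euclidean_space))"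
  shows "\<exists>t0>0. \<forall>t. 0 < t \<and> t < t0 \<longrightarrow> (\<forall>x. norm x = t \<longrightarrow> P x)"
proof -
  obtain d where "d > 0" "\<And>x. x \<noteq> 0 \<Longrightarrow> dist x 0 < d \<Longrightarrow> P x"
    using assms unfolding eventually_at by auto
  then show ?thesis by (intro exI[of _ d]) auto
qed

lemma eventually_near_infinity:
  assumes "eventually P (at_infinity :: 'a::euclidean_space filter)"
  shows "\<exists>t0>0. \<forall>t. 0 < t \<and> t < t0 \<longrightarrow> (\<forall>x. norm x = 1 / t \<longrightarrow> P x)"
proof -
  obtain b where b: "\<And>x. b \<le> norm x \<Longrightarrow> P x"
    using assms unfolding eventually_at_infinity by auto
  define m where "m = max b 1"
  have m: "b \<le> m" "0 < m" by (auto simp: m_def)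
  show ?thesis
  proof (intro exI[of _ "1 / m"] conjI allI impI)
    fix t and x :: 'a assume t: "0 < t \<and> t < 1 / m" and x: "norm x = 1 / t"
    then have "m < 1 / t" using m by (simp add: field_simps)
    then show "P x" using x m by (intro b) simp
  qed (use m in simp)
qed

text \<open>N is the extremum of u over spheres as a function of t: the maximum for \<epsilon> = 1,
  the minimum for \<epsilon> = - 1. T marks a range in which all local hypotheses hold at once;
  \<open>W_quarter\<close> is the smallness that produces the factor 4.\<close>

locale radial_comparison = weak_inequality p \<epsilon> V u D + wo: wolff p n \<zeta> g
  for p \<epsilon> V and u :: "'a::euclidean_space \<Rightarrow> real" and D n \<zeta> g +
  fixes T :: real and N :: "real \<Rightarrow> real"
  assumes n_eq: "n = DIM('a)" and T_pos: "0 < T" and \<epsilon>_abs: "\<bar>\<epsilon>\<bar> = 1"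
    and rad_I: "\<And>t. 0 < t \<Longrightarrow> t < T \<Longrightarrow> radius \<zeta> t \<in> wo.I"
    and rad_D: "\<And>t x. 0 < t \<Longrightarrow> t < T \<Longrightarrow> norm x = radius \<zeta> t \<Longrightarrow> x \<in> D"
    and V_le: "AE x in lebesgue. (\<exists>t. 0 < t \<and> t < T \<and> norm x = radius \<zeta> t) \<longrightarrow>
        \<bar>V x\<bar> \<le> g (norm x) / norm x powr p"
    and W_quarter: "\<And>t. 0 < t \<Longrightarrow> t < T \<Longrightarrow> wo.W (radius \<zeta> t) \<le> 1 / 4"
    and N_extremal: "\<And>t x. 0 < t \<Longrightarrow> t < T \<Longrightarrow> norm x = radius \<zeta> t \<Longrightarrow> \<epsilon> * (u x - N t) \<le> 0"
    and N_attained: "\<And>t. 0 < t \<Longrightarrow> t < T \<Longrightarrow> \<exists>x. norm x = radius \<zeta> t \<and> u x = N t"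
begin

abbreviation Wt :: "real \<Rightarrow> real" where "Wt t \<equiv> wo.W (radius \<zeta> t)"

text \<open>For \<zeta> = \<infinity> the potential decreases in r and r decreases in t, so in
  either case it increases in t.\<close>

sublocale profile Wt N T
proof
  fix s t :: real assume st: "0 < s" "s < t" "t < T"
  then have I: "radius \<zeta> s \<in> wo.I" "radius \<zeta> t \<in> wo.I" by (auto intro: rad_I)
  show "Wt s < Wt t"
  proof (cases "\<zeta> = 0")
    case True
    have r: "radius \<zeta> s < radius \<zeta> t" using st True by (simp add: radius_def)
    have z: "wo.zeta_sign = 1" unfolding wo.zeta_sign_def using True by simp
    show ?thesis by (simp add: wo.W_eq[OF I(1)] wo.W_eq[OF I(2)] z wo.outer.F_strict[OF I r])
  next
    case False
    have "1 / t < 1 / s" using st by (intro divide_strict_left_mono) auto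
    then have r: "radius \<zeta> t < radius \<zeta> s" using False by (simp add: radius_def)
    have z: "wo.zeta_sign = - 1" unfolding wo.zeta_sign_def using False by simp
    show ?thesis by (simp add: wo.W_eq[OF I(1)] wo.W_eq[OF I(2)] z wo.outer.F_strict[OF I(2) I(1) r])
  qed
next
  fix t assume "0 < t" "t < T"
  then show "0 < N t" using N_attained rad_D u_pos by metis
qed (rule T_pos)

text \<open>Translates the comparison on an annulus into a statement about N: the chord supplies A
  and B, and extremality of N supplies the boundary inequalities.\<close>

lemma chord_comparison:
  assumes t12: "0 < t1" "t1 < t2" "t2 < T"
    and sign: "wo.laplace_sign * sgn (N t2 - N t1) = - \<epsilon>"
    and small: "\<And>t x. t \<in> {t1..t2} \<Longrightarrow> norm x = radius \<zeta> t \<Longrightarrow>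
      0 < \<epsilon> * (u x - chord Wt N t1 t2 t) \<Longrightarrow> u x \<le> 4 * \<bar>N t2 - N t1\<bar>"
    and t: "t \<in> {t1..t2}"
  shows "\<epsilon> * (N t - chord Wt N t1 t2 t) \<le> 0"
proof -
  define a b where "a = min (radius \<zeta> t1) (radius \<zeta> t2)" and "b = max (radius \<zeta> t1) (radius \<zeta> t2)"
  define B where "B = (N t2 - N t1) / (Wt t2 - Wt t1)"
  define A where "A = N t1 - B * Wt t1"
  have dW: "0 < Wt t2 - Wt t1" using W_strict[of t1 t2] t12 by simp
  have chord: "chord Wt N t1 t2 s = A + B * Wt s" for s
    using chord_affine[of Wt t1 t2 N s] dW by (simp add: A_def B_def)
  have r_t: "radius \<zeta> r \<in> {t1..t2}" if "a \<le> r" "r \<le> b" for r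
    using radius_between[of t1 t2 \<zeta> r] that t12 by (simp add: a_def b_def)
  have t_r: "a \<le> radius \<zeta> s \<and> radius \<zeta> s \<le> b" if "s \<in> {t1..t2}" for s
  proof -
    have "1 / t2 \<le> 1 / s" "1 / s \<le> 1 / t1" using that t12 by (auto intro!: divide_left_mono)
    then show ?thesis using that by (auto simp: a_def b_def radius_def min_def max_def)
  qed
  have a_pos: "0 < a" using t12 by (simp add: a_def radius_pos)
  have rI: "r \<in> wo.I" if "a \<le> r" "r \<le> b" for r
    using rad_I[of "radius \<zeta> r"] r_t[OF that] t12 by (simp add: radius_radius)
  then have sub: "{a..b} \<subseteq> wo.I" by auto
  \<comment> \<open>W is nonnegative and at most 1/4 on the range, so the slope divides the
    increment of N by a number in (0, 1/4].\<close>
  have B4: "4 * \<bar>N t2 - N t1\<bar> \<le> \<bar>B\<bar>"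
  proof -
    have "Wt t2 - Wt t1 \<le> 1 / 4" using W_quarter[of t2] wo.W_nonneg[of "radius \<zeta> t1"] t12 by simp
    then have "4 * \<bar>N t2 - N t1\<bar> * (Wt t2 - Wt t1) \<le> 4 * \<bar>N t2 - N t1\<bar> * (1 / 4)"
      by (intro mult_left_mono) auto
    then show ?thesis using dW by (simp add: B_def abs_divide field_simps)
  qed
  have sgnB: "sgn B = sgn (N t2 - N t1)" using dW by (simp add: B_def sgn_divide)
  have comp: "\<epsilon> * (u x - (A + B * wo.W (norm x))) \<le> 0" if x: "a \<le> norm x" "norm x \<le> b" for x
  proof (rule comparison[where a = a and b = b and W = wo.W and W' = wo.W' and \<sigma> = wo.laplace_sign
        and G = "\<lambda>r. g r / r powr p"])
    show "x \<in> D" if "a \<le> norm x" "norm x \<le> b" for x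
      using rad_D[of "radius \<zeta> (norm x)" x] r_t[OF that] t12 by (simp add: radius_radius)
    show "continuous_on {a..b} wo.W'" using wo.W'_cont sub by (rule continuous_on_subset)
    show "continuous_on {a..b} (\<lambda>r. g r / r powr p)"
      using a_pos by (intro continuous_intros continuous_on_subset[OF wo.g_cont]) auto
    show "0 \<le> g r / r powr p" if "a \<le> r" for r
      using wo.g_pos[of r] that a_pos by simp
    show "AE x in lebesgue. a \<le> norm x \<and> norm x \<le> b \<longrightarrow> \<bar>V x\<bar> \<le> g (norm x) / norm x powr p"
      using V_le
    proof eventually_elim
      case (elim x)
      show ?case
      proof
        assume x: "a \<le> norm x \<and> norm x \<le> b"
        then have "radius \<zeta> (norm x) \<in> {t1..t2}" by (intro r_t) auto
        then have "\<exists>t. 0 < t \<and> t < T \<and> norm x = radius \<zeta> t"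
          using t12 by (intro exI[of _ "radius \<zeta> (norm x)"]) (auto simp: radius_radius)
        then show "\<bar>V x\<bar> \<le> g (norm x) / norm x powr p" using elim by blast
      qed
    qed
    show "wo.laplace_sign * sgn B = - \<epsilon>" using sign sgnB by simp
    show "\<epsilon> * (u x - (A + B * wo.W (norm x))) \<le> 0" if "norm x = a \<or> norm x = b" for x
    proof -
      have "norm x = radius \<zeta> t1 \<or> norm x = radius \<zeta> t2"
        using that by (auto simp: a_def b_def min_def max_def split: if_splits)
      moreover have "A + B * Wt t1 = N t1" by (simp add: A_def)
      moreover have "A + B * Wt t2 = N t2"
      proof -
        have "B * (Wt t2 - Wt t1) = N t2 - N t1" using dW by (simp add: B_def)
        then show ?thesis by (simp add: A_def algebra_simps)
      qed
      ultimately show ?thesis using N_extremal[of t1 x] N_extremal[of t2 x] t12 by auto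
    qed
    show "u x \<le> \<bar>B\<bar>"
      if x: "a \<le> norm x" "norm x \<le> b" and pos: "0 < \<epsilon> * (u x - (A + B * wo.W (norm x)))" for x
    proof -
      have "u x \<le> 4 * \<bar>N t2 - N t1\<bar>"
        using pos by (intro small[OF r_t[OF x]]) (auto simp: radius_radius chord)
      then show ?thesis using B4 by linarith
    qed
  qed (use a_pos x \<epsilon>_abs rI wo.W_deriv wo.W_flux_deriv n_eq in auto)
  \<comment> \<open>The comparison holds at every point of the sphere, in particular at one where
    the extremum N t is attained.\<close>
  obtain x where x: "norm x = radius \<zeta> t" "u x = N t" using N_attained[of t] t t12 by auto
  then show ?thesis using comp[of x] t_r[OF t] by (simp add: chord)
qed

lemma subsolution_comparison:
  assumes "\<epsilon> = 1" "0 < t1" "t1 < t2" "t2 < T"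
    and "wo.laplace_sign * sgn (N t2 - N t1) = - 1"
    and le: "\<And>t. t \<in> {t1..t2} \<Longrightarrow> N t \<le> 4 * \<bar>N t2 - N t1\<bar>" and "t \<in> {t1..t2}"
  shows "N t \<le> chord Wt N t1 t2 t"
proof -
  have "\<epsilon> * (N t - chord Wt N t1 t2 t) \<le> 0"
  proof (rule chord_comparison)
    show "u x \<le> 4 * \<bar>N t2 - N t1\<bar>" if "s \<in> {t1..t2}" "norm x = radius \<zeta> s" for s x
      using N_extremal[of s x] le[of s] that assms(1-4) by auto
  qed (use assms in auto)
  then show ?thesis using assms(1) by simp
qed

text \<open>Only points with u below the chord matter, and there u is less than the larger end value
  of N; thus a condition on the end points replaces the bound over the whole interval in the
  subsolution case.\<close>

lemma supersolution_comparison: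
  assumes "\<epsilon> = - 1" "0 < t1" "t1 < t2" "t2 < T"
    and "wo.laplace_sign * sgn (N t2 - N t1) = 1"
    and le: "max (N t1) (N t2) \<le> 4 * \<bar>N t2 - N t1\<bar>" and "t \<in> {t1..t2}"
  shows "chord Wt N t1 t2 t \<le> N t"
proof -
  have "\<epsilon> * (N t - chord Wt N t1 t2 t) \<le> 0"
  proof (rule chord_comparison)
    show "u x \<le> 4 * \<bar>N t2 - N t1\<bar>"
      if "s \<in> {t1..t2}" "0 < \<epsilon> * (u x - chord Wt N t1 t2 s)" for s x
      using chord_le[of t1 t2 s] le that assms(1-4) by auto
  qed (use assms in auto)
  then show ?thesis using assms(1) by simp
qed

text \<open>In polar form u is uniformly continuous on a compact interval times the unit sphere.
  This continuity feeds the intermediate value argument for subsolutions.\<close>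

lemma N_continuous:
  assumes "\<epsilon> = 1"
  shows "continuous_on {0<..<T} N"
proof -
  have "isCont N t0" if t0: "t0 \<in> {0<..<T}" for t0
  proof -
    define c d where "c = t0 / 2" and "d = (t0 + T) / 2"
    have cd: "0 < c" "c < t0" "t0 < d" "d < T" using t0 by (auto simp: c_def d_def)
    have rad_cont: "continuous_on {c..d} (radius \<zeta>)"
      using cd by (cases "\<zeta> = 0") (auto simp: radius_def[abs_def] intro!: continuous_intros)
    define K where "K = {c..d} \<times> sphere (0::'a) 1"
    have "compact K" unfolding K_def by (intro compact_Times) auto
    have norm_K: "norm (radius \<zeta> s *\<^sub>R y) = radius \<zeta> s" if "(s, y) \<in> K" for s y
      using that cd radius_pos[of s \<zeta>] by (auto simp: K_def)
    have "continuous_on K (\<lambda>z. u (radius \<zeta> (fst z) *\<^sub>R snd z))"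
    proof (rule continuous_on_compose2[OF u_cont])
      show "continuous_on K (\<lambda>z. radius \<zeta> (fst z) *\<^sub>R snd z)"
        by (intro continuous_intros continuous_on_compose2[OF rad_cont]) (auto simp: K_def)
      show "(\<lambda>z. radius \<zeta> (fst z) *\<^sub>R snd z) ` K \<subseteq> D"
      proof
        fix v assume "v \<in> (\<lambda>z. radius \<zeta> (fst z) *\<^sub>R snd z) ` K"
        then obtain s y where sy: "(s, y) \<in> K" "v = radius \<zeta> s *\<^sub>R y" by auto
        then have "0 < s" "s < T" using cd by (auto simp: K_def)
        then show "v \<in> D" using norm_K[OF sy(1)] sy(2) by (intro rad_D[of s]) auto
      qed
    qed
    then have unif: "uniformly_continuous_on K (\<lambda>z. u (radius \<zeta> (fst z) *\<^sub>R snd z))"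
      using \<open>compact K\<close> by (rule compact_uniformly_continuous)
    have "continuous_on {c..d} N"
      unfolding continuous_on_iff
    proof (intro ballI allI impI)
      fix t and e :: real assume t: "t \<in> {c..d}" and "0 < e"
      then obtain \<delta> where \<delta>: "\<delta> > 0" "\<And>z z'. z \<in> K \<Longrightarrow> z' \<in> K \<Longrightarrow> dist z' z < \<delta> \<Longrightarrow>
          dist (u (radius \<zeta> (fst z') *\<^sub>R snd z')) (u (radius \<zeta> (fst z) *\<^sub>R snd z)) < e"
        using unif unfolding uniformly_continuous_on_def by meson
      \<comment> \<open>A maximum point on the sphere for s is moved along its ray to the sphere for
        s', where its value is at most N s'. Exchanging s and s' gives the other inequality.\<close>
      have le: "N s < N s' + e" if s: "s \<in> {c..d}" "s' \<in> {c..d}" "dist s s' < \<delta>" for s s'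
      proof -
        obtain x where x: "norm x = radius \<zeta> s" "u x = N s"
          using N_attained[of s] s cd by auto
        define y where "y = x /\<^sub>R radius \<zeta> s"
        have s0: "0 < radius \<zeta> s" using s cd by (intro radius_pos) auto
        have y: "norm y = 1" "x = radius \<zeta> s *\<^sub>R y" using s0 x by (auto simp: y_def)
        have K: "(s, y) \<in> K" "(s', y) \<in> K" using s y by (auto simp: K_def)
        have "dist (s, y) (s', y) < \<delta>" using s(3) by (simp add: dist_Pair_Pair)
        then have "N s < u (radius \<zeta> s' *\<^sub>R y) + e"
          using \<delta>(2)[OF K(2) K(1)] x y by (simp add: dist_real_def)
        also have "u (radius \<zeta> s' *\<^sub>R y) \<le> N s'"
          using N_extremal[of s' "radius \<zeta> s' *\<^sub>R y"] norm_K[OF K(2)] s cd assms by auto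
        finally show ?thesis by simp
      qed
      show "\<exists>\<delta>>0. \<forall>s\<in>{c..d}. dist s t < \<delta> \<longrightarrow> dist (N s) (N t) < e"
      proof (intro exI[of _ \<delta>] conjI ballI impI)
        fix s assume s: "s \<in> {c..d}" "dist s t < \<delta>"
        then have "N s < N t + e" "N t < N s + e" using t by (auto intro!: le simp: dist_commute)
        then show "dist (N s) (N t) < e" by (simp add: dist_real_def)
      qed (rule \<delta>(1))
    qed
    then show ?thesis using cd by (intro continuous_on_interior[of "{c..d}" N t0]) auto
  qed
  then show ?thesis by (simp add: continuous_at_imp_continuous_on)
qed

lemma limit_transfer:
  assumes ev: "\<zeta> = 0 \<Longrightarrow> eventually (\<lambda>x. P (u x)) (at 0)"
    "\<zeta> = \<infinity> \<Longrightarrow> eventually (\<lambda>x. P (u x)) at_infinity"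
  shows "\<exists>t0>0. \<forall>t. 0 < t \<and> t < t0 \<longrightarrow> P (N t)"
proof -
  obtain t0 where t0: "t0 > 0" "\<And>t x. 0 < t \<Longrightarrow> t < t0 \<Longrightarrow> norm x = radius \<zeta> t \<Longrightarrow> P (u x)"
  proof (cases "\<zeta> = 0")
    case True
    then show ?thesis using eventually_near_0[OF ev(1)] that by (auto simp: radius_def)
  next
    case False
    then show ?thesis using eventually_near_infinity[OF ev(2)] that wo.zeta by (auto simp: radius_def)
  qed
  show ?thesis
  proof (intro exI[of _ "min t0 T"] conjI allI impI)
    fix t assume t: "0 < t \<and> t < min t0 T"
    then obtain x where "norm x = radius \<zeta> t" "u x = N t" using N_attained[of t] by auto
    then show "P (N t)" using t0(2)[of t x] t by simp
  qed (use t0 T_pos in simp)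
qed

lemma laplace_sign_eq_1: "wo.laplace_sign = 1 \<longleftrightarrow> \<zeta> = 0 \<and> p \<le> real n \<or> \<zeta> = \<infinity> \<and> real n \<le> p"
  unfolding wo.laplace_sign_def wolff_base_def using wo.zeta by auto

text \<open>The sign condition of the comparison demands N t1 > N t2 if \<sigma> = 1 and N t1 < N t2
  if \<sigma> = - 1. The four limit conditions pair \<sigma> = 1 with blow-up and \<sigma> = - 1
  with decay to 0.\<close>

lemma subsolution_convex:
  assumes "\<epsilon> = 1"
    and lim: "\<zeta> = 0 \<and> p > real n \<and> (u \<longlongrightarrow> 0) (at 0) \<or>
         \<zeta> = 0 \<and> p \<le> real n \<and> filterlim u at_top (at 0) \<or>
         \<zeta> = \<infinity> \<and> p \<ge> real n \<and> filterlim u at_top at_infinity \<or>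
         \<zeta> = \<infinity> \<and> p < real n \<and> (u \<longlongrightarrow> 0) at_infinity"
  shows "convex_near_0" "monotone_near_0"
proof -
  have "convex_near_0 \<and> monotone_near_0"
  proof (cases "wo.laplace_sign = 1")
    case True
    then have top: "\<zeta> = 0 \<Longrightarrow> filterlim u at_top (at 0)" "\<zeta> = \<infinity> \<Longrightarrow> filterlim u at_top at_infinity"
      using lim unfolding laplace_sign_eq_1 by auto
    have "\<exists>t0>0. \<forall>t. 0 < t \<and> t < t0 \<longrightarrow> K < N t" for K
      using top by (intro limit_transfer) (auto simp: filterlim_at_top_dense)
    then show ?thesis
      using True assms(1)
      by (intro conjI subsolution_unbounded N_continuous) (auto intro!: subsolution_comparison)
  next
    case False
    then have s: "wo.laplace_sign = - 1" unfolding wo.laplace_sign_def by (auto split: if_splits)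
    from False have zero: "\<zeta> = 0 \<Longrightarrow> (u \<longlongrightarrow> 0) (at 0)" "\<zeta> = \<infinity> \<Longrightarrow> (u \<longlongrightarrow> 0) at_infinity"
      using lim unfolding laplace_sign_eq_1 by auto
    have "\<exists>t0>0. \<forall>t. 0 < t \<and> t < t0 \<longrightarrow> N t < e" if "0 < e" for e
      using zero that by (intro limit_transfer) (auto intro: order_tendstoD)
    then show ?thesis
      using s assms(1)
      by (intro conjI subsolution_vanishing N_continuous) (auto intro!: subsolution_comparison)
  qed
  then show "convex_near_0" "monotone_near_0" by auto
qed

text \<open>For \<epsilon> = - 1 the required sign of the increment is the opposite one, and so are
  the limits paired with the two values of \<sigma>.\<close>

lemma supersolution_concave:
  assumes "\<epsilon> = - 1"
    and lim: "\<zeta> = 0 \<and> p > real n \<and> filterlim u at_top (at 0) \<or>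
         \<zeta> = 0 \<and> p \<le> real n \<and> (u \<longlongrightarrow> 0) (at 0) \<or>
         \<zeta> = \<infinity> \<and> p \<ge> real n \<and> (u \<longlongrightarrow> 0) at_infinity \<or>
         \<zeta> = \<infinity> \<and> p < real n \<and> filterlim u at_top at_infinity"
  shows "concave_near_0" "monotone_near_0"
proof -
  have "concave_near_0 \<and> monotone_near_0"
  proof (cases "wo.laplace_sign = 1")
    case True
    then have zero: "\<zeta> = 0 \<Longrightarrow> (u \<longlongrightarrow> 0) (at 0)" "\<zeta> = \<infinity> \<Longrightarrow> (u \<longlongrightarrow> 0) at_infinity"
      using lim unfolding laplace_sign_eq_1 by auto
    have "\<exists>t0>0. \<forall>t. 0 < t \<and> t < t0 \<longrightarrow> N t < e" if "0 < e" for e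
      using zero that by (intro limit_transfer) (auto intro: order_tendstoD)
    then show ?thesis
      using True assms(1)
      by (intro conjI supersolution_vanishing) (auto intro!: supersolution_comparison)
  next
    case False
    then have s: "wo.laplace_sign = - 1" unfolding wo.laplace_sign_def by (auto split: if_splits)
    from False have top: "\<zeta> = 0 \<Longrightarrow> filterlim u at_top (at 0)" "\<zeta> = \<infinity> \<Longrightarrow> filterlim u at_top at_infinity"
      using lim unfolding laplace_sign_eq_1 by auto
    have "\<exists>t0>0. \<forall>t. 0 < t \<and> t < t0 \<longrightarrow> K < N t" for K
      using top by (intro limit_transfer) (auto simp: filterlim_at_top_dense)
    then show ?thesis
      using s assms(1)
      by (intro conjI supersolution_unbounded) (auto intro!: supersolution_comparison)
  qed
  then show "concave_near_0" "monotone_near_0" by auto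
qed

end

section \<open>Localisation near \<zeta>\<close>

lemma (in wolff) radii_near_zeta:
  fixes D U :: "'a::euclidean_space set"
  assumes "punctured_nbhd \<zeta> D" "punctured_nbhd \<zeta> U"
  shows "\<exists>T>0. \<forall>t. 0 < t \<and> t < T \<longrightarrow> radius \<zeta> t \<in> I \<and> W (radius \<zeta> t) \<le> 1 / 4 \<and>
    (\<forall>x. norm x = radius \<zeta> t \<longrightarrow> x \<in> D \<and> x \<in> U)"
proof -
  obtain c where c: "c \<in> I" "W c < 1 / 4" using W_small[of "1 / 4"] by auto
  have c_pos: "0 < c" by (rule I_pos[OF c(1)])
  show ?thesis
  proof (cases "\<zeta> = 0")
    case True
    obtain r s where r: "0 < r" "ball 0 r - {0} \<subseteq> D" and s: "0 < s" "ball 0 s - {0} \<subseteq> U"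
      using assms True by (auto simp: punctured_nbhd_def)
    have z: "zeta_sign = 1" unfolding zeta_sign_def using True by simp
    show ?thesis
    proof (intro exI[of _ "min c (min r s)"] conjI allI impI)
      fix t assume t: "0 < t \<and> t < min c (min r s)"
      have "ereal t < 1" using t c(1) lo_hi True less_trans[of "ereal t" "ereal c" 1]
        by (auto simp: einterval_iff)
      then show tI: "radius \<zeta> t \<in> I" using t True lo_hi by (auto simp: radius_def einterval_iff)
      have "radius \<zeta> t < c" using t True by (simp add: radius_def)
      then show "W (radius \<zeta> t) \<le> 1 / 4"
        using outer.F_strict[OF tI c(1)] c(2) by (simp add: W_eq[OF tI] W_eq[OF c(1)] z)
      fix x :: 'a assume "norm x = radius \<zeta> t"
      then have "x \<in> ball 0 r - {0}" "x \<in> ball 0 s - {0}" using t True by (auto simp: radius_def)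
      then show "x \<in> D" "x \<in> U" using r s by auto
    qed (use c_pos r s in auto)
  next
    case False
    obtain r s where r: "0 < r" "- cball 0 r \<subseteq> D" and s: "0 < s" "- cball 0 s \<subseteq> U"
      using assms False by (auto simp: punctured_nbhd_def)
    have z: "zeta_sign = - 1" unfolding zeta_sign_def using False by simp
    define m where "m = max c (max r s)"
    have m: "0 < m" "c \<le> m" "r \<le> m" "s \<le> m" using c_pos by (auto simp: m_def)
    show ?thesis
    proof (intro exI[of _ "1 / m"] conjI allI impI)
      fix t assume t: "0 < t \<and> t < 1 / m"
      then have "m < 1 / t" using m(1) by (simp add: field_simps)
      then have R: "m < radius \<zeta> t" using False by (simp add: radius_def)
      have "1 < ereal (radius \<zeta> t)"
        using R m c(1) lo_hi False less_trans[of 1 "ereal c" "ereal (radius \<zeta> t)"]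
        by (auto simp: einterval_iff)
      then show tI: "radius \<zeta> t \<in> I" using False lo_hi by (auto simp: einterval_iff)
      have "c < radius \<zeta> t" using R m by simp
      then show "W (radius \<zeta> t) \<le> 1 / 4"
        using outer.F_strict[OF c(1) tI] c(2) by (simp add: W_eq[OF tI] W_eq[OF c(1)] z)
      fix x :: 'a assume "norm x = radius \<zeta> t"
      then have "x \<in> - cball 0 r" "x \<in> - cball 0 s" using R m by auto
      then show "x \<in> D" "x \<in> U" using r s by auto
    qed (use m in simp)
  qed
qed

text \<open>E stands for the supremum or infimum over spheres; only its extremality and attainment
  are used, so both halves of the theorem share this construction of T.\<close>

lemma radial_comparison_exists:
  fixes V u :: "'a::euclidean_space \<Rightarrow> real"
  assumes p: "1 < p" and zeta: "\<zeta> = 0 \<or> \<zeta> = \<infinity>"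
    and V: "Linf_loc (Omega_minus_zeta \<zeta> R) V" and C1: "condition_C1 p \<zeta> g V"
    and nbhd: "punctured_nbhd \<zeta> D" "D \<subseteq> Omega_minus_zeta \<zeta> R"
    and u: "Ck_on 1 D u" "\<And>x. x \<in> D \<Longrightarrow> 0 < u x" and \<epsilon>: "\<bar>\<epsilon>\<bar> = 1"
    and weak: "\<And>\<phi>. test_function D \<phi> \<Longrightarrow> \<forall>x. 0 \<le> \<phi> x \<Longrightarrow> \<epsilon> * weak_form p V D u \<phi> \<le> 0"
    and E: "\<And>r. 0 < r \<Longrightarrow> sphere 0 r \<subseteq> D \<Longrightarrow>
      (\<forall>x\<in>sphere 0 r. \<epsilon> * (u x - E r) \<le> 0) \<and> (\<exists>x\<in>sphere 0 r. u x = E r)"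
  shows "\<exists>T. radial_comparison p \<epsilon> V u D DIM('a) \<zeta> g T (\<lambda>t. E (radius \<zeta> t))"
proof -
  interpret weak_inequality p \<epsilon> V u D
  proof
    show "open D" using nbhd(1) by (simp add: punctured_nbhd_def)
    show "V \<in> borel_measurable (lebesgue_on D)"
      using V unfolding Linf_loc_def by (blast intro: measurable_restrict_mono[OF _ nbhd(2)])
    show "\<exists>C. AE x in lebesgue. x \<in> K \<longrightarrow> \<bar>V x\<bar> \<le> C" if "compact K" "K \<subseteq> D" for K
      using V that(1) order_trans[OF that(2) nbhd(2)] unfolding Linf_loc_def by blast
  qed (use p u weak in auto)
  interpret wo: wolff p "DIM('a)" \<zeta> g
    by standard (use p zeta C1 in \<open>auto simp: condition_C1_def Suc_le_eq\<close>)
  obtain U :: "'a set" where U: "punctured_nbhd \<zeta> U"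
    and VU: "AE x in lebesgue. x \<in> U \<longrightarrow> \<bar>V x\<bar> \<le> g (norm x) / norm x powr p"
    using C1 unfolding condition_C1_def by blast
  obtain T where T: "T > 0" and rad: "\<And>t. 0 < t \<Longrightarrow> t < T \<Longrightarrow> radius \<zeta> t \<in> wo.I \<and>
      wo.W (radius \<zeta> t) \<le> 1 / 4 \<and> (\<forall>x::'a. norm x = radius \<zeta> t \<longrightarrow> x \<in> D \<and> x \<in> U)"
    using wo.radii_near_zeta[OF nbhd(1) U] by blast
  have ext: "(\<forall>x\<in>sphere 0 (radius \<zeta> t). \<epsilon> * (u x - E (radius \<zeta> t)) \<le> 0) \<and>
      (\<exists>x\<in>sphere 0 (radius \<zeta> t). u x = E (radius \<zeta> t))" if "0 < t" "t < T" for t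
    using rad[OF that] that by (intro E radius_pos) auto
  have "radial_comparison p \<epsilon> V u D DIM('a) \<zeta> g T (\<lambda>t. E (radius \<zeta> t))"
  proof unfold_locales
    show "AE x in lebesgue. (\<exists>t>0. t < T \<and> norm x = radius \<zeta> t) \<longrightarrow> \<bar>V x\<bar> \<le> g (norm x) / norm x powr p"
      using VU by eventually_elim (use rad in blast)
    show "\<epsilon> * (u x - E (radius \<zeta> t)) \<le> 0" if "0 < t" "t < T" "norm x = radius \<zeta> t" for t x
      using ext[OF that(1,2)] that(3) by auto
    show "\<exists>x. norm x = radius \<zeta> t \<and> u x = E (radius \<zeta> t)" if "0 < t" "t < T" for t
      using ext[OF that] by auto
  qed (use T \<epsilon> rad in auto)
  then show ?thesis ..
qed

section \<open>Extrema over spheres and the two halves of the theorem\<close>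

lemma sphere_nonempty:
  assumes "0 < r"
  shows "sphere (0 :: 'a::euclidean_space) r \<noteq> {}"
proof -
  obtain x :: 'a where "norm x = r" using vector_choose_size[of r] assms by auto
  then show ?thesis by auto
qed

lemma SUP_attained:
  fixes u :: "'a::topological_space \<Rightarrow> real"
  assumes "compact S" "S \<noteq> {}" "continuous_on S u"
  shows "(\<forall>x\<in>S. u x \<le> (SUP x\<in>S. u x)) \<and> (\<exists>x\<in>S. u x = (SUP x\<in>S. u x))"
proof -
  obtain x where x: "x \<in> S" "\<And>y. y \<in> S \<Longrightarrow> u y \<le> u x"
    using continuous_attains_sup[OF assms] by blast
  then have "(SUP x\<in>S. u x) = u x" by (intro cSup_eq_maximum) auto
  then show ?thesis using x by auto
qed

lemma INF_attained:
  fixes u :: "'a::topological_space \<Rightarrow> real"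
  assumes "compact S" "S \<noteq> {}" "continuous_on S u"
  shows "(\<forall>x\<in>S. (INF x\<in>S. u x) \<le> u x) \<and> (\<exists>x\<in>S. u x = (INF x\<in>S. u x))"
proof -
  obtain x where x: "x \<in> S" "\<And>y. y \<in> S \<Longrightarrow> u x \<le> u y"
    using continuous_attains_inf[OF assms] by blast
  then have "(INF x\<in>S. u x) = u x" by (intro cInf_eq_minimum) auto
  then show ?thesis using x by auto
qed

lemma subsolution_three_spheres:
  fixes V u :: "'a::euclidean_space \<Rightarrow> real" and p :: real and \<zeta> :: ereal and g :: "real \<Rightarrow> real"
  defines "W \<equiv> wolff_potential p DIM('a) \<zeta> g"
  assumes "1 < p" and zeta: "\<zeta> = 0 \<or> \<zeta> = \<infinity>"
    and "Linf_loc (Omega_minus_zeta \<zeta> R) V" and "condition_C1 p \<zeta> g V"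
    and "punctured_nbhd \<zeta> D" "D \<subseteq> Omega_minus_zeta \<zeta> R"
    and u: "subsolution p V D u" "\<forall>x\<in>D. 0 < u x"
    and lim: "\<zeta> = 0 \<and> p > real DIM('a) \<and> (u \<longlongrightarrow> 0) (at 0) \<or>
         \<zeta> = 0 \<and> p \<le> real DIM('a) \<and> filterlim u at_top (at 0) \<or>
         \<zeta> = \<infinity> \<and> p \<ge> real DIM('a) \<and> filterlim u at_top at_infinity \<or>
         \<zeta> = \<infinity> \<and> p < real DIM('a) \<and> (u \<longlongrightarrow> 0) at_infinity"
    and M: "M = (\<lambda>r. SUP x\<in>sphere 0 r. u x)"
  shows "\<exists>R2>0. \<forall>t2. 0 < t2 \<and> t2 < R2 \<longrightarrow> (\<exists>R1. 0 < R1 \<and> R1 < t2 \<and>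
      (\<forall>t1. 0 < t1 \<and> t1 < R1 \<longrightarrow> (\<forall>t3\<in>{t1<..<t2}.
        M (radius \<zeta> t3) \<le> chord (\<lambda>t. W (radius \<zeta> t)) (\<lambda>t. M (radius \<zeta> t)) t1 t2 t3)))" (is ?convex)
    and "\<exists>\<rho>>0. mono_on {0<..<\<rho>} (\<lambda>t. M (radius \<zeta> t)) \<or> antimono_on {0<..<\<rho>} (\<lambda>t. M (radius \<zeta> t))" (is ?mono)
proof -
  have u_C1: "Ck_on 1 D u" using u(1) by (simp add: subsolution_def)
  have ext: "(\<forall>x\<in>sphere 0 r. 1 * (u x - M r) \<le> 0) \<and> (\<exists>x\<in>sphere 0 r. u x = M r)"
    if "0 < r" "sphere 0 r \<subseteq> D" for r
    using SUP_attained[of "sphere 0 r" u] sphere_nonempty[OF that(1), where 'a = 'a]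
      continuous_on_subset[OF _ that(2)] Ck_on_SucD[of 0 D u] u_C1
    by (auto simp: M)
  have "\<exists>T. radial_comparison p 1 V u D DIM('a) \<zeta> g T (\<lambda>t. M (radius \<zeta> t))"
    by (rule radial_comparison_exists[where R = R])
       (use assms u_C1 ext in \<open>auto simp: subsolution_def\<close>)
  then obtain T where "radial_comparison p 1 V u D DIM('a) \<zeta> g T (\<lambda>t. M (radius \<zeta> t))" ..
  then interpret rc: radial_comparison p 1 V u D "DIM('a)" \<zeta> g T "\<lambda>t. M (radius \<zeta> t)" .
  show ?convex ?mono
    using rc.subsolution_convex[OF refl lim]
    unfolding rc.convex_near_0_def rc.monotone_near_0_def W_def by simp_all
qed

lemma supersolution_three_spheres:
  fixes V u :: "'a::euclidean_space \<Rightarrow> real" and p :: real and \<zeta> :: ereal and g :: "real \<Rightarrow> real"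
  defines "W \<equiv> wolff_potential p DIM('a) \<zeta> g"
  assumes "1 < p" and zeta: "\<zeta> = 0 \<or> \<zeta> = \<infinity>"
    and "Linf_loc (Omega_minus_zeta \<zeta> R) V" and "condition_C1 p \<zeta> g V"
    and "punctured_nbhd \<zeta> D" "D \<subseteq> Omega_minus_zeta \<zeta> R"
    and u: "supersolution p V D u" "\<forall>x\<in>D. 0 < u x"
    and lim: "\<zeta> = 0 \<and> p > real DIM('a) \<and> filterlim u at_top (at 0) \<or>
         \<zeta> = 0 \<and> p \<le> real DIM('a) \<and> (u \<longlongrightarrow> 0) (at 0) \<or>
         \<zeta> = \<infinity> \<and> p \<ge> real DIM('a) \<and> (u \<longlongrightarrow> 0) at_infinity \<or>
         \<zeta> = \<infinity> \<and> p < real DIM('a) \<and> filterlim u at_top at_infinity"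
    and m: "m = (\<lambda>r. INF x\<in>sphere 0 r. u x)"
  shows "\<exists>R2>0. \<forall>t2. 0 < t2 \<and> t2 < R2 \<longrightarrow> (\<exists>R1. 0 < R1 \<and> R1 < t2 \<and>
      (\<forall>t1. 0 < t1 \<and> t1 < R1 \<longrightarrow> (\<forall>t3\<in>{t1<..<t2}.
        chord (\<lambda>t. W (radius \<zeta> t)) (\<lambda>t. m (radius \<zeta> t)) t1 t2 t3 \<le> m (radius \<zeta> t3))))" (is ?concave)
    and "\<exists>\<rho>>0. mono_on {0<..<\<rho>} (\<lambda>t. m (radius \<zeta> t)) \<or> antimono_on {0<..<\<rho>} (\<lambda>t. m (radius \<zeta> t))" (is ?mono)
proof -
  have u_C1: "Ck_on 1 D u" using u(1) by (simp add: supersolution_def)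
  have ext: "(\<forall>x\<in>sphere 0 r. (- 1) * (u x - m r) \<le> 0) \<and> (\<exists>x\<in>sphere 0 r. u x = m r)"
    if "0 < r" "sphere 0 r \<subseteq> D" for r
    using INF_attained[of "sphere 0 r" u] sphere_nonempty[OF that(1), where 'a = 'a]
      continuous_on_subset[OF _ that(2)] Ck_on_SucD[of 0 D u] u_C1
    by (auto simp: m)
  have "\<exists>T. radial_comparison p (- 1) V u D DIM('a) \<zeta> g T (\<lambda>t. m (radius \<zeta> t))"
    by (rule radial_comparison_exists[where R = R])
       (use assms u_C1 ext in \<open>auto simp: supersolution_def\<close>)
  then obtain T where "radial_comparison p (- 1) V u D DIM('a) \<zeta> g T (\<lambda>t. m (radius \<zeta> t))" ..
  then interpret rc: radial_comparison p "- 1" V u D "DIM('a)" \<zeta> g T "\<lambda>t. m (radius \<zeta> t)" .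
  show ?concave ?mono
    using rc.supersolution_concave[OF refl lim]
    unfolding rc.concave_near_0_def rc.monotone_near_0_def W_def by simp_all
qed

theorem theorem5p1:
  fixes p R :: real and \<zeta> :: ereal
    and V :: "real ^ 'n \<Rightarrow> real" and g :: "real \<Rightarrow> real"
  defines "W \<equiv> wolff_potential p CARD('n) \<zeta> g"
  assumes p: "1 < p" and d: "CARD('n) \<ge> 2" and R: "0 < R"
    and zeta: "\<zeta> = 0 \<or> \<zeta> = \<infinity>"
    and V: "Linf_loc (Omega_minus_zeta \<zeta> R) V"
    and C1: "condition_C1 p \<zeta> g V"
  shows
    "(\<forall>D u M.
        punctured_nbhd \<zeta> D \<and> D \<subseteq> Omega_minus_zeta \<zeta> R \<and>
        subsolution p V D u \<and> (\<forall>x\<in>D. 0 < u x) \<and>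
        (\<zeta> = 0 \<and> p > real CARD('n) \<and> (u \<longlongrightarrow> 0) (at 0) \<or>
         \<zeta> = 0 \<and> p \<le> real CARD('n) \<and> filterlim u at_top (at 0) \<or>
         \<zeta> = \<infinity> \<and> p \<ge> real CARD('n) \<and> filterlim u at_top at_infinity \<or>
         \<zeta> = \<infinity> \<and> p < real CARD('n) \<and> (u \<longlongrightarrow> 0) at_infinity) \<and>
        M = (\<lambda>r. SUP x\<in>sphere 0 r. u x) \<longrightarrow>
        (\<zeta> = 0 \<longrightarrow>
          (\<exists>R2>0. \<forall>r2. 0 < r2 \<and> r2 < R2 \<longrightarrow>
             (\<exists>R1. 0 < R1 \<and> R1 < r2 \<and>
                (\<forall>r1. 0 < r1 \<and> r1 < R1 \<longrightarrow>
                   (\<forall>r3\<in>{r1<..<r2}.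
                      M r3 \<le> M r1 * ((W r2 - W r3) / (W r2 - W r1))
                            + M r2 * ((W r3 - W r1) / (W r2 - W r1)))))) \<and>
          (\<exists>\<rho>>0. mono_on {0<..<\<rho>} M \<or> antimono_on {0<..<\<rho>} M)) \<and>
        (\<zeta> = \<infinity> \<longrightarrow>
          (\<exists>R2>0. \<forall>r2. r2 > R2 \<longrightarrow>
             (\<exists>R1. R1 > r2 \<and>
                (\<forall>r1. r1 > R1 \<longrightarrow>
                   (\<forall>r3\<in>{r2<..<r1}.
                      M r3 \<le> M r1 * ((W r2 - W r3) / (W r2 - W r1))
                            + M r2 * ((W r3 - W r1) / (W r2 - W r1)))))) \<and>
          (\<exists>\<rho>>0. mono_on {\<rho><..} M \<or> antimono_on {\<rho><..} M)))
     \<and>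
     (\<forall>D u m.
        punctured_nbhd \<zeta> D \<and> D \<subseteq> Omega_minus_zeta \<zeta> R \<and>
        supersolution p V D u \<and> (\<forall>x\<in>D. 0 < u x) \<and>
        (\<zeta> = 0 \<and> p > real CARD('n) \<and> filterlim u at_top (at 0) \<or>
         \<zeta> = 0 \<and> p \<le> real CARD('n) \<and> (u \<longlongrightarrow> 0) (at 0) \<or>
         \<zeta> = \<infinity> \<and> p \<ge> real CARD('n) \<and> (u \<longlongrightarrow> 0) at_infinity \<or>
         \<zeta> = \<infinity> \<and> p < real CARD('n) \<and> filterlim u at_top at_infinity) \<and>
        m = (\<lambda>r. INF x\<in>sphere 0 r. u x) \<longrightarrow>
        (\<zeta> = 0 \<longrightarrow>
          (\<exists>R2>0. \<forall>r2. 0 < r2 \<and> r2 < R2 \<longrightarrow>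
             (\<exists>R1. 0 < R1 \<and> R1 < r2 \<and>
                (\<forall>r1. 0 < r1 \<and> r1 < R1 \<longrightarrow>
                   (\<forall>r3\<in>{r1<..<r2}.
                      m r1 * ((W r2 - W r3) / (W r2 - W r1))
                      + m r2 * ((W r3 - W r1) / (W r2 - W r1)) \<le> m r3)))) \<and>
          (\<exists>\<rho>>0. mono_on {0<..<\<rho>} m \<or> antimono_on {0<..<\<rho>} m)) \<and>
        (\<zeta> = \<infinity> \<longrightarrow>
          (\<exists>R2>0. \<forall>r2. r2 > R2 \<longrightarrow>
             (\<exists>R1. R1 > r2 \<and>
                (\<forall>r1. r1 > R1 \<longrightarrow>
                   (\<forall>r3\<in>{r2<..<r1}.
                      m r1 * ((W r2 - W r3) / (W r2 - W r1))
                      + m r2 * ((W r3 - W r1) / (W r2 - W r1)) \<le> m r3)))) \<and>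
          (\<exists>\<rho>>0. mono_on {\<rho><..} m \<or> antimono_on {\<rho><..} m)))"
proof (rule conjI; intro allI impI)
  fix D :: "(real ^ 'n) set" and u M
  assume *: "punctured_nbhd \<zeta> D \<and> D \<subseteq> Omega_minus_zeta \<zeta> R \<and>
        subsolution p V D u \<and> (\<forall>x\<in>D. 0 < u x) \<and>
        (\<zeta> = 0 \<and> p > real CARD('n) \<and> (u \<longlongrightarrow> 0) (at 0) \<or>
         \<zeta> = 0 \<and> p \<le> real CARD('n) \<and> filterlim u at_top (at 0) \<or>
         \<zeta> = \<infinity> \<and> p \<ge> real CARD('n) \<and> filterlim u at_top at_infinity \<or>
         \<zeta> = \<infinity> \<and> p < real CARD('n) \<and> (u \<longlongrightarrow> 0) at_infinity) \<and>
        M = (\<lambda>r. SUP x\<in>sphere 0 r. u x)"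
  \<comment> \<open>The dimension \<open>DIM('a)\<close> of the general statement becomes
    \<open>CARD('n)\<close> here, so that the potential is literally W.\<close>
  note sub = subsolution_three_spheres[OF p zeta V C1, of D u M, unfolded DIM_cart DIM_real mult_1_right, folded W_def]
  show "(\<zeta> = 0 \<longrightarrow>
          (\<exists>R2>0. \<forall>r2. 0 < r2 \<and> r2 < R2 \<longrightarrow>
             (\<exists>R1. 0 < R1 \<and> R1 < r2 \<and>
                (\<forall>r1. 0 < r1 \<and> r1 < R1 \<longrightarrow>
                   (\<forall>r3\<in>{r1<..<r2}.
                      M r3 \<le> M r1 * ((W r2 - W r3) / (W r2 - W r1))
                            + M r2 * ((W r3 - W r1) / (W r2 - W r1)))))) \<and>
          (\<exists>\<rho>>0. mono_on {0<..<\<rho>} M \<or> antimono_on {0<..<\<rho>} M)) \<and>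
        (\<zeta> = \<infinity> \<longrightarrow>
          (\<exists>R2>0. \<forall>r2. r2 > R2 \<longrightarrow>
             (\<exists>R1. R1 > r2 \<and>
                (\<forall>r1. r1 > R1 \<longrightarrow>
                   (\<forall>r3\<in>{r2<..<r1}.
                      M r3 \<le> M r1 * ((W r2 - W r3) / (W r2 - W r1))
                            + M r2 * ((W r3 - W r1) / (W r2 - W r1)))))) \<and>
          (\<exists>\<rho>>0. mono_on {\<rho><..} M \<or> antimono_on {\<rho><..} M))"
  proof (intro conjI impI)
    assume "\<zeta> = 0"
    then have rad: "radius \<zeta> = (\<lambda>t. t)" by (simp add: radius_def fun_eq_iff)
    show "\<exists>R2>0. \<forall>r2. 0 < r2 \<and> r2 < R2 \<longrightarrow>
             (\<exists>R1. 0 < R1 \<and> R1 < r2 \<and>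
                (\<forall>r1. 0 < r1 \<and> r1 < R1 \<longrightarrow>
                   (\<forall>r3\<in>{r1<..<r2}.
                      M r3 \<le> M r1 * ((W r2 - W r3) / (W r2 - W r1))
                            + M r2 * ((W r3 - W r1) / (W r2 - W r1)))))"
      using sub(1) * unfolding rad chord_def by blast
    show "\<exists>\<rho>>0. mono_on {0<..<\<rho>} M \<or> antimono_on {0<..<\<rho>} M"
      using sub(2) * unfolding rad by blast
  next
    assume "\<zeta> = \<infinity>"
    then have rad: "radius \<zeta> = (\<lambda>t. 1 / t)" by (simp add: radius_def fun_eq_iff)
    \<comment> \<open>With t = 1/r the ordering t1 < t3 < t2 becomes r2 < r3 < r1, and t1 near 0
      means r1 large.\<close>
    have "\<exists>R2>0. \<forall>t2. 0 < t2 \<and> t2 < R2 \<longrightarrow> (\<exists>R1. 0 < R1 \<and> R1 < t2 \<and>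
      (\<forall>t1. 0 < t1 \<and> t1 < R1 \<longrightarrow> (\<forall>t3\<in>{t1<..<t2}.
        M (1 / t3) \<le> chord (\<lambda>t. W (1 / t)) (\<lambda>t. M (1 / t)) t1 t2 t3)))"
      using sub(1) * unfolding rad by blast
    from near_infinity[OF this]
    show "\<exists>R2>0. \<forall>r2. r2 > R2 \<longrightarrow>
             (\<exists>R1. R1 > r2 \<and>
                (\<forall>r1. r1 > R1 \<longrightarrow>
                   (\<forall>r3\<in>{r2<..<r1}.
                      M r3 \<le> M r1 * ((W r2 - W r3) / (W r2 - W r1))
                            + M r2 * ((W r3 - W r1) / (W r2 - W r1)))))"
      by (simp add: chord_def)
    have "\<exists>\<rho>>0. mono_on {0<..<\<rho>} (\<lambda>t. M (1 / t)) \<or> antimono_on {0<..<\<rho>} (\<lambda>t. M (1 / t))"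
      using sub(2) * unfolding rad by blast
    then show "\<exists>\<rho>>0. mono_on {\<rho><..} M \<or> antimono_on {\<rho><..} M"
      by (rule monotone_near_infinity)
  qed
next
  fix D :: "(real ^ 'n) set" and u m
  assume *: "punctured_nbhd \<zeta> D \<and> D \<subseteq> Omega_minus_zeta \<zeta> R \<and>
        supersolution p V D u \<and> (\<forall>x\<in>D. 0 < u x) \<and>
        (\<zeta> = 0 \<and> p > real CARD('n) \<and> filterlim u at_top (at 0) \<or>
         \<zeta> = 0 \<and> p \<le> real CARD('n) \<and> (u \<longlongrightarrow> 0) (at 0) \<or>
         \<zeta> = \<infinity> \<and> p \<ge> real CARD('n) \<and> (u \<longlongrightarrow> 0) at_infinity \<or>
         \<zeta> = \<infinity> \<and> p < real CARD('n) \<and> filterlim u at_top at_infinity) \<and>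
        m = (\<lambda>r. INF x\<in>sphere 0 r. u x)"
  note super = supersolution_three_spheres[OF p zeta V C1, of D u m, unfolded DIM_cart DIM_real mult_1_right, folded W_def]
  show "(\<zeta> = 0 \<longrightarrow>
          (\<exists>R2>0. \<forall>r2. 0 < r2 \<and> r2 < R2 \<longrightarrow>
             (\<exists>R1. 0 < R1 \<and> R1 < r2 \<and>
                (\<forall>r1. 0 < r1 \<and> r1 < R1 \<longrightarrow>
                   (\<forall>r3\<in>{r1<..<r2}.
                      m r1 * ((W r2 - W r3) / (W r2 - W r1))
                      + m r2 * ((W r3 - W r1) / (W r2 - W r1)) \<le> m r3)))) \<and>
          (\<exists>\<rho>>0. mono_on {0<..<\<rho>} m \<or> antimono_on {0<..<\<rho>} m)) \<and>
        (\<zeta> = \<infinity> \<longrightarrow>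
          (\<exists>R2>0. \<forall>r2. r2 > R2 \<longrightarrow>
             (\<exists>R1. R1 > r2 \<and>
                (\<forall>r1. r1 > R1 \<longrightarrow>
                   (\<forall>r3\<in>{r2<..<r1}.
                      m r1 * ((W r2 - W r3) / (W r2 - W r1))
                      + m r2 * ((W r3 - W r1) / (W r2 - W r1)) \<le> m r3)))) \<and>
          (\<exists>\<rho>>0. mono_on {\<rho><..} m \<or> antimono_on {\<rho><..} m))"
  proof (intro conjI impI)
    assume "\<zeta> = 0"
    then have rad: "radius \<zeta> = (\<lambda>t. t)" by (simp add: radius_def fun_eq_iff)
    show "\<exists>R2>0. \<forall>r2. 0 < r2 \<and> r2 < R2 \<longrightarrow>
             (\<exists>R1. 0 < R1 \<and> R1 < r2 \<and>
                (\<forall>r1. 0 < r1 \<and> r1 < R1 \<longrightarrow>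
                   (\<forall>r3\<in>{r1<..<r2}.
                      m r1 * ((W r2 - W r3) / (W r2 - W r1))
                      + m r2 * ((W r3 - W r1) / (W r2 - W r1)) \<le> m r3)))"
      using super(1) * unfolding rad chord_def by blast
    show "\<exists>\<rho>>0. mono_on {0<..<\<rho>} m \<or> antimono_on {0<..<\<rho>} m"
      using super(2) * unfolding rad by blast
  next
    assume "\<zeta> = \<infinity>"
    then have rad: "radius \<zeta> = (\<lambda>t. 1 / t)" by (simp add: radius_def fun_eq_iff)
    have "\<exists>R2>0. \<forall>t2. 0 < t2 \<and> t2 < R2 \<longrightarrow> (\<exists>R1. 0 < R1 \<and> R1 < t2 \<and>
      (\<forall>t1. 0 < t1 \<and> t1 < R1 \<longrightarrow> (\<forall>t3\<in>{t1<..<t2}.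
        chord (\<lambda>t. W (1 / t)) (\<lambda>t. m (1 / t)) t1 t2 t3 \<le> m (1 / t3))))"
      using super(1) * unfolding rad by blast
    from near_infinity[OF this]
    show "\<exists>R2>0. \<forall>r2. r2 > R2 \<longrightarrow>
             (\<exists>R1. R1 > r2 \<and>
                (\<forall>r1. r1 > R1 \<longrightarrow>
                   (\<forall>r3\<in>{r2<..<r1}.
                      m r1 * ((W r2 - W r3) / (W r2 - W r1))
                      + m r2 * ((W r3 - W r1) / (W r2 - W r1)) \<le> m r3)))"
      by (simp add: chord_def)
    have "\<exists>\<rho>>0. mono_on {0<..<\<rho>} (\<lambda>t. m (1 / t)) \<or> antimono_on {0<..<\<rho>} (\<lambda>t. m (1 / t))"
      using super(2) * unfolding rad by blast
    then show "\<exists>\<rho>>0. mono_on {\<rho><..} m \<or> antimono_on {\<rho><..} m"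
      by (rule monotone_near_infinity)
  qed
qed

end
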